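(* Let $s\ge\frac12$. There is a constant $C$ (depending only on $s$ and $\eta$) such that for all $0<T<1$ and all $u\in Z^{s,\frac12}$, $$\Big\|\eta\Big(\frac tT\Big)|u|^2u\Big\|_{Z^{s,-\frac12}}\le C\,T^{\frac16}\,\|u\|^3_{Z^{s,\frac12}}.$$
   Context: Functions are defined on $\mathbb{T}^2=[0,2\pi]_x\times[0,2\pi]_t$ (periodic in both variables), with space-time Fourier coefficients $\widehat u(n,\tau)$, $(n,\tau)\in\mathbb{Z}^2$. Let $P(n)=n^3-2n^2+8n$ and $\langle y\rangle=1+|y|$. Define $$\|u\|_{X^{s,b}}=\Big(\sum_{n}\langle n\rangle^{2s}\sum_{\tau}\langle\tau-P(n)\rangle^{2b}|\widehat u(n,\tau)|^2\Big)^{1/2},\qquad \|u\|_{Y^{s,b}}=\Big[\sum_{n}\langle n\rangle^{2s}\Big(\sum_{\tau}\langle\tau-P(n)\rangle^{b}|\widehat u(n,\tau)|\Big)^2\Big]^{1/2},$$ and $Z^{s,b}=X^{s,b}\cap Y^{s,b-\frac12}$ with norm $\|u\|_{Z^{s,b}}=\|u\|_{X^{s,b}}+\|u\|_{Y^{s,b-\frac12}}$. $\eta$ is a fixed smooth bump function supported in $[-2,2]$ and equal to $1$ on $[-1,1]$; for $0<T<1$, $\eta(t/T)$ is supported in $[-2,2]\subset(-\pi,\pi)$ and is regarded as a $2\pi$-periodic function of $t$. *)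

theory Defs
  imports "HOL-Analysis.Analysis"
begin

(* Functions on the torus are doubly 2 pi-periodic functions of (x, t) on the plane; only their
   restriction to one period cell enters the Fourier coefficients. *)

definition torus_cell :: "(real \<times> real) set" where
  "torus_cell = {0..2*pi} \<times> {0..2*pi}"

definition torus_integrable :: "(real \<times> real \<Rightarrow> complex) \<Rightarrow> bool" where
  "torus_integrable u \<longleftrightarrow>
     (\<forall>x t. u (x + 2*pi, t) = u (x, t) \<and> u (x, t + 2*pi) = u (x, t)) \<and>
     u absolutely_integrable_on torus_cell"

definition fourier_coeff :: "(real \<times> real \<Rightarrow> complex) \<Rightarrow> int \<Rightarrow> int \<Rightarrow> complex" where
  "fourier_coeff u n \<tau> =
     (1 / (2*pi)^2) *\<^sub>R
       (LINT (x, t):torus_cell|lebesgue. u (x, t) * cis (- (of_int n * x + of_int \<tau> * t)))"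

definition P :: "int \<Rightarrow> int" where
  "P n = n^3 - 2 * n^2 + 8 * n"

definition jbr :: "int \<Rightarrow> real" where
  "jbr y = 1 + \<bar>of_int y\<bar>"

definition X_term :: "real \<Rightarrow> (real \<times> real \<Rightarrow> complex) \<Rightarrow> int \<Rightarrow> int \<Rightarrow> real" where
  "X_term b u n \<tau> = jbr (\<tau> - P n) powr (2 * b) * (cmod (fourier_coeff u n \<tau>))^2"

definition Y_term :: "real \<Rightarrow> (real \<times> real \<Rightarrow> complex) \<Rightarrow> int \<Rightarrow> int \<Rightarrow> real" where
  "Y_term b u n \<tau> = jbr (\<tau> - P n) powr b * cmod (fourier_coeff u n \<tau>)"

definition X_norm :: "real \<Rightarrow> real \<Rightarrow> (real \<times> real \<Rightarrow> complex) \<Rightarrow> real" where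
  "X_norm s b u = sqrt (\<Sum>\<^sub>\<infinity>n\<in>UNIV. jbr n powr (2 * s) * (\<Sum>\<^sub>\<infinity>\<tau>\<in>UNIV. X_term b u n \<tau>))"

definition Y_norm :: "real \<Rightarrow> real \<Rightarrow> (real \<times> real \<Rightarrow> complex) \<Rightarrow> real" where
  "Y_norm s b u = sqrt (\<Sum>\<^sub>\<infinity>n\<in>UNIV. jbr n powr (2 * s) * (\<Sum>\<^sub>\<infinity>\<tau>\<in>UNIV. Y_term b u n \<tau>)^2)"

(* A divergent infinite sum has the value 0, so finiteness of the norms is expressed by
   summability of both the inner and the outer sums, as part of membership in the spaces. *)

definition X_space :: "real \<Rightarrow> real \<Rightarrow> (real \<times> real \<Rightarrow> complex) set" where
  "X_space s b = {u. torus_integrable u \<and>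
     (\<forall>n. X_term b u n summable_on UNIV) \<and>
     (\<lambda>n. jbr n powr (2 * s) * (\<Sum>\<^sub>\<infinity>\<tau>\<in>UNIV. X_term b u n \<tau>)) summable_on UNIV}"

definition Y_space :: "real \<Rightarrow> real \<Rightarrow> (real \<times> real \<Rightarrow> complex) set" where
  "Y_space s b = {u. torus_integrable u \<and>
     (\<forall>n. Y_term b u n summable_on UNIV) \<and>
     (\<lambda>n. jbr n powr (2 * s) * (\<Sum>\<^sub>\<infinity>\<tau>\<in>UNIV. Y_term b u n \<tau>)^2) summable_on UNIV}"

definition Z_space :: "real \<Rightarrow> real \<Rightarrow> (real \<times> real \<Rightarrow> complex) set" where
  "Z_space s b = X_space s b \<inter> Y_space s (b - 1/2)"

definition Z_norm :: "real \<Rightarrow> real \<Rightarrow> (real \<times> real \<Rightarrow> complex) \<Rightarrow> real" where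
  "Z_norm s b u = X_norm s b u + Y_norm s (b - 1/2) u"

definition bump :: "(real \<Rightarrow> real) \<Rightarrow> bool" where
  "bump \<eta> \<longleftrightarrow>
     (\<forall>k t. (deriv ^^ k) \<eta> differentiable (at t)) \<and>
     (\<forall>t. \<bar>t\<bar> > 2 \<longrightarrow> \<eta> t = 0) \<and>
     (\<forall>t. \<bar>t\<bar> \<le> 1 \<longrightarrow> \<eta> t = 1)"

(* The 2 pi-periodic function that agrees with f on [-pi, pi). *)

definition periodize :: "(real \<Rightarrow> real) \<Rightarrow> real \<Rightarrow> real" where
  "periodize f t = f (t - 2*pi * of_int \<lfloor>(t + pi) / (2*pi)\<rfloor>)"

definition cutoff :: "(real \<Rightarrow> real) \<Rightarrow> real \<Rightarrow> real \<Rightarrow> real" where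
  "cutoff \<eta> T = periodize (\<lambda>t. \<eta> (t / T))"

definition cutoff_cubic ::
  "(real \<Rightarrow> real) \<Rightarrow> real \<Rightarrow> (real \<times> real \<Rightarrow> complex) \<Rightarrow> (real \<times> real \<Rightarrow> complex)" where
  "cutoff_cubic \<eta> T u =
     (\<lambda>(x, t). of_real (cutoff \<eta> T t) * (of_real ((cmod (u (x, t)))^2) * u (x, t)))"

end

theory Submission
  imports Defs
begin

text \<open>
Write the nonlinearity as a product of \<open>\<eta>(t/T) u\<close>, \<open>cnj u\<close> and \<open>u\<close>. Since
\<open>\<langle>n\<rangle> \<le> \<langle>n1\<rangle>\<langle>n2\<rangle>\<langle>n3\<rangle>\<close> for \<open>n = n1 - n2 + n3\<close>, the spatial weights are harmless, and everything
reduces to the modulations. With \<open>w = \<langle>\<tau> - P n\<rangle>\<close>, the kernel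
\<open>\<Sum>k. w k powr (-2/3) * w (K - k) powr (-1)\<close> is bounded uniformly in \<open>K\<close>, because
\<open>P m + P (n - m)\<close> is quadratic in \<open>m\<close> with leading coefficient \<open>3 n - 4 \<noteq> 0\<close>. Cauchy-Schwarz turns this into
a bilinear \<open>L\<^sup>2\<close> bound with one factor in \<open>X\<close> of exponent \<open>1/3\<close> and one in \<open>X\<close> of exponent \<open>1/2\<close>;
using it for the pair \<open>(\<eta>(t/T) u, u)\<close> and, by duality, for \<open>u\<close> paired with the test function bounds the
nonlinearity in \<open>X\<close> of exponent \<open>-1/3\<close>, which controls both parts of the \<open>Z\<close> norm. The factor
\<open>T powr (1/6)\<close> is the cost of multiplying by \<open>\<eta>(t/T)\<close> from \<open>Z\<close> of exponent \<open>1/2\<close> to \<open>X\<close> of exponent \<open>1/3\<close>.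
A function \<open>u\<close> in the space is only known to be integrable, so its cube is handled through partial Fourier sums,
which the bilinear bound makes dominated in \<open>L\<^sup>4\<close>; uniqueness of Fourier coefficients identifies the limit.
\<close>

section \<open>Sums of extended nonnegative reals\<close>

text \<open>The exponents come from one window. Convolving weights of exponents \<open>2/3\<close>
  and \<open>1\<close> in \<open>\<tau>\<close> leaves decay of any exponent below
  \<open>2/3\<close>, and summing over a quadratic phase needs an exponent above \<open>1/2\<close>;
  \<open>7/12\<close> lies between. The exponent \<open>1/6\<close> of \<open>T\<close> is
  \<open>1/2 - 1/3\<close>, the modulation that one factor can spare. The \<open>Y\<close> part of
  the norm pays for the cutoff: at the critical regularity 1/2 in time, multiplication by a bump of
  width \<open>T\<close> is controlled with the help of a supremum bound, which summability of the
  coefficients in \<open>\<tau>\<close> provides. The quadratic term of \<open>P\<close> matters: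
  for the pure cube, \<open>P m + P (- m)\<close> would vanish for all \<open>m\<close>, and the
  kernel sum would diverge at \<open>n = 0\<close>. The conjugate is harmless because
  \<open>k = k1 - k2 + k3\<close> is read as \<open>k + k2 = k1 + k3\<close>: both sides are plain
  convolutions, so one kernel serves for the product and for its dual. Estimates are made in
  \<open>ennreal\<close>, where interchange of sums and Cauchy-Schwarz carry no summability
  conditions; the infinite sums of the norms enter only in the final section.\<close>

abbreviation nnsum :: "('a \<Rightarrow> ennreal) \<Rightarrow> ennreal" (binder "\<Sum>\<^sup>+" 10)
  where "nnsum f \<equiv> nn_integral (count_space UNIV) f"

lemma nnsum_swap:
  fixes f :: "'a::countable \<Rightarrow> 'b \<Rightarrow> ennreal"
  shows "(\<Sum>\<^sup>+x. \<Sum>\<^sup>+y. f x y) = (\<Sum>\<^sup>+y. \<Sum>\<^sup>+x. f x y)"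
  by (rule nn_integral_count_space_nn_integral[symmetric]) auto

lemma nnsum_pair: "(\<Sum>\<^sup>+x. \<Sum>\<^sup>+y. f (x, y)) = nnsum f"
  by (rule nn_integral_fst_count_space)

lemma nnsum_reindex:
  assumes "bij g"
  shows "(\<Sum>\<^sup>+x. f (g x)) = nnsum f"
  using assms by (intro nn_integral_bij_count_space) auto

lemma nnsum_shift:
  fixes f :: "'a::ab_group_add \<Rightarrow> ennreal"
  shows "(\<Sum>\<^sup>+x. f (x + c)) = nnsum f" and "(\<Sum>\<^sup>+x. f (x - c)) = nnsum f"
    and "(\<Sum>\<^sup>+x. f (c + x)) = nnsum f" and "(\<Sum>\<^sup>+x. f (c - x)) = nnsum f"
proof -
  have "bij (\<lambda>x. x + c)" "bij (\<lambda>x. x - c)" "bij (\<lambda>x. c + x)" "bij (\<lambda>x. c - x)"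
    by (auto intro: bij_betw_byWitness[where f'="\<lambda>x. x - c"] bij_betw_byWitness[where f'="\<lambda>x. x + c"]
        bij_betw_byWitness[where f'="\<lambda>x. c - x"])
  then show "(\<Sum>\<^sup>+x. f (x + c)) = nnsum f" and "(\<Sum>\<^sup>+x. f (x - c)) = nnsum f"
    and "(\<Sum>\<^sup>+x. f (c + x)) = nnsum f" and "(\<Sum>\<^sup>+x. f (c - x)) = nnsum f"
    by (auto intro: nnsum_reindex[of _ f])
qed

lemma nnsum_Cauchy_Schwarz:
  "(\<Sum>\<^sup>+x. f x * g x)^2 \<le> (\<Sum>\<^sup>+x. f x ^ 2) * (\<Sum>\<^sup>+x. g x ^ 2)"
  by (rule Cauchy_Schwarz_nn_integral) auto

lemma nnsum_cmult: "(\<Sum>\<^sup>+x. c * f x) = c * nnsum f" "(\<Sum>\<^sup>+x. f x * c) = nnsum f * c"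
  by (simp_all add: nn_integral_cmult nn_integral_multc)

lemma nnsum_add: "(\<Sum>\<^sup>+x. f x + g x) = nnsum f + nnsum g"
  by (simp add: nn_integral_add)

lemma nnsum_mono: "(\<And>x. f x \<le> g x) \<Longrightarrow> nnsum f \<le> nnsum g"
  by (rule nn_integral_mono)

lemma nnsum_finite_support:
  assumes "finite S" "\<And>x. x \<notin> S \<Longrightarrow> f x = 0"
  shows "nnsum f = sum f S"
  using assms by (intro nn_integral_count_space') auto

lemma sum_le_nnsum:
  assumes "finite S"
  shows "sum f S \<le> nnsum f"
proof -
  have "sum f S = (\<Sum>\<^sup>+x. f x * indicator S x)"
    using assms by (subst nnsum_finite_support[of S]) auto
  also have "\<dots> \<le> nnsum f"
    by (rule nnsum_mono) (auto simp: indicator_def)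
  finally show ?thesis .
qed

text \<open>Monotone convergence along the finite sets of elements with \<open>to_nat\<close> below
  \<open>N\<close>. It reduces the duality argument to finite sets, on which the quantity to be
  cancelled is finite.\<close>

lemma nnsum_le_finiteI:
  fixes f :: "'a::countable \<Rightarrow> ennreal"
  assumes "\<And>S. finite S \<Longrightarrow> sum f S \<le> B"
  shows "nnsum f \<le> B"
proof -
  define S where "S N = {x::'a. to_nat x < N}" for N
  have fin: "finite (S N)" for N
    unfolding S_def using finite_vimageI[of "{..<N}" "to_nat :: 'a \<Rightarrow> nat"] by (simp add: vimage_def)
  have "(\<Sum>\<^sup>+x. (SUP N. f x * indicator (S N) x)) = (SUP N. \<Sum>\<^sup>+x. f x * indicator (S N) x)"
    by (rule nn_integral_monotone_convergence_SUP)
      (auto simp: incseq_def le_fun_def S_def indicator_def)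
  moreover have "(SUP N. f x * indicator (S N) x) = f x" for x
  proof (rule antisym)
    show "(SUP N. f x * indicator (S N) x) \<le> f x"
      by (rule SUP_least) (auto simp: indicator_def)
    have "f x \<le> f x * indicator (S (Suc (to_nat x))) x" by (simp add: S_def)
    then show "f x \<le> (SUP N. f x * indicator (S N) x)"
      by (meson SUP_upper2 UNIV_I)
  qed
  moreover have "(\<Sum>\<^sup>+x. f x * indicator (S N) x) \<le> B" for N
    using assms[OF fin] fin by (subst nnsum_finite_support[of "S N"]) auto
  ultimately show ?thesis by (auto intro: SUP_least)
qed

section \<open>Weighted convolutions and their dual form\<close>

text \<open>The factor \<open>sqrt (w1 k * w2 (K - k))\<close> is inserted together with its
  inverse. For fixed \<open>K\<close>, Cauchy-Schwarz leaves the kernel sum, which is at most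
  \<open>C\<close>; summing the rest over \<open>K\<close> factors into the two weighted square
  sums. This is the bilinear L^2 estimate on the Fourier side.\<close>

lemma nnsum_weighted_conv:
  fixes w1 w2 :: "'a::{countable,ab_group_add} \<Rightarrow> real" and a b :: "'a \<Rightarrow> ennreal"
  assumes pos: "\<And>k. w1 k > 0" "\<And>k. w2 k > 0"
    and C: "\<And>K. (\<Sum>\<^sup>+k. ennreal (1 / w1 k * (1 / w2 (K - k)))) \<le> C"
  shows "(\<Sum>\<^sup>+K. (\<Sum>\<^sup>+k. a k * b (K - k))^2)
    \<le> C * (\<Sum>\<^sup>+k. ennreal (w1 k) * a k ^ 2) * (\<Sum>\<^sup>+k. ennreal (w2 k) * b k ^ 2)"
proof -
  define A where "A k = ennreal (sqrt (w1 k)) * a k" for k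
  define B where "B k = ennreal (sqrt (w2 k)) * b k" for k
  have A2: "A k ^ 2 = ennreal (w1 k) * a k ^ 2" and B2: "B k ^ 2 = ennreal (w2 k) * b k ^ 2" for k
    using pos by (simp_all add: A_def B_def power_mult_distrib ennreal_power less_imp_le)
  have "(\<Sum>\<^sup>+k. a k * b (K - k))^2 \<le> C * (\<Sum>\<^sup>+k. A k ^ 2 * B (K - k) ^ 2)" for K
  proof -
    define r where "r k = ennreal (sqrt (1 / w1 k * (1 / w2 (K - k))))" for k
    have "a k * b (K - k) = r k * (A k * B (K - k))" for k
    proof -
      have "r k * (ennreal (sqrt (w1 k)) * ennreal (sqrt (w2 (K - k)))) = 1"
        using pos[of k] pos(2)[of "K - k"] unfolding r_def
        by (simp add: ennreal_mult[symmetric] real_sqrt_mult real_sqrt_divide)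
      then have "r k * (A k * B (K - k)) = 1 * (a k * b (K - k))"
        unfolding A_def B_def by (metis mult.assoc mult.left_commute)
      then show ?thesis by simp
    qed
    then have "(\<Sum>\<^sup>+k. a k * b (K - k))^2 = (\<Sum>\<^sup>+k. r k * (A k * B (K - k)))^2" by simp
    also have "\<dots> \<le> (\<Sum>\<^sup>+k. r k ^ 2) * (\<Sum>\<^sup>+k. (A k * B (K - k)) ^ 2)"
      by (rule nnsum_Cauchy_Schwarz)
    also have "(\<Sum>\<^sup>+k. r k ^ 2) = (\<Sum>\<^sup>+k. ennreal (1 / w1 k * (1 / w2 (K - k))))"
      unfolding r_def using pos by (simp add: ennreal_power less_imp_le)
    also have "\<dots> * (\<Sum>\<^sup>+k. (A k * B (K - k)) ^ 2) \<le> C * (\<Sum>\<^sup>+k. A k ^ 2 * B (K - k) ^ 2)"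
      using C by (intro mult_mono) (auto simp: power_mult_distrib)
    finally show ?thesis .
  qed
  then have "(\<Sum>\<^sup>+K. (\<Sum>\<^sup>+k. a k * b (K - k))^2) \<le> (\<Sum>\<^sup>+K. C * (\<Sum>\<^sup>+k. A k ^ 2 * B (K - k) ^ 2))"
    by (rule nnsum_mono)
  also have "\<dots> = C * (\<Sum>\<^sup>+k. \<Sum>\<^sup>+K. A k ^ 2 * B (K - k) ^ 2)"
    by (simp add: nnsum_cmult(1) nnsum_swap[of "\<lambda>K k. A k ^ 2 * B (K - k) ^ 2"])
  also have "\<dots> = C * (nnsum (\<lambda>k. A k ^ 2) * nnsum (\<lambda>k. B k ^ 2))"
    by (simp add: nnsum_cmult nnsum_shift(2)[of "\<lambda>k. B k ^ 2"])
  finally show ?thesis by (simp add: A2 B2 mult.assoc)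
qed

(* Duality: f is tested against f / w1 on finite sets, which keeps the quantity to be absorbed finite. *)
lemma nnsum_weighted_trilinear:
  fixes w1 w2 f :: "'a::{countable,ab_group_add} \<Rightarrow> real" and a b :: "'a \<Rightarrow> ennreal"
  assumes pos: "\<And>k. w1 k > 0" "\<And>k. w2 k > 0"
    and C: "\<And>K. (\<Sum>\<^sup>+k. ennreal (1 / w1 k * (1 / w2 (K - k)))) \<le> C"
    and f: "\<And>k. 0 \<le> f k" "\<And>k. ennreal (f k) \<le> (\<Sum>\<^sup>+k2. a k2 * (\<Sum>\<^sup>+k3. a k3 * b (k + k2 - k3)))"
  shows "(\<Sum>\<^sup>+k. ennreal (f k ^ 2 / w1 k))
    \<le> C^2 * (\<Sum>\<^sup>+k. ennreal (w2 k) * a k ^ 2)^2 * (\<Sum>\<^sup>+k. ennreal (w1 k) * b k ^ 2)"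
proof -
  define Na where "Na = (\<Sum>\<^sup>+k. ennreal (w2 k) * a k ^ 2)"
  define Nb where "Nb = (\<Sum>\<^sup>+k. ennreal (w1 k) * b k ^ 2)"
  define G where "G K = (\<Sum>\<^sup>+k3. a k3 * b (K - k3))" for K
  have G: "(\<Sum>\<^sup>+K. G K ^ 2) \<le> C * Nb * Na"
  proof -
    have "G K = (\<Sum>\<^sup>+k. b k * a (K - k))" for K
      unfolding G_def using nnsum_shift(4)[of "\<lambda>k. a k * b (K - k)" K, symmetric]
      by (simp add: mult.commute)
    then show ?thesis
      unfolding Na_def Nb_def using nnsum_weighted_conv[OF pos C, of b a] by simp
  qed
  have "(\<Sum>k\<in>S. ennreal (f k ^ 2 / w1 k)) \<le> C^2 * Na^2 * Nb" if S: "finite S" for S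
  proof -
    define W where "W k = ennreal (f k / w1 k) * indicator S k" for k
    define Q where "Q = (\<Sum>k\<in>S. ennreal (f k ^ 2 / w1 k))"
    have Qfin: "Q \<noteq> \<infinity>" unfolding Q_def using S by (simp add: ennreal_sum_less_top[symmetric] less_top[symmetric])
    have Wsq: "(\<Sum>\<^sup>+k. ennreal (w1 k) * W k ^ 2) = Q"
    proof -
      have "ennreal (w1 k) * ennreal (f k / w1 k) ^ 2 = ennreal (f k ^ 2 / w1 k)" for k
        using pos(1)[of k] f(1)[of k]
        by (simp add: ennreal_power ennreal_mult[symmetric] power2_eq_square)
      then show ?thesis
        unfolding Q_def W_def using S by (subst nnsum_finite_support[of S]) auto
    qed
    have "Q = (\<Sum>\<^sup>+k. W k * ennreal (f k))"
    proof -
      have "ennreal (f k ^ 2 / w1 k) = ennreal (f k / w1 k) * ennreal (f k)" for k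
        using pos(1)[of k] f(1)[of k]
        by (simp add: ennreal_mult[symmetric] power2_eq_square)
      then show ?thesis
        unfolding Q_def W_def using S by (subst nnsum_finite_support[of S]) auto
    qed
    also have "\<dots> \<le> (\<Sum>\<^sup>+k. W k * (\<Sum>\<^sup>+k2. a k2 * G (k + k2)))"
      unfolding G_def by (intro nnsum_mono mult_left_mono f) auto
    also have "\<dots> = (\<Sum>\<^sup>+k. \<Sum>\<^sup>+k2. W k * (a k2 * G (k + k2)))"
      by (simp add: nnsum_cmult)
    \<comment> \<open>With \<open>K = k + k2\<close> the trilinear sum pairs two convolutions
      evaluated at the same \<open>K\<close>: \<open>G\<close>, and that of \<open>W\<close> with
      \<open>a\<close>.\<close>
    also have "\<dots> = (\<Sum>\<^sup>+k. \<Sum>\<^sup>+K. W k * (a (K - k) * G K))"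
      by (subst nnsum_shift(2)[of "\<lambda>k2. W k * (a k2 * G (k + k2))" k for k, symmetric]) simp
    also have "\<dots> = (\<Sum>\<^sup>+K. G K * (\<Sum>\<^sup>+k. W k * a (K - k)))"
      by (subst nnsum_swap) (simp add: nnsum_cmult(1)[symmetric] ac_simps)
    finally have "Q^2 \<le> (\<Sum>\<^sup>+K. G K * (\<Sum>\<^sup>+k. W k * a (K - k)))^2"
      by (rule power_mono) simp
    also have "\<dots> \<le> (\<Sum>\<^sup>+K. G K ^ 2) * (\<Sum>\<^sup>+K. (\<Sum>\<^sup>+k. W k * a (K - k))^2)"
      by (rule nnsum_Cauchy_Schwarz)
    \<comment> \<open>The weighted square sum of \<open>W\<close> is \<open>Q\<close> by
      \<open>Wsq\<close>, so \<open>Q\<close> comes back linearly on the right and one factor of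
      \<open>Q^2\<close> can be cancelled.\<close>
    also have "\<dots> \<le> (C * Nb * Na) * (C * Q * Na)"
      using nnsum_weighted_conv[OF pos C, of W a] G
      by (intro mult_mono) (auto simp: Wsq Na_def)
    also have "\<dots> = (C^2 * Na^2 * Nb) * Q"
      by (simp add: power2_eq_square ac_simps)
    finally have *: "Q * Q \<le> (C^2 * Na^2 * Nb) * Q" by (simp add: power2_eq_square)
    show ?thesis
    proof (cases "Q = 0")
      case False
      then show ?thesis using * Qfin unfolding Q_def[symmetric]
        by (metis ennreal_mult_le_mult_iff infinity_ennreal_def mult.commute)
    qed (simp add: Q_def)
  qed
  then show ?thesis unfolding Na_def Nb_def by (rule nnsum_le_finiteI)
qed

section \<open>The modulation kernel\<close>

lemma jbr_ge_1: "jbr y \<ge> 1" and jbr_pos: "jbr y > 0"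
  by (simp_all add: jbr_def)

lemma jbr_minus: "jbr (- y) = jbr y"
  by (simp add: jbr_def)

lemma jbr_add_le: "jbr (x + y) \<le> jbr x + jbr y"
  by (simp add: jbr_def)

lemma jbr_add_mult_le: "jbr (x + y) \<le> jbr x * jbr y"
proof -
  have "\<bar>x + y\<bar> \<le> \<bar>x\<bar> + \<bar>y\<bar>" by simp
  then have "\<bar>real_of_int (x + y)\<bar> \<le> \<bar>real_of_int x\<bar> + \<bar>real_of_int y\<bar>" by linarith
  moreover have "\<bar>real_of_int x\<bar> * \<bar>real_of_int y\<bar> \<ge> 0" by simp
  ultimately have "1 + \<bar>real_of_int (x + y)\<bar> \<le> (1 + \<bar>real_of_int x\<bar>) * (1 + \<bar>real_of_int y\<bar>)"
    unfolding distrib_left distrib_right by linarith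
  then show ?thesis by (simp add: jbr_def)
qed

text \<open>Comparison with the p-series through \<open>int_decode\<close>, which lists the integers
  as 0, -1, 1, -2, 2, ...: entry \<open>n\<close> has absolute value at least
  \<open>n / 2\<close>.\<close>

lemma nnsum_jbr_powr:
  fixes p :: real
  assumes "p > 1"
  shows "\<exists>C\<ge>0. (\<Sum>\<^sup>+j. ennreal (jbr j powr - p)) \<le> ennreal C"
proof -
  have sm: "summable (\<lambda>n. 2 powr p * real (Suc n) powr - p)"
    using assms summable_Suc_iff[of "\<lambda>n. real n powr - p"]
    by (intro summable_mult) (simp add: summable_real_powr_iff del: of_nat_Suc)
  have "(\<Sum>\<^sup>+j. ennreal (jbr j powr - p)) = (\<Sum>\<^sup>+n. ennreal (jbr (int_decode n) powr - p))"
    by (rule nnsum_reindex[symmetric]) (rule bij_int_decode)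
  also have "\<dots> \<le> (\<Sum>\<^sup>+n. ennreal (2 powr p * real (Suc n) powr - p))"
  proof (rule nnsum_mono, rule ennreal_leI)
    fix n :: nat
    have "real (Suc n) / 2 \<le> jbr (int_decode n)"
      by (auto simp: jbr_def int_decode_def sum_decode_def field_simps elim!: evenE oddE)
    then have "jbr (int_decode n) powr - p \<le> (real (Suc n) / 2) powr - p"
      using assms by (intro powr_mono2') auto
    also have "\<dots> = 2 powr p * real (Suc n) powr - p"
      by (simp add: powr_divide powr_minus field_simps)
    finally show "jbr (int_decode n) powr - p \<le> 2 powr p * real (Suc n) powr - p" .
  qed
  also have "\<dots> = ennreal (\<Sum>n. 2 powr p * real (Suc n) powr - p)"
    unfolding nn_integral_count_space_nat using sm by (intro suminf_ennreal_eq) (auto simp: summable_sums)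
  finally show ?thesis using suminf_nonneg[OF sm] by (intro exI[of _ "\<Sum>n. 2 powr p * real (Suc n) powr - p"]) simp
qed

text \<open>The larger of \<open>x\<close> and \<open>y\<close> is at least \<open>D / 2\<close> and
  gives up the power \<open>7/12\<close> to produce the decay in \<open>D\<close>; both
  \<open>2/3\<close> and \<open>1\<close> exceed \<open>7/12\<close>, so either can. What it has
  left is moved to the smaller one, whose total exponent becomes
  \<open>2/3 + 1 - 7/12 = 13/12\<close>, which is summable.\<close>

lemma powr_convolution_pointwise:
  fixes x y D :: real
  assumes "x \<ge> 1" "y \<ge> 1" "0 < D" "D \<le> x + y"
  shows "x powr (-2/3) * y powr (-1) \<le> 2 * D powr (-7/12) * (x powr (-13/12) + y powr (-13/12))"
proof -
  have half: "z powr (-7/12) \<le> 2 * D powr (-7/12)" if "D \<le> 2 * z" for z :: real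
  proof -
    have "z powr (-7/12) \<le> (D / 2) powr (-7/12)" using that assms by (intro powr_mono2') auto
    also have "\<dots> = 2 powr (7/12) * D powr (-7/12)"
      using assms by (simp add: powr_divide powr_minus field_simps)
    also have "\<dots> \<le> 2 powr 1 * D powr (-7/12)"
      by (intro mult_right_mono powr_mono) auto
    finally show ?thesis by simp
  qed
  show ?thesis
  proof (cases "x \<le> y")
    case True
    have "x powr (-2/3) * y powr (-1) = x powr (-2/3) * (y powr (-7/12) * y powr (-5/12))"
      by (simp add: powr_add[symmetric])
    also have "\<dots> \<le> x powr (-2/3) * ((2 * D powr (-7/12)) * x powr (-5/12))"
      using True assms by (intro mult_left_mono mult_mono half powr_mono2') auto
    also have "\<dots> = 2 * D powr (-7/12) * x powr (-13/12)"
      by (simp add: powr_add[symmetric])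
    also have "\<dots> \<le> 2 * D powr (-7/12) * (x powr (-13/12) + y powr (-13/12))"
      by (intro mult_left_mono) auto
    finally show ?thesis .
  next
    case False
    have "x powr (-2/3) * y powr (-1) = (x powr (-7/12) * x powr (-1/12)) * y powr (-1)"
      by (simp add: powr_add[symmetric])
    also have "\<dots> \<le> ((2 * D powr (-7/12)) * y powr (-1/12)) * y powr (-1)"
      using False assms by (intro mult_right_mono mult_mono half powr_mono2') auto
    also have "\<dots> = 2 * D powr (-7/12) * (y powr (-1/12) * y powr (-1))" by simp
    also have "\<dots> = 2 * D powr (-7/12) * y powr (-13/12)"
      by (subst powr_add[symmetric]) simp
    also have "\<dots> \<le> 2 * D powr (-7/12) * (x powr (-13/12) + y powr (-13/12))"
      by (intro mult_left_mono) auto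
    finally show ?thesis .
  qed
qed

lemma nnsum_jbr_convolution:
  obtains C where "C \<ge> 0" "\<And>\<alpha> \<beta>. (\<Sum>\<^sup>+\<tau>. ennreal (jbr (\<tau> - \<alpha>) powr (-2/3) * jbr (\<beta> - \<tau>) powr (-1)))
      \<le> ennreal (C * jbr (\<beta> - \<alpha>) powr (-7/12))"
proof -
  obtain C where C: "C \<ge> 0" "(\<Sum>\<^sup>+j. ennreal (jbr j powr (-13/12))) \<le> ennreal C"
    using nnsum_jbr_powr[of "13/12"] by auto
  have "(\<Sum>\<^sup>+\<tau>. ennreal (jbr (\<tau> - \<alpha>) powr (-2/3) * jbr (\<beta> - \<tau>) powr (-1)))
      \<le> ennreal ((4 * C) * jbr (\<beta> - \<alpha>) powr (-7/12))" for \<alpha> \<beta>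
  proof -
    have "(\<Sum>\<^sup>+\<tau>. ennreal (jbr (\<tau> - \<alpha>) powr (-2/3) * jbr (\<beta> - \<tau>) powr (-1)))
      \<le> (\<Sum>\<^sup>+\<tau>. ennreal (2 * jbr (\<beta> - \<alpha>) powr (-7/12)) *
          (ennreal (jbr (\<tau> - \<alpha>) powr (-13/12)) + ennreal (jbr (\<beta> - \<tau>) powr (-13/12))))"
    proof (rule nnsum_mono)
      fix \<tau>
      have "jbr (\<beta> - \<alpha>) \<le> jbr (\<tau> - \<alpha>) + jbr (\<beta> - \<tau>)"
        using jbr_add_le[of "\<tau> - \<alpha>" "\<beta> - \<tau>"] by simp
      then have "jbr (\<tau> - \<alpha>) powr (-2/3) * jbr (\<beta> - \<tau>) powr (-1) \<le> 2 * jbr (\<beta> - \<alpha>) powr (-7/12) *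
          (jbr (\<tau> - \<alpha>) powr (-13/12) + jbr (\<beta> - \<tau>) powr (-13/12))"
        by (intro powr_convolution_pointwise) (auto simp: jbr_ge_1 jbr_pos)
      then show "ennreal (jbr (\<tau> - \<alpha>) powr (-2/3) * jbr (\<beta> - \<tau>) powr (-1)) \<le> ennreal (2 * jbr (\<beta> - \<alpha>) powr (-7/12)) *
          (ennreal (jbr (\<tau> - \<alpha>) powr (-13/12)) + ennreal (jbr (\<beta> - \<tau>) powr (-13/12)))"
        by (subst ennreal_plus[symmetric], simp, simp, subst ennreal_mult[symmetric]) (auto intro: ennreal_leI)
    qed
    also have "\<dots> = ennreal (2 * jbr (\<beta> - \<alpha>) powr (-7/12)) *
        ((\<Sum>\<^sup>+j. ennreal (jbr j powr (-13/12))) + (\<Sum>\<^sup>+j. ennreal (jbr j powr (-13/12))))"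
      using nnsum_shift(2)[of "\<lambda>j. ennreal (jbr j powr (-13/12))" \<alpha>]
        nnsum_shift(4)[of "\<lambda>j. ennreal (jbr j powr (-13/12))" \<beta>]
      by (simp add: nnsum_cmult nnsum_add)
    also have "\<dots> \<le> ennreal (2 * jbr (\<beta> - \<alpha>) powr (-7/12)) * (ennreal C + ennreal C)"
      using C by (intro mult_left_mono add_mono) auto
    also have "\<dots> = ennreal ((4 * C) * jbr (\<beta> - \<alpha>) powr (-7/12))"
      using C(1) by (simp add: ennreal_plus[symmetric] ennreal_mult[symmetric] del: ennreal_plus)
    finally show ?thesis .
  qed
  then show ?thesis using C(1) by (intro that[of "4 * C"]) auto
qed

section \<open>Sums over quadratic phases\<close>

text \<open>The bound must not depend on the real centre \<open>\<theta>\<close>. Replacing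
  \<open>\<theta>\<close> by its floor costs a factor \<open>8\<close> inside the power, and a
  translation then removes it; the square doubles the exponent \<open>7/12\<close> to
  \<open>7/6\<close>.\<close>

lemma nnsum_inverse_quadratic:
  obtains C where "C \<ge> 0" "\<And>\<theta>::real. (\<Sum>\<^sup>+m::int. ennreal ((1 + (of_int m - \<theta>)^2) powr (-7/12))) \<le> ennreal C"
proof -
  obtain C where C: "C \<ge> 0" "(\<Sum>\<^sup>+j. ennreal (jbr j powr (-7/6))) \<le> ennreal C"
    using nnsum_jbr_powr[of "7/6"] by auto
  have "(\<Sum>\<^sup>+m::int. ennreal ((1 + (of_int m - \<theta>)^2) powr (-7/12))) \<le> ennreal (8 powr (7/12) * C)" for \<theta> :: real
  proof -
    have "(\<Sum>\<^sup>+m::int. ennreal ((1 + (of_int m - \<theta>)^2) powr (-7/12)))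
      \<le> (\<Sum>\<^sup>+m::int. ennreal (8 powr (7/12)) * ennreal (jbr (m - \<lfloor>\<theta>\<rfloor>) powr (-7/6)))"
    proof (rule nnsum_mono)
      fix m :: int
      define y where "y = \<bar>of_int m - \<theta>\<bar>"
      define b where "b = jbr (m - \<lfloor>\<theta>\<rfloor>)"
      have b: "b \<le> 2 + y" "b \<ge> 1" unfolding b_def y_def jbr_def by (simp_all, linarith)
      then have "b^2 \<le> (2 + y)^2" by (intro power_mono) auto
      also have "\<dots> \<le> 8 * (1 + y^2)"
      proof -
        have "8 * (1 + y^2) - (2 + y)^2 = (2 - y)^2 + 6 * y^2"
          by (simp add: power2_eq_square algebra_simps)
        then show ?thesis using zero_le_power2[of "2 - y"] zero_le_power2[of y] by linarith
      qed
      finally have "b^2 / 8 \<le> 1 + (of_int m - \<theta>)^2" by (simp add: y_def)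
      then have "(1 + (of_int m - \<theta>)^2) powr (-7/12) \<le> (b^2 / 8) powr (-7/12)"
        using b by (intro powr_mono2') auto
      also have "\<dots> = 8 powr (7/12) * (b^2) powr (-7/12)"
        by (simp add: powr_divide powr_minus field_simps)
      also have "(b^2) powr (-7/12) = b powr (-7/6)"
        using b by (simp add: powr_powr flip: powr_numeral)
      finally show "ennreal ((1 + (of_int m - \<theta>)^2) powr (-7/12))
          \<le> ennreal (8 powr (7/12)) * ennreal (jbr (m - \<lfloor>\<theta>\<rfloor>) powr (-7/6))"
        by (subst ennreal_mult[symmetric]) (auto simp: b_def intro: ennreal_leI)
    qed
    also have "\<dots> = ennreal (8 powr (7/12)) * (\<Sum>\<^sup>+j. ennreal (jbr j powr (-7/6)))"
      using nnsum_shift(2)[of "\<lambda>j. ennreal (jbr j powr (-7/6))" "\<lfloor>\<theta>\<rfloor>"] by (simp add: nnsum_cmult)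
    also have "\<dots> \<le> ennreal (8 powr (7/12)) * ennreal C"
      using C by (intro mult_left_mono) auto
    finally show ?thesis using C(1) by (simp add: ennreal_mult)
  qed
  then show ?thesis using C(1) by (intro that[of "8 powr (7/12) * C"]) auto
qed

(* \<theta>1 and \<theta>2 are the real parts of the zeros of the quadratic polynomial \<mu> - P m - P (n - m) in m;
   its leading coefficient 3 n - 4 never vanishes on the integers. *)
lemma jbr_phase_lower_bound:
  "\<exists>\<theta>1 \<theta>2::real. \<forall>m. jbr (\<mu> - P m - P (n - m)) \<ge> 1 + (of_int m - \<theta>1)^2
     \<or> jbr (\<mu> - P m - P (n - m)) \<ge> 1 + (of_int m - \<theta>2)^2"
proof -
  define q :: real where "q = of_int (3 * n - 4)"
  have q: "\<bar>q\<bar> \<ge> 1"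
  proof -
    have "3 * n - 4 \<noteq> 0" by presburger
    then have "\<bar>3 * n - 4\<bar> \<ge> 1" by linarith
    then show ?thesis unfolding q_def by linarith
  qed
  \<comment> \<open>The polynomial is invariant under the exchange of \<open>m\<close> and
    \<open>n - m\<close>, so it has no linear term in the variable \<open>2 * m - n\<close>: it
    equals \<open>q / 4\<close> times \<open>\<rho> - (2 * m - n)^2\<close>.\<close>
  define \<rho> where "\<rho> = (of_int n)^2 + 4 * (of_int (\<mu> - n^3 + 2 * n^2 - 8 * n)) / q"
  have id: "4 * real_of_int (\<mu> - P m - P (n - m)) = q * (\<rho> - (2 * of_int m - of_int n)^2)" for m
  proof -
    have "q * \<rho> = q * (of_int n)^2 + 4 * (of_int (\<mu> - n^3 + 2 * n^2 - 8 * n))"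
      using q by (auto simp: \<rho>_def field_simps)
    then have "q * (\<rho> - (2 * of_int m - of_int n)^2) =
        q * (of_int n)^2 + 4 * (of_int (\<mu> - n^3 + 2 * n^2 - 8 * n)) - q * (2 * of_int m - of_int n)^2"
      by (simp add: algebra_simps)
    also have "\<dots> = 4 * real_of_int (\<mu> - P m - P (n - m))"
      unfolding q_def P_def by (simp add: power2_eq_square power3_eq_cube algebra_simps)
    finally show ?thesis by simp
  qed
  have lower: "jbr (\<mu> - P m - P (n - m)) \<ge> 1 + \<bar>\<rho> - (2 * of_int m - of_int n)^2\<bar> / 4" for m
  proof -
    have "\<bar>\<rho> - (2 * of_int m - of_int n)^2\<bar> \<le> \<bar>q\<bar> * \<bar>\<rho> - (2 * of_int m - of_int n)^2\<bar>"
      using q by (simp add: mult_le_cancel_right1)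
    also have "\<dots> = 4 * \<bar>real_of_int (\<mu> - P m - P (n - m))\<bar>"
      unfolding abs_mult[symmetric] id[symmetric] by (simp add: abs_mult del: of_int_diff)
    finally have "\<bar>\<rho> - (2 * of_int m - of_int n)^2\<bar> \<le> 4 * \<bar>real_of_int (\<mu> - P m - P (n - m))\<bar>" .
    moreover have "x \<le> 4 * y \<Longrightarrow> 1 + x / 4 \<le> 1 + y" for x y :: real by simp
    ultimately show ?thesis unfolding jbr_def by blast
  qed
  show ?thesis
  proof (cases "\<rho> \<ge> 0")
    case False
    then have "1 + \<bar>\<rho> - (2 * of_int m - of_int n)^2\<bar> / 4 \<ge> 1 + (of_int m - of_int n / 2)^2" for m
      using zero_le_power2[of "2 * real_of_int m - of_int n"]
      by (simp add: power2_eq_square field_simps)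
    then show ?thesis using lower order_trans by blast
  next
    case True
    define r where "r = sqrt \<rho>"
    have r: "r \<ge> 0" "r^2 = \<rho>" using True by (auto simp: r_def)
    have "1 + \<bar>\<rho> - (2 * of_int m - of_int n)^2\<bar> / 4 \<ge> 1 + (of_int m - (of_int n + r) / 2)^2 \<or>
       1 + \<bar>\<rho> - (2 * of_int m - of_int n)^2\<bar> / 4 \<ge> 1 + (of_int m - (of_int n - r) / 2)^2" for m
    proof -
      define z where "z = 2 * real_of_int m - of_int n"
      have fac: "\<bar>\<rho> - z^2\<bar> = \<bar>z - r\<bar> * \<bar>z + r\<bar>"
        unfolding r(2)[symmetric] abs_mult[symmetric]
        by (subst abs_minus_cancel[symmetric]) (simp add: power2_eq_square algebra_simps)
      have e: "(of_int m - (of_int n + r) / 2)^2 = (z - r)^2 / 4" "(of_int m - (of_int n - r) / 2)^2 = (z + r)^2 / 4"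
        by (simp_all add: z_def power2_eq_square field_simps)
      \<comment> \<open>Of the two factors of \<open>\<rho> - z^2\<close>, the smaller one in
        absolute value has its square bounded by the product, so \<open>m\<close> is measured
        against the nearer zero.\<close>
      have "(z - r)^2 \<le> \<bar>\<rho> - z^2\<bar> \<or> (z + r)^2 \<le> \<bar>\<rho> - z^2\<bar>"
      proof (cases "\<bar>z - r\<bar> \<le> \<bar>z + r\<bar>")
        case True
        then have "\<bar>z - r\<bar> * \<bar>z - r\<bar> \<le> \<bar>z - r\<bar> * \<bar>z + r\<bar>" by (intro mult_left_mono) auto
        then show ?thesis unfolding fac by (simp add: power2_eq_square)
      next
        case False
        then have "\<bar>z + r\<bar> * \<bar>z + r\<bar> \<le> \<bar>z - r\<bar> * \<bar>z + r\<bar>" by (intro mult_right_mono) auto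
        then show ?thesis unfolding fac by (simp add: power2_eq_square)
      qed
      then show ?thesis unfolding e z_def[symmetric] by auto
    qed
    then show ?thesis using lower order_trans by blast
  qed
qed

lemma nnsum_jbr_phase:
  obtains C where "C \<ge> 0" "\<And>\<mu> n. (\<Sum>\<^sup>+m. ennreal (jbr (\<mu> - P m - P (n - m)) powr (-7/12))) \<le> ennreal C"
proof -
  obtain C where C: "C \<ge> 0"
    "\<And>\<theta>::real. (\<Sum>\<^sup>+m::int. ennreal ((1 + (of_int m - \<theta>)^2) powr (-7/12))) \<le> ennreal C"
    using nnsum_inverse_quadratic by blast
  have "(\<Sum>\<^sup>+m. ennreal (jbr (\<mu> - P m - P (n - m)) powr (-7/12))) \<le> ennreal (2 * C)" for \<mu> n
  proof -
    obtain \<theta>1 \<theta>2 :: real where th: "\<And>m. jbr (\<mu> - P m - P (n - m)) \<ge> 1 + (of_int m - \<theta>1)^2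
        \<or> jbr (\<mu> - P m - P (n - m)) \<ge> 1 + (of_int m - \<theta>2)^2"
      using jbr_phase_lower_bound by blast
    have "(\<Sum>\<^sup>+m. ennreal (jbr (\<mu> - P m - P (n - m)) powr (-7/12)))
      \<le> (\<Sum>\<^sup>+m. ennreal ((1 + (of_int m - \<theta>1)^2) powr (-7/12)) + ennreal ((1 + (of_int m - \<theta>2)^2) powr (-7/12)))"
    proof (rule nnsum_mono)
      fix m
      have *: "ennreal (jbr (\<mu> - P m - P (n - m)) powr (-7/12)) \<le> ennreal ((1 + (of_int m - \<theta>)^2) powr (-7/12))"
        if "jbr (\<mu> - P m - P (n - m)) \<ge> 1 + (of_int m - \<theta>)^2" for \<theta>
        using that by (intro ennreal_leI powr_mono2') (auto intro: add_pos_nonneg)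
      show "ennreal (jbr (\<mu> - P m - P (n - m)) powr (-7/12)) \<le>
        ennreal ((1 + (of_int m - \<theta>1)^2) powr (-7/12)) + ennreal ((1 + (of_int m - \<theta>2)^2) powr (-7/12))"
        using th[of m] *[of \<theta>1] *[of \<theta>2] by (auto intro: add_increasing add_increasing2)
    qed
    also have "\<dots> \<le> ennreal C + ennreal C"
      unfolding nnsum_add by (intro add_mono C)
    finally show ?thesis using C(1) by (simp add: ennreal_plus[symmetric] del: ennreal_plus)
  qed
  then show ?thesis using C(1) by (intro that[of "2 * C"]) auto
qed

definition modulation :: "int \<times> int \<Rightarrow> real" where
  "modulation k = jbr (snd k - P (fst k))"

lemma modulation_ge_1: "modulation k \<ge> 1" and modulation_pos: "modulation k > 0"
  by (simp_all add: modulation_def jbr_ge_1 jbr_pos)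

text \<open>The time frequency is summed first: at a fixed splitting of the spatial frequency this
  leaves the power \<open>-7/12\<close> of the phase. The phase is then summed over the splittings,
  uniformly in both components of \<open>K\<close>.\<close>

lemma modulation_kernel_bound:
  obtains C where "C \<ge> 0"
    "\<And>K. (\<Sum>\<^sup>+k. ennreal (1 / modulation k powr (2/3) * (1 / modulation (K - k)))) \<le> ennreal C"
proof -
  obtain C1 where C1: "C1 \<ge> 0" "\<And>\<alpha> \<beta>. (\<Sum>\<^sup>+\<tau>. ennreal (jbr (\<tau> - \<alpha>) powr (-2/3) * jbr (\<beta> - \<tau>) powr (-1)))
      \<le> ennreal (C1 * jbr (\<beta> - \<alpha>) powr (-7/12))"
    using nnsum_jbr_convolution by blast
  obtain C2 where C2: "C2 \<ge> 0"
    "\<And>\<mu> n. (\<Sum>\<^sup>+m. ennreal (jbr (\<mu> - P m - P (n - m)) powr (-7/12))) \<le> ennreal C2"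
    using nnsum_jbr_phase by blast
  have "(\<Sum>\<^sup>+k. ennreal (1 / modulation k powr (2/3) * (1 / modulation (K - k)))) \<le> ennreal (C1 * C2)" for K
  proof -
    obtain n \<tau> where K: "K = (n, \<tau>)" by fastforce
    have "(\<Sum>\<^sup>+k. ennreal (1 / modulation k powr (2/3) * (1 / modulation (K - k))))
      = (\<Sum>\<^sup>+m. \<Sum>\<^sup>+\<sigma>. ennreal (jbr (\<sigma> - P m) powr (-2/3) * jbr ((\<tau> - P (n - m)) - \<sigma>) powr (-1)))"
    proof (subst nnsum_pair[symmetric], intro nn_integral_cong)
      fix m \<sigma>
      have "1 / modulation (K - (m, \<sigma>)) = jbr ((\<tau> - P (n - m)) - \<sigma>) powr (-1)"
        by (simp add: modulation_def K powr_minus jbr_pos less_imp_le field_simps algebra_simps)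
      moreover have "1 / modulation (m, \<sigma>) powr (2/3) = jbr (\<sigma> - P m) powr (-2/3)"
        by (simp add: modulation_def powr_minus_divide)
      ultimately show "ennreal (1 / modulation (m, \<sigma>) powr (2/3) * (1 / modulation (K - (m, \<sigma>))))
        = ennreal (jbr (\<sigma> - P m) powr (-2/3) * jbr ((\<tau> - P (n - m)) - \<sigma>) powr (-1))" by simp
    qed
    also have "\<dots> \<le> (\<Sum>\<^sup>+m. ennreal (C1 * jbr (\<tau> - P m - P (n - m)) powr (-7/12)))"
    proof (rule nnsum_mono)
      fix m
      show "(\<Sum>\<^sup>+\<sigma>. ennreal (jbr (\<sigma> - P m) powr (-2/3) * jbr ((\<tau> - P (n - m)) - \<sigma>) powr (-1)))
        \<le> ennreal (C1 * jbr (\<tau> - P m - P (n - m)) powr (-7/12))"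
        using C1(2)[of "P m" "\<tau> - P (n - m)"] by (simp add: algebra_simps)
    qed
    also have "\<dots> = ennreal C1 * (\<Sum>\<^sup>+m. ennreal (jbr (\<tau> - P m - P (n - m)) powr (-7/12)))"
      using C1(1) by (simp add: ennreal_mult nnsum_cmult)
    also have "\<dots> \<le> ennreal C1 * ennreal C2"
      by (intro mult_left_mono C2) auto
    finally show ?thesis using C1(1) C2(1) by (simp add: ennreal_mult)
  qed
  then show ?thesis using C1(1) C2(1) by (intro that[of "C1 * C2"]) auto
qed

section \<open>Localization in time on the Fourier side\<close>

lemma nnsum_int_le:
  "nnsum f \<le> (\<Sum>\<^sup>+n. f (int n)) + (\<Sum>\<^sup>+n. f (- int n))"
proof -
  have "bij_betw int UNIV {0..}"
    by (rule bij_betw_byWitness[where f'=nat]) auto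
  moreover have "bij_betw (\<lambda>n. - int n) UNIV {..0}"
    by (rule bij_betw_byWitness[where f'="\<lambda>i. nat (- i)"]) auto
  ultimately have "bij_betw int UNIV {0..}" "bij_betw (\<lambda>n. - int n) UNIV {..0}" by blast+
  from this[THEN nn_integral_bij_count_space]
  have eq: "(\<Sum>\<^sup>+n. f (int n)) = (\<Sum>\<^sup>+j. f j * indicator {0..} j)"
    "(\<Sum>\<^sup>+n. f (- int n)) = (\<Sum>\<^sup>+j. f j * indicator {..0} j)"
    by (simp_all add: nn_integral_count_space_indicator)
  have "nnsum f \<le> (\<Sum>\<^sup>+j. f j * indicator {0..} j + f j * indicator {..0} j)"
    by (rule nnsum_mono) (auto simp: indicator_def)
  then show ?thesis by (simp add: nnsum_add eq)
qed

text \<open>The majorant, up to a constant, for the Fourier coefficients of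
  \<open>\<eta> (t / T)\<close>: height \<open>T\<close>, width \<open>1 / T\<close>, and the
  quadratic decay that two integrations by parts give.\<close>

definition lorentz :: "real \<Rightarrow> int \<Rightarrow> real" where
  "lorentz T m = T / (1 + (T * of_int m)^2)"

lemma lorentz_nonneg: "0 \<le> T \<Longrightarrow> 0 \<le> lorentz T m"
  by (auto simp: lorentz_def intro!: divide_nonneg_pos add_pos_nonneg)

lemma lorentz_le: "0 \<le> T \<Longrightarrow> lorentz T m \<le> T"
  unfolding lorentz_def by (rule order_trans[OF divide_left_mono[of 1]]) (auto intro!: add_pos_nonneg)

text \<open>As a function of a real variable, \<open>lorentz T\<close> is the derivative of
  \<open>arctan (T * x)\<close> and decreases for positive \<open>x\<close>; the mean value theorem
  thus yields a telescoping bound.\<close>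

lemma lorentz_le_arctan_diff:
  assumes "0 < T"
  shows "lorentz T (int (Suc n)) \<le> arctan (T * real (Suc n)) - arctan (T * real n)"
proof -
  have "\<exists>z>T * real n. z < T * real (Suc n) \<and>
      arctan (T * real (Suc n)) - arctan (T * real n) = (T * real (Suc n) - T * real n) * inverse (1 + z^2)"
    using assms by (intro MVT2) (auto intro!: DERIV_arctan)
  then obtain z where z: "T * real n < z" "z < T * real (Suc n)"
    "arctan (T * real (Suc n)) - arctan (T * real n) = T * inverse (1 + z^2)"
    by (auto simp: algebra_simps)
  have "0 \<le> z" using z(1) assms by (smt (verit) mult_nonneg_nonneg of_nat_0_le_iff)
  then have "z^2 \<le> (T * real (Suc n))^2" using z by (intro power_mono) auto
  moreover have "0 < 1 + z^2" by (intro add_pos_nonneg) auto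
  ultimately show ?thesis
    unfolding z(3) lorentz_def using assms by (auto simp: field_simps intro!: divide_left_mono mult_pos_pos)
qed

text \<open>The l^1 size is uniform in \<open>T\<close>: each half line contributes at most
  \<open>1 + pi / 2 < 3\<close>, with zero counted in both.\<close>

lemma nnsum_lorentz:
  assumes "0 < T" "T < 1"
  shows "(\<Sum>\<^sup>+m. ennreal (lorentz T m)) \<le> ennreal 6"
proof -
  have "(\<Sum>\<^sup>+n. ennreal (lorentz T (int n))) \<le> ennreal 3"
    unfolding nn_integral_count_space_nat
  proof (rule suminf_le_const[OF summableI])
    fix N
    have "(\<Sum>n<N. lorentz T (int n)) \<le> (\<Sum>n<Suc N. lorentz T (int n))"
      using lorentz_nonneg assms by simp
    also have "\<dots> = lorentz T 0 + (\<Sum>n<N. lorentz T (int (Suc n)))"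
      by (simp add: sum.lessThan_Suc_shift del: sum.lessThan_Suc)
    also have "\<dots> \<le> 1 + (\<Sum>n<N. arctan (T * real (Suc n)) - arctan (T * real n))"
      using assms by (intro add_mono sum_mono lorentz_le_arctan_diff) (auto simp: lorentz_def)
    also have "\<dots> = 1 + arctan (T * real N)"
      by (subst sum_lessThan_telescope) simp
    also have "\<dots> \<le> 3"
      using arctan_ubound[of "T * real N"] pi_less_4 by linarith
    finally have "ennreal (\<Sum>n<N. lorentz T (int n)) \<le> ennreal 3" by (rule ennreal_leI)
    then show "(\<Sum>n<N. ennreal (lorentz T (int n))) \<le> ennreal 3"
      using lorentz_nonneg[of T] assms by (simp add: sum_ennreal)
  qed
  moreover have "lorentz T (- int n) = lorentz T (int n)" for n by (simp add: lorentz_def)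
  ultimately have "(\<Sum>\<^sup>+m. ennreal (lorentz T m)) \<le> ennreal 3 + ennreal 3"
    by (intro order_trans[OF nnsum_int_le] add_mono) auto
  then show ?thesis by (simp add: ennreal_plus[symmetric] del: ennreal_plus)
qed

text \<open>A bump of width \<open>T\<close> has squared L^2 norm of order \<open>T\<close>. Here
  this is the maximum \<open>T\<close> times the l^1 bound.\<close>

lemma nnsum_lorentz_sq:
  assumes "0 < T" "T < 1"
  shows "(\<Sum>\<^sup>+m. ennreal (lorentz T m)^2) \<le> ennreal (6 * T)"
proof -
  have "(\<Sum>\<^sup>+m. ennreal (lorentz T m)^2) \<le> (\<Sum>\<^sup>+m. ennreal T * ennreal (lorentz T m))"
    using lorentz_le assms unfolding power2_eq_square
    by (intro nnsum_mono mult_right_mono ennreal_leI) auto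
  also have "\<dots> \<le> ennreal T * ennreal 6"
    unfolding nnsum_cmult by (intro mult_left_mono nnsum_lorentz assms) auto
  finally show ?thesis using assms by (simp add: ennreal_mult[symmetric] mult.commute del: ennreal_numeral)
qed

text \<open>The homogeneous H^(1/2) norm in one variable is scale invariant, so no power of
  \<open>T\<close> appears: \<open>\<bar>T * m\<bar> / (1 + (T * m)^2)\<close> is at most
  \<open>1\<close>, and the \<open>1\<close> in \<open>jbr\<close> adds at most
  \<open>T\<close>.\<close>

lemma nnsum_jbr_lorentz_sq:
  assumes "0 < T" "T < 1"
  shows "(\<Sum>\<^sup>+m. ennreal (jbr m) * ennreal (lorentz T m)^2) \<le> ennreal 12"
proof -
  have "jbr m * lorentz T m \<le> 2" for m
  proof -
    have "\<bar>T * of_int m\<bar> \<le> 1 + (T * of_int m)^2"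
      using zero_le_power2[of "\<bar>T * of_int m\<bar> - 1"] zero_le_power2[of "T * of_int m"]
      by (simp add: power2_eq_square algebra_simps)
    then have "\<bar>T * of_int m\<bar> / (1 + (T * of_int m)^2) \<le> 1"
      by (subst divide_le_eq_1_pos) (auto intro!: add_pos_nonneg)
    moreover have "jbr m * lorentz T m = lorentz T m + \<bar>T * of_int m\<bar> / (1 + (T * of_int m)^2)"
      using assms by (simp add: jbr_def lorentz_def abs_mult add_divide_distrib algebra_simps)
    ultimately show ?thesis using lorentz_le[of T m] assms by linarith
  qed
  then have "(\<Sum>\<^sup>+m. ennreal (jbr m) * ennreal (lorentz T m)^2) \<le> (\<Sum>\<^sup>+m. ennreal 2 * ennreal (lorentz T m))"
    using lorentz_nonneg[of T] assms jbr_pos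
    by (intro nnsum_mono) (auto simp: power2_eq_square ennreal_mult[symmetric] mult.assoc[symmetric] less_imp_le
        intro!: ennreal_leI mult_right_mono simp del: ennreal_numeral)
  also have "\<dots> \<le> ennreal 2 * ennreal 6"
    unfolding nnsum_cmult by (intro mult_left_mono nnsum_lorentz assms) auto
  finally show ?thesis by (simp add: ennreal_mult[symmetric] del: ennreal_numeral)
qed

section \<open>Young's inequality and multiplication by the cutoff\<close>

text \<open>Young's inequality for l^1 and l^2, by Cauchy-Schwarz with respect to the weight
  \<open>f\<close>. The square root \<open>r\<close> divides \<open>f\<close> evenly between the two
  factors.\<close>

lemma nnsum_young:
  fixes f g :: "'a::{countable,ab_group_add} \<Rightarrow> ennreal"
  shows "(\<Sum>\<^sup>+x. (\<Sum>\<^sup>+y. f y * g (x - y))^2) \<le> (nnsum f)^2 * (\<Sum>\<^sup>+x. g x ^ 2)"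
proof -
  have root: "\<exists>r. r^2 = f y" for y
  proof (cases "f y")
    case (real c)
    then show ?thesis by (intro exI[of _ "ennreal (sqrt c)"]) (simp add: ennreal_power)
  qed (auto intro: exI[of _ top])
  obtain r where r: "\<And>y. r y ^ 2 = f y" using root by metis
  have "(\<Sum>\<^sup>+y. f y * g (x - y))^2 \<le> nnsum f * (\<Sum>\<^sup>+y. f y * g (x - y)^2)" for x
  proof -
    have "(\<Sum>\<^sup>+y. f y * g (x - y))^2 = (\<Sum>\<^sup>+y. r y * (r y * g (x - y)))^2"
      by (simp add: r[symmetric] power2_eq_square mult.assoc)
    also have "(\<Sum>\<^sup>+y. r y * (r y * g (x - y)))^2 \<le> (\<Sum>\<^sup>+y. r y ^ 2) * (\<Sum>\<^sup>+y. (r y * g (x - y))^2)"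
      by (rule nnsum_Cauchy_Schwarz)
    finally show ?thesis by (simp add: r power_mult_distrib)
  qed
  then have "(\<Sum>\<^sup>+x. (\<Sum>\<^sup>+y. f y * g (x - y))^2) \<le> nnsum f * (\<Sum>\<^sup>+x. \<Sum>\<^sup>+y. f y * g (x - y)^2)"
    by (subst nnsum_cmult[symmetric]) (rule nnsum_mono)
  also have "(\<Sum>\<^sup>+x. \<Sum>\<^sup>+y. f y * g (x - y)^2) = nnsum f * (\<Sum>\<^sup>+x. g x ^ 2)"
    by (subst nnsum_swap) (simp add: nnsum_cmult nnsum_shift(2)[of "\<lambda>x. g x ^ 2"])
  finally show ?thesis by (simp add: power2_eq_square mult.assoc)
qed

lemma ennreal_power2_add_le: "(x + y)^2 \<le> 2 * (x^2 + y^2)" for x y :: ennreal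
proof (cases x; cases y)
  fix a b assume *: "0 \<le> a" "x = ennreal a" "0 \<le> b" "y = ennreal b"
  have "(a + b)^2 \<le> 2 * (a^2 + b^2)"
    using zero_le_power2[of "a - b"] by (simp add: power2_eq_square algebra_simps)
  then have "ennreal ((a + b)^2) \<le> ennreal (2 * (a^2 + b^2))" by (rule ennreal_leI)
  then show ?thesis using * by (simp add: ennreal_power[symmetric] ennreal_mult ennreal_plus)
qed (auto simp: ennreal_mult_top)

(* The gain: x^(2/3) <= T^(1/3) (1/T + x) interpolates between the L^2 bound O(T) coming from
   the shrinking support and the scale invariant H^(1/2) bound. *)
lemma lorentz_convolution_gain:
  fixes a :: "int \<Rightarrow> ennreal"
  assumes T: "0 < T" "T < 1"
  shows "(\<Sum>\<^sup>+\<tau>. ennreal (jbr (\<tau> - p) powr (2/3)) * (\<Sum>\<^sup>+\<sigma>. a \<sigma> * ennreal (lorentz T (\<tau> - \<sigma>)))^2)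
    \<le> ennreal (72 * T powr (1/3)) * ((nnsum a)^2 + (\<Sum>\<^sup>+\<tau>. ennreal (jbr (\<tau> - p)) * a \<tau> ^ 2))"
proof -
  define h where "h m = ennreal (lorentz T m)" for m
  define V where "V \<tau> = (\<Sum>\<^sup>+\<sigma>. a \<sigma> * h (\<tau> - \<sigma>))" for \<tau>
  define A where "A = (nnsum a)^2"
  define B where "B = (\<Sum>\<^sup>+\<tau>. ennreal (jbr (\<tau> - p)) * a \<tau> ^ 2)"
  define s where "s j = ennreal (sqrt (jbr j))" for j
  have s2: "s j ^ 2 = ennreal (jbr j)" for j
    unfolding s_def using jbr_pos[of j] by (simp add: ennreal_power less_imp_le)
  have h: "nnsum h \<le> ennreal 6"
    using nnsum_lorentz[OF T] by (simp add: h_def[abs_def] del: ennreal_numeral)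
  \<comment> \<open>Here \<open>a\<close> takes the l^1 role and the kernel the l^2 role; this is
    where the \<open>Y\<close> norm enters.\<close>
  have L2: "(\<Sum>\<^sup>+\<tau>. V \<tau> ^ 2) \<le> A * ennreal (6 * T)"
    unfolding V_def A_def by (rule order_trans[OF nnsum_young])
      (auto simp: h_def intro!: mult_left_mono nnsum_lorentz_sq T)
  have H: "(\<Sum>\<^sup>+\<tau>. ennreal (jbr (\<tau> - p)) * V \<tau> ^ 2) \<le> 2 * (ennreal 36 * B + A * ennreal 12)"
  proof -
    \<comment> \<open>A Leibniz rule: the square root of the weight is subadditive, so the weight
      falls either on \<open>a\<close> (\<open>V1\<close>) or on the kernel
      (\<open>V2\<close>).\<close>
    define V1 where "V1 \<tau> = (\<Sum>\<^sup>+\<sigma>. (s (\<sigma> - p) * a \<sigma>) * h (\<tau> - \<sigma>))" for \<tau>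
    define V2 where "V2 \<tau> = (\<Sum>\<^sup>+\<sigma>. a \<sigma> * (s (\<tau> - \<sigma>) * h (\<tau> - \<sigma>)))" for \<tau>
    have "ennreal (jbr (\<tau> - p)) * V \<tau> ^ 2 \<le> 2 * (V1 \<tau> ^ 2 + V2 \<tau> ^ 2)" for \<tau>
    proof -
      have "s (\<tau> - p) \<le> s (\<sigma> - p) + s (\<tau> - \<sigma>)" for \<sigma>
      proof -
        have "sqrt (jbr (\<tau> - p)) \<le> sqrt (jbr (\<sigma> - p) + jbr (\<tau> - \<sigma>))"
          using jbr_add_le[of "\<sigma> - p" "\<tau> - \<sigma>"] by simp
        also have "\<dots> \<le> sqrt (jbr (\<sigma> - p)) + sqrt (jbr (\<tau> - \<sigma>))"
          by (intro sqrt_add_le_add_sqrt) (auto simp: jbr_pos less_imp_le)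
        finally show ?thesis unfolding s_def
          using jbr_pos by (subst ennreal_plus[symmetric]) (auto intro: ennreal_leI simp: less_imp_le simp del: ennreal_plus)
      qed
      then have "s (\<tau> - p) * V \<tau> \<le> (\<Sum>\<^sup>+\<sigma>. (s (\<sigma> - p) + s (\<tau> - \<sigma>)) * (a \<sigma> * h (\<tau> - \<sigma>)))"
        unfolding V_def nnsum_cmult[symmetric] by (intro nnsum_mono mult_right_mono) auto
      also have "\<dots> = V1 \<tau> + V2 \<tau>"
        unfolding V1_def V2_def nnsum_add[symmetric] by (simp add: distrib_left distrib_right ac_simps)
      finally have "(s (\<tau> - p) * V \<tau>)^2 \<le> (V1 \<tau> + V2 \<tau>)^2" by (rule power_mono) simp
      also have "\<dots> \<le> 2 * (V1 \<tau> ^ 2 + V2 \<tau> ^ 2)" by (rule ennreal_power2_add_le)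
      finally show ?thesis by (simp add: power_mult_distrib s2)
    qed
    then have "(\<Sum>\<^sup>+\<tau>. ennreal (jbr (\<tau> - p)) * V \<tau> ^ 2) \<le> (\<Sum>\<^sup>+\<tau>. 2 * (V1 \<tau> ^ 2 + V2 \<tau> ^ 2))"
      by (rule nnsum_mono)
    also have "\<dots> = 2 * ((\<Sum>\<^sup>+\<tau>. V1 \<tau> ^ 2) + (\<Sum>\<^sup>+\<tau>. V2 \<tau> ^ 2))"
      by (simp add: nnsum_cmult nnsum_add)
    also have "\<dots> \<le> 2 * (ennreal 36 * B + A * ennreal 12)"
    proof (intro mult_left_mono add_mono)
      \<comment> \<open>For \<open>V1\<close> the roles in Young's inequality are exchanged: the
        kernel is summed in l^1 and the weighted \<open>a\<close> in l^2.\<close>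
      have "V1 \<tau> = (\<Sum>\<^sup>+\<sigma>. h \<sigma> * (s (\<tau> - \<sigma> - p) * a (\<tau> - \<sigma>)))" for \<tau>
        unfolding V1_def using nnsum_shift(4)[of "\<lambda>\<sigma>. (s (\<sigma> - p) * a \<sigma>) * h (\<tau> - \<sigma>)" \<tau>]
        by (simp add: mult.commute)
      then have "(\<Sum>\<^sup>+\<tau>. V1 \<tau> ^ 2) \<le> (nnsum h)^2 * (\<Sum>\<^sup>+\<tau>. (s (\<tau> - p) * a \<tau>)^2)"
        using nnsum_young[of h "\<lambda>\<tau>. s (\<tau> - p) * a \<tau>"] by simp
      also have "\<dots> \<le> (ennreal 6)^2 * B"
        unfolding B_def power_mult_distrib s2
        by (intro mult_right_mono power_mono h) auto
      finally show "(\<Sum>\<^sup>+\<tau>. V1 \<tau> ^ 2) \<le> ennreal 36 * B"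
        by (simp add: ennreal_power del: ennreal_numeral)
      have "(\<Sum>\<^sup>+\<tau>. V2 \<tau> ^ 2) \<le> A * (\<Sum>\<^sup>+\<tau>. (s \<tau> * h \<tau>)^2)"
        unfolding V2_def A_def by (rule nnsum_young)
      also have "\<dots> \<le> A * ennreal 12"
        unfolding power_mult_distrib s2 h_def by (intro mult_left_mono nnsum_jbr_lorentz_sq T) auto
      finally show "(\<Sum>\<^sup>+\<tau>. V2 \<tau> ^ 2) \<le> A * ennreal 12" .
    qed auto
    finally show ?thesis .
  qed
  have interp: "x powr (2/3) \<le> T powr (1/3) * (1 / T + x)" if "x \<ge> 1" for x :: real
  proof (cases "x \<le> 1 / T")
    case True
    have "x powr (2/3) \<le> (1 / T) powr (2/3)" using True that by (intro powr_mono2) auto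
    also have "\<dots> = T powr (1/3) * (1 / T)"
      using T powr_add[of T "-2/3" 1] powr_add[of T "1/3" "-1"]
      by (simp add: powr_divide powr_minus field_simps)
    also have "\<dots> \<le> T powr (1/3) * (1 / T + x)" using that by (intro mult_left_mono) auto
    finally show ?thesis .
  next
    case False
    have "(1 / T) powr (1/3) \<le> x powr (1/3)" using False T by (intro powr_mono2) auto
    then have "1 \<le> T powr (1/3) * x powr (1/3)" using T by (simp add: powr_divide field_simps)
    then have "x powr (2/3) * 1 \<le> x powr (2/3) * (T powr (1/3) * x powr (1/3))" by (intro mult_left_mono) auto
    also have "\<dots> = T powr (1/3) * x" using that by (simp add: powr_add[symmetric])
    also have "\<dots> \<le> T powr (1/3) * (1 / T + x)" using T by (intro mult_left_mono) auto
    finally show ?thesis by simp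
  qed
  have "(\<Sum>\<^sup>+\<tau>. ennreal (jbr (\<tau> - p) powr (2/3)) * V \<tau> ^ 2)
      \<le> (\<Sum>\<^sup>+\<tau>. ennreal (T powr (1/3)) * (ennreal (1 / T) * V \<tau> ^ 2 + ennreal (jbr (\<tau> - p)) * V \<tau> ^ 2))"
  proof (rule nnsum_mono)
    fix \<tau>
    have "ennreal (jbr (\<tau> - p) powr (2/3)) * V \<tau> ^ 2 \<le> ennreal (T powr (1/3) * (1 / T + jbr (\<tau> - p))) * V \<tau> ^ 2"
      by (intro mult_right_mono ennreal_leI interp jbr_ge_1) auto
    also have "\<dots> = ennreal (T powr (1/3)) * (ennreal (1 / T) * V \<tau> ^ 2 + ennreal (jbr (\<tau> - p)) * V \<tau> ^ 2)"
      using T jbr_pos[of "\<tau> - p"] by (simp add: ennreal_mult ennreal_plus less_imp_le distrib_right mult.assoc)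
    finally show "ennreal (jbr (\<tau> - p) powr (2/3)) * V \<tau> ^ 2
      \<le> ennreal (T powr (1/3)) * (ennreal (1 / T) * V \<tau> ^ 2 + ennreal (jbr (\<tau> - p)) * V \<tau> ^ 2)" .
  qed
  also have "\<dots> = ennreal (T powr (1/3)) * (ennreal (1 / T) * (\<Sum>\<^sup>+\<tau>. V \<tau> ^ 2)
      + (\<Sum>\<^sup>+\<tau>. ennreal (jbr (\<tau> - p)) * V \<tau> ^ 2))"
    by (simp add: nnsum_cmult nnsum_add)
  also have "\<dots> \<le> ennreal (T powr (1/3)) * (ennreal (1 / T) * (A * ennreal (6 * T)) + 2 * (ennreal 36 * B + A * ennreal 12))"
    by (intro mult_left_mono add_mono L2 H) auto
  also have "ennreal (1 / T) * (A * ennreal (6 * T)) = ennreal 6 * A"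
  proof -
    have "ennreal (1 / T) * ennreal (6 * T) = ennreal 6"
      using T by (simp add: ennreal_mult[symmetric] del: ennreal_numeral)
    then show ?thesis by (metis mult.assoc mult.commute)
  qed
  \<comment> \<open>\<open>30 = 6 + 2 * 12\<close> and \<open>72 = 2 * 36\<close>, where
    \<open>36\<close> is the square of the l^1 bound \<open>6\<close>.\<close>
  also have "ennreal 6 * A + 2 * (ennreal 36 * B + A * ennreal 12) = 30 * A + 72 * B"
    by (simp add: distrib_left mult.assoc[symmetric] mult.commute[of A] add.assoc[symmetric]
        distrib_right[symmetric] add.commute)
  finally have bound: "(\<Sum>\<^sup>+\<tau>. ennreal (jbr (\<tau> - p) powr (2/3)) * V \<tau> ^ 2)
      \<le> ennreal (T powr (1/3)) * (30 * A + 72 * B)" .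
  have "30 * A + 72 * B \<le> 72 * (A + B)"
    unfolding distrib_left by (intro add_mono mult_right_mono) auto
  then have "ennreal (T powr (1/3)) * (30 * A + 72 * B) \<le> ennreal (T powr (1/3)) * (72 * (A + B))"
    by (rule mult_left_mono) simp
  then show ?thesis
    using bound unfolding V_def h_def A_def B_def by (simp add: ennreal_mult ac_simps)
qed

section \<open>Trigonometric polynomials on the torus\<close>

abbreviation torus :: "(real \<times> real) measure" where
  "torus \<equiv> lebesgue_on torus_cell"

definition character :: "int \<times> int \<Rightarrow> real \<times> real \<Rightarrow> complex" where
  "character k z = cis (of_int (fst k) * fst z + of_int (snd k) * snd z)"

lemma character_add: "character (k + l) z = character k z * character l z"
  by (simp add: character_def cis_mult algebra_simps)

lemma character_uminus: "character (- k) z = cnj (character k z)"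
  by (simp add: character_def cis_cnj)

lemma character_zero: "character 0 z = 1"
  by (simp add: character_def)

lemma norm_character: "norm (character k z) = 1"
  by (simp add: character_def)

lemma torus_cell_borel: "torus_cell \<in> sets borel"
  unfolding torus_cell_def by (intro borel_Times) auto

lemma torus_cell_lebesgue: "torus_cell \<in> sets lebesgue"
  using torus_cell_borel by simp

lemma character_borel [measurable]: "character k \<in> borel_measurable borel"
  unfolding character_def[abs_def] by (intro borel_measurable_continuous_onI continuous_intros)

lemma borel_imp_torus_measurable:
  "f \<in> borel_measurable borel \<Longrightarrow> f \<in> borel_measurable torus"
  by (intro measurable_restrict_space1 measurable_completion) simp

lemma character_torus [measurable]: "character k \<in> borel_measurable torus"
  by (intro borel_imp_torus_measurable character_borel)

lemma emeasure_torus_cell: "emeasure lebesgue torus_cell = ennreal ((2 * pi)^2)"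
proof -
  have eq: "torus_cell = cbox (0, 0) (2 * pi, 2 * pi)"
    by (simp add: torus_cell_def cbox_Pair_eq)
  have "emeasure lborel torus_cell = ennreal (measure lborel torus_cell)"
    unfolding eq using emeasure_lborel_cbox_finite[of "(0, 0) :: real \<times> real" "(2 * pi, 2 * pi)"]
    by (intro emeasure_eq_ennreal_measure) auto
  moreover have "measure lborel torus_cell = (2 * pi)^2"
    unfolding eq by (simp add: content_Pair power2_eq_square)
  ultimately show ?thesis using torus_cell_borel by simp
qed

lemma finite_measure_torus: "finite_measure torus"
  by (rule finite_measureI) (simp add: emeasure_restrict_space torus_cell_lebesgue emeasure_torus_cell)

lemma torus_integrable_altdef:
  "torus_integrable u \<longleftrightarrow>
    (\<forall>x t. u (x + 2*pi, t) = u (x, t) \<and> u (x, t + 2*pi) = u (x, t)) \<and> integrable torus u"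
  unfolding torus_integrable_def set_integrable_def
  by (subst integrable_restrict_space) (auto simp: torus_cell_lebesgue)

lemma fourier_coeff_altdef:
  "fourier_coeff u n \<tau> = (1 / (2*pi)^2) *\<^sub>R (LINT z|torus. u z * character (- (n, \<tau>)) z)"
  unfolding fourier_coeff_def set_lebesgue_integral_def
  by (subst integral_restrict_space) (auto simp: torus_cell_lebesgue character_def split_beta intro!: arg_cong2[where f=scaleR] Bochner_Integration.integral_cong)

lemma integral_torus_product:
  fixes f g :: "real \<Rightarrow> complex"
  assumes f: "f \<in> borel_measurable borel" "\<And>x. norm (f x) \<le> B"
    and g: "g \<in> borel_measurable borel" "\<And>x. norm (g x) \<le> B"
  shows "(LINT z|torus. f (fst z) * g (snd z))
    = (LINT x:{0..2*pi}|lborel. f x) * (LINT t:{0..2*pi}|lborel. g t)"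
proof -
  note [measurable] = f(1) g(1)
  define F where "F z = indicator {0..2*pi} (fst z) *\<^sub>R f (fst z) * (indicator {0..2*pi} (snd z) *\<^sub>R g (snd z))"
    for z :: "real \<times> real"
  have "(LINT z|torus. f (fst z) * g (snd z)) = (LINT z|lebesgue. F z)"
    using torus_cell_lebesgue by (subst integral_restrict_space)
      (auto simp: F_def torus_cell_def indicator_def intro!: Bochner_Integration.integral_cong)
  also have "\<dots> = (LINT z|lborel. F z)"
  proof (rule integral_completion)
    have "F \<in> borel_measurable (borel \<Otimes>\<^sub>M borel)" unfolding F_def by measurable
    then show "F \<in> borel_measurable lborel" by (simp add: borel_prod)
  qed
  also have "\<dots> = (LINT z|(lborel \<Otimes>\<^sub>M lborel). F z)"
    by (simp add: lborel_prod)
  also have "\<dots> = (LINT x|lborel. LINT t|lborel. F (x, t))"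
  proof (rule lborel_pair.integral_fst'[symmetric])
    have "set_integrable lborel torus_cell (\<lambda>z. f (fst z) * g (snd z))"
      unfolding set_integrable_def
    proof (rule integrableI_bounded_set_indicator[where B="B * B"])
      show "torus_cell \<in> sets lborel" using torus_cell_borel by simp
      have "(\<lambda>z. f (fst z) * g (snd z)) \<in> borel_measurable (borel \<Otimes>\<^sub>M borel)" by measurable
      then show "(\<lambda>z. f (fst z) * g (snd z)) \<in> borel_measurable lborel" by (simp add: borel_prod)
      have "emeasure lebesgue torus_cell = emeasure lborel torus_cell"
        using torus_cell_borel by simp
      then show "emeasure lborel torus_cell < \<infinity>"
        using emeasure_torus_cell by (metis ennreal_less_top infinity_ennreal_def)
      have "norm (f (fst z) * g (snd z)) \<le> B * B" for z
        unfolding norm_mult using f(2) g(2) norm_ge_zero order_trans by (intro mult_mono) blast+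
      then show "AE x in lborel. x \<in> torus_cell \<longrightarrow> norm (f (fst x) * g (snd x)) \<le> B * B" by simp
    qed
    then have "integrable lborel F"
      unfolding set_integrable_def
      by (rule back_subst[where P="integrable lborel"]) (auto simp: F_def torus_cell_def indicator_def fun_eq_iff)
    then show "integrable (lborel \<Otimes>\<^sub>M lborel) F" by (simp add: lborel_prod)
  qed
  also have "\<dots> = (LINT x:{0..2*pi}|lborel. f x) * (LINT t:{0..2*pi}|lborel. g t)"
    unfolding F_def set_lebesgue_integral_def fst_conv snd_conv
      integral_mult_right_zero integral_mult_left_zero ..
  finally show ?thesis .
qed

lemma integral_cis_period:
  "(LINT x:{0..2*pi}|lborel. cis (of_int n * x)) = (if n = 0 then 2 * pi else 0)"
proof (cases "n = 0")
  case True
  then show ?thesis by (simp add: set_lebesgue_integral_def scaleR_conv_of_real)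
next
  case False
  define G where "G x = cis (of_int n * x) / (\<i> * of_int n)" for x :: real
  have "(LBINT x=0..2*pi. cis (of_int n * x)) = G (2*pi) - G 0"
    unfolding zero_ereal_def
  proof (rule interval_integral_FTC_finite)
    show "continuous_on {min 0 (2*pi)..max 0 (2*pi)} (\<lambda>x. cis (of_int n * x))"
      by (intro continuous_intros)
    fix x :: real
    show "(G has_vector_derivative cis (of_int n * x)) (at x within {min 0 (2*pi)..max 0 (2*pi)})"
      unfolding G_def cis_conv_exp of_real_mult of_real_of_int_eq using False
      by (intro has_vector_derivative_real_field[where f="\<lambda>z. exp (\<i> * (of_int n * z)) / (\<i> * of_int n)"])
        (auto intro!: derivative_eq_intros simp: mult.commute[of _ \<i>])
  qed
  moreover have "cis (of_int n * (2 * pi)) = 1"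
    using cis_multiple_2pi[of "of_int n"] by (simp add: mult.commute)
  ultimately have "(LBINT x=0..2*pi. cis (of_int n * x)) = 0" by (simp add: G_def)
  then show ?thesis using False interval_integral_Icc[of 0 "2*pi" "\<lambda>x. cis (of_int n * x)"]
    by (simp add: zero_ereal_def)
qed

lemma integral_character: "(LINT z|torus. character k z) = (if k = 0 then (2 * pi)^2 else 0)"
proof -
  have "(LINT z|torus. character k z) =
    (LINT x:{0..2*pi}|lborel. cis (of_int (fst k) * x)) * (LINT t:{0..2*pi}|lborel. cis (of_int (snd k) * t))"
  proof (subst integral_torus_product[where B=1, symmetric])
    show "(\<lambda>x. cis (of_int (fst k) * x)) \<in> borel_measurable borel" "(\<lambda>x. cis (of_int (snd k) * x)) \<in> borel_measurable borel"
      by (intro borel_measurable_continuous_onI continuous_intros)+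
  qed (auto simp: character_def cis_mult intro!: Bochner_Integration.integral_cong)
  then show ?thesis by (auto simp: integral_cis_period prod_eq_iff power2_eq_square)
qed

lemma integrable_bounded_torus:
  fixes f :: "_ \<Rightarrow> 'a::{banach,second_countable_topology}"
  assumes "f \<in> borel_measurable torus" "\<And>z. norm (f z) \<le> B"
  shows "integrable torus f"
  using assms by (intro finite_measure.integrable_const_bound[OF finite_measure_torus, of _ B]) auto

lemma integrable_times_character:
  assumes "integrable torus u"
  shows "integrable torus (\<lambda>z. u z * character k z)"
  by (rule Bochner_Integration.integrable_bound[OF assms])
    (use assms in \<open>auto simp: norm_mult norm_character\<close>)

definition trig_poly :: "(int \<times> int) set \<Rightarrow> (int \<times> int \<Rightarrow> complex) \<Rightarrow> real \<times> real \<Rightarrow> complex" where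
  "trig_poly S c z = (\<Sum>k\<in>S. c k * character k z)"

lemma trig_poly_measurable [measurable]: "trig_poly S c \<in> borel_measurable torus"
  unfolding trig_poly_def[abs_def] by measurable

lemma norm_trig_poly_le: "norm (trig_poly S c z) \<le> (\<Sum>k\<in>S. norm (c k))"
  unfolding trig_poly_def by (rule order_trans[OF norm_sum]) (simp add: norm_mult norm_character)

lemma integrable_trig_poly: "integrable torus (trig_poly S c)"
  by (rule integrable_bounded_torus[OF _ norm_trig_poly_le]) measurable

lemma fourier_coeff_trig_poly:
  assumes "finite S"
  shows "fourier_coeff (trig_poly S c) n \<tau> = (if (n, \<tau>) \<in> S then c (n, \<tau>) else 0)"
proof -
  have "(LINT z|torus. trig_poly S c z * character (- (n, \<tau>)) z)
    = (LINT z|torus. (\<Sum>k\<in>S. c k * character (k - (n, \<tau>)) z))"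
    unfolding trig_poly_def sum_distrib_right
    by (simp only: mult.assoc character_add[symmetric] add_uminus_conv_diff)
  also have "\<dots> = (\<Sum>k\<in>S. c k * (LINT z|torus. character (k - (n, \<tau>)) z))"
    by (subst Bochner_Integration.integral_sum)
      (auto intro!: integrable_mult_right integrable_bounded_torus[where B=1] simp: norm_character)
  also have "\<dots> = (\<Sum>k\<in>S. if k = (n, \<tau>) then c k * (2 * pi)^2 else 0)"
    by (intro sum.cong) (auto simp: integral_character)
  also have "\<dots> = (if (n, \<tau>) \<in> S then c (n, \<tau>) * (2 * pi)^2 else 0)"
    using assms by simp
  finally show ?thesis
    unfolding fourier_coeff_altdef by (simp add: scaleR_conv_of_real)
qed

lemma nn_integral_norm_trig_poly_sq:
  assumes "finite S"
  shows "(\<integral>\<^sup>+z. ennreal (norm (trig_poly S c z) ^ 2) \<partial>torus) = ennreal ((2 * pi)^2 * (\<Sum>k\<in>S. norm (c k)^2))"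
proof -
  have "(LINT z|torus. trig_poly S c z * cnj (trig_poly S c z))
      = (LINT z|torus. (\<Sum>k\<in>S. cnj (c k) * (trig_poly S c z * character (- k) z)))"
    by (simp add: trig_poly_def[of S c] cnj_sum sum_distrib_left character_uminus mult.commute mult.left_commute)
  also have "\<dots> = (\<Sum>k\<in>S. cnj (c k) * (LINT z|torus. trig_poly S c z * character (- k) z))"
    by (subst Bochner_Integration.integral_sum)
      (auto intro!: integrable_mult_right integrable_times_character integrable_trig_poly)
  also have "\<dots> = (\<Sum>k\<in>S. cnj (c k) * ((2 * pi)^2 * c k))"
  proof (intro sum.cong refl arg_cong2[where f="(*)"])
    fix k assume "k \<in> S"
    then have "fourier_coeff (trig_poly S c) (fst k) (snd k) = c k"
      using assms by (simp add: fourier_coeff_trig_poly)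
    then show "(LINT z|torus. trig_poly S c z * character (- k) z) = (2 * pi)^2 * c k"
      unfolding fourier_coeff_altdef prod.collapse by (auto simp: scaleR_conv_of_real field_simps)
  qed
  also have "\<dots> = of_real ((2 * pi)^2 * (\<Sum>k\<in>S. norm (c k)^2))"
    unfolding sum_distrib_left of_real_sum
  proof (rule sum.cong[OF refl])
    fix k
    show "cnj (c k) * ((2 * pi)^2 * c k) = of_real ((2 * pi)^2 * norm (c k)^2)"
      using complex_norm_square[of "c k"] by (simp add: mult_ac)
  qed
  finally have c: "(LINT z|torus. trig_poly S c z * cnj (trig_poly S c z)) = of_real ((2 * pi)^2 * (\<Sum>k\<in>S. norm (c k)^2))" .
  have "complex_of_real (LINT z|torus. norm (trig_poly S c z) ^ 2) = (LINT z|torus. trig_poly S c z * cnj (trig_poly S c z))"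
    by (simp only: integral_complex_of_real[symmetric] complex_norm_square)
  then have "(LINT z|torus. norm (trig_poly S c z) ^ 2) = (2 * pi)^2 * (\<Sum>k\<in>S. norm (c k)^2)"
    unfolding c of_real_eq_iff .
  moreover have "integrable torus (\<lambda>z. norm (trig_poly S c z) ^ 2)"
    by (rule integrable_bounded_torus[where B="(\<Sum>k\<in>S. norm (c k))^2"])
      (auto intro!: power_mono norm_trig_poly_le)
  ultimately show ?thesis by (subst nn_integral_eq_integral) auto
qed

section \<open>Squares of trigonometric polynomials and the L^4 bound\<close>

lemma trig_poly_power2:
  assumes "finite S"
  shows "trig_poly S c z ^ 2
    = trig_poly ((\<lambda>p. fst p + snd p) ` (S \<times> S)) (\<lambda>K. \<Sum>k | k \<in> S \<and> K - k \<in> S. c k * c (K - k)) z"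
proof -
  have "trig_poly S c z ^ 2 = (\<Sum>p\<in>S \<times> S. c (fst p) * c (snd p) * character (fst p + snd p) z)"
    by (simp add: trig_poly_def power2_eq_square sum_product sum.cartesian_product split_beta character_add mult_ac)
  also have "\<dots> = (\<Sum>K\<in>(\<lambda>p. fst p + snd p) ` (S \<times> S).
      \<Sum>p | p \<in> S \<times> S \<and> fst p + snd p = K. c (fst p) * c (snd p) * character (fst p + snd p) z)"
    using assms by (intro sum.image_gen) auto
  also have "\<dots> = (\<Sum>K\<in>(\<lambda>p. fst p + snd p) ` (S \<times> S).
      \<Sum>k | k \<in> S \<and> K - k \<in> S. c k * c (K - k) * character K z)"
    by (intro sum.cong refl sum.reindex_bij_witness[where i="\<lambda>k. (k, K - k)" and j=fst for K]) auto
  finally show ?thesis by (simp add: trig_poly_def sum_distrib_right)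
qed

text \<open>The fourth power of the L^4 norm is the squared L^2 norm of the square, whose
  coefficients are convolutions, so Parseval and the kernel bound apply. The weight
  \<open>modulation k powr (2/3)\<close> is enlarged to \<open>modulation k\<close>, since the lemma
  only serves the convergence of partial sums. The indicator allows its use on frequency blocks with
  small weighted mass.\<close>

lemma trig_poly_L4:
  obtains C where "C \<ge> 0" "\<And>S c. finite S \<Longrightarrow> (\<integral>\<^sup>+z. ennreal (norm (trig_poly S c z) ^ 4) \<partial>torus)
      \<le> ennreal C * (\<Sum>\<^sup>+k. ennreal (modulation k) * (ennreal (norm (c k)) * indicator S k)^2)^2"
proof -
  obtain C where C: "C \<ge> 0"
    "\<And>K. (\<Sum>\<^sup>+k. ennreal (1 / modulation k powr (2/3) * (1 / modulation (K - k)))) \<le> ennreal C"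
    using modulation_kernel_bound by blast
  have "(\<integral>\<^sup>+z. ennreal (norm (trig_poly S c z) ^ 4) \<partial>torus)
      \<le> ennreal ((2 * pi)^2 * C) * (\<Sum>\<^sup>+k. ennreal (modulation k) * (ennreal (norm (c k)) * indicator S k)^2)^2"
    if S: "finite S" for S c
  proof -
    define F where "F = (\<lambda>p. fst p + snd p) ` (S \<times> S)"
    define D where "D K = (\<Sum>k | k \<in> S \<and> K - k \<in> S. c k * c (K - k))" for K
    define a where "a k = ennreal (norm (c k)) * indicator S k" for k
    define N where "N = (\<Sum>\<^sup>+k. ennreal (modulation k) * a k ^ 2)"
    have F: "finite F" using S by (simp add: F_def)
    have sq: "trig_poly S c z ^ 2 = trig_poly F D z" for z
      unfolding F_def D_def by (rule trig_poly_power2[OF S])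
    have p4: "x ^ 4 = (x ^ 2) ^ 2" for x :: real by simp
    have D: "ennreal (norm (D K)) \<le> (\<Sum>\<^sup>+k. a k * a (K - k))" for K
    proof -
      have "ennreal (norm (D K)) \<le> ennreal (\<Sum>k | k \<in> S \<and> K - k \<in> S. norm (c k) * norm (c (K - k)))"
        unfolding D_def by (intro ennreal_leI order_trans[OF norm_sum]) (simp add: norm_mult)
      also have "\<dots> = (\<Sum>k | k \<in> S \<and> K - k \<in> S. a k * a (K - k))"
        by (subst sum_ennreal[symmetric]) (auto simp: a_def ennreal_mult)
      also have "\<dots> \<le> (\<Sum>\<^sup>+k. a k * a (K - k))"
        using S by (intro sum_le_nnsum) auto
      finally show ?thesis .
    qed
    have "(\<integral>\<^sup>+z. ennreal (norm (trig_poly S c z) ^ 4) \<partial>torus) = (\<integral>\<^sup>+z. ennreal (norm (trig_poly F D z) ^ 2) \<partial>torus)"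
      unfolding p4 norm_power[symmetric] sq ..
    also have "\<dots> = ennreal ((2 * pi)^2) * (\<Sum>K\<in>F. ennreal (norm (D K)) ^ 2)"
      by (subst nn_integral_norm_trig_poly_sq[OF F])
        (simp add: ennreal_mult sum_nonneg ennreal_power sum_ennreal)
    also have "\<dots> \<le> ennreal ((2 * pi)^2) * (\<Sum>\<^sup>+K. (\<Sum>\<^sup>+k. a k * a (K - k))^2)"
      by (intro mult_left_mono order_trans[OF sum_mono sum_le_nnsum] power_mono D F) auto
    also have "(\<Sum>\<^sup>+K. (\<Sum>\<^sup>+k. a k * a (K - k))^2)
        \<le> ennreal C * (\<Sum>\<^sup>+k. ennreal (modulation k powr (2/3)) * a k ^ 2) * (\<Sum>\<^sup>+k. ennreal (modulation k) * a k ^ 2)"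
      using C(2) by (intro nnsum_weighted_conv) (auto simp: modulation_pos less_imp_neq[symmetric])
    also have "(\<Sum>\<^sup>+k. ennreal (modulation k powr (2/3)) * a k ^ 2) \<le> N"
      unfolding N_def
    proof (intro nnsum_mono mult_right_mono ennreal_leI)
      fix k show "modulation k powr (2/3) \<le> modulation k"
        using powr_mono[of "2/3" 1 "modulation k"] modulation_ge_1[of k] by simp
    qed auto
    finally have "(\<integral>\<^sup>+z. ennreal (norm (trig_poly S c z) ^ 4) \<partial>torus) \<le> ennreal ((2 * pi)^2) * (ennreal C * N * N)"
      by (simp add: N_def mult_left_mono mult_right_mono)
    also have "\<dots> = ennreal ((2 * pi)^2 * C) * N^2"
      using C(1) by (simp add: ennreal_mult power2_eq_square mult.assoc)
    finally show ?thesis unfolding N_def a_def .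
  qed
  then show ?thesis using C(1) by (intro that[of "(2 * pi)^2 * C"]) auto
qed

section \<open>Uniqueness of Fourier coefficients\<close>

text \<open>The torus as a compact subset of the product of two complex planes. Functions composed
  with \<open>circle2\<close> are periodic by construction, and Stone-Weierstrass applies on the
  image.\<close>

definition circle2 :: "real \<times> real \<Rightarrow> complex \<times> complex" where
  "circle2 z = (cis (fst z), cis (snd z))"

lemma continuous_circle2: "continuous_on A circle2"
  unfolding circle2_def[abs_def] by (intro continuous_intros)

lemma trig_poly_add:
  assumes "finite S" "finite S'"
  shows "trig_poly S c z + trig_poly S' c' z
    = trig_poly (S \<union> S') (\<lambda>k. c k * of_bool (k \<in> S) + c' k * of_bool (k \<in> S')) z"
  using assms unfolding trig_poly_def distrib_right sum.distrib
  by (intro arg_cong2[where f="(+)"] sum.mono_neutral_cong_left) auto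

lemma trig_poly_mult:
  assumes "finite S" "finite S'"
  shows "trig_poly S c z * trig_poly S' c' z
    = trig_poly ((\<lambda>p. fst p + snd p) ` (S \<times> S')) (\<lambda>K. \<Sum>p | p \<in> S \<times> S' \<and> fst p + snd p = K. c (fst p) * c' (snd p)) z"
proof -
  have "trig_poly S c z * trig_poly S' c' z = (\<Sum>p\<in>S \<times> S'. c (fst p) * c' (snd p) * character (fst p + snd p) z)"
    by (simp add: trig_poly_def sum_product sum.cartesian_product split_beta character_add mult_ac)
  also have "\<dots> = (\<Sum>K\<in>(\<lambda>p. fst p + snd p) ` (S \<times> S').
      \<Sum>p | p \<in> S \<times> S' \<and> fst p + snd p = K. c (fst p) * c' (snd p) * character (fst p + snd p) z)"
    using assms by (intro sum.image_gen) auto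
  finally show ?thesis by (simp add: trig_poly_def sum_distrib_right)
qed

text \<open>The functions are real valued because they form the algebra for the real
  Stone-Weierstrass theorem; the coefficients stay complex.\<close>

definition is_trig :: "(complex \<times> complex \<Rightarrow> real) \<Rightarrow> bool" where
  "is_trig f \<longleftrightarrow> (\<exists>S c. finite S \<and> (\<forall>z. complex_of_real (f (circle2 z)) = trig_poly S c z))"

lemma is_trig_add:
  assumes "is_trig f" "is_trig g"
  shows "is_trig (\<lambda>x. f x + g x)"
proof -
  obtain S c S' c' where *: "finite S" "finite S'" "\<And>z. complex_of_real (f (circle2 z)) = trig_poly S c z"
    "\<And>z. complex_of_real (g (circle2 z)) = trig_poly S' c' z"
    using assms unfolding is_trig_def by blast
  then have "complex_of_real (f (circle2 z) + g (circle2 z))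
      = trig_poly (S \<union> S') (\<lambda>k. c k * of_bool (k \<in> S) + c' k * of_bool (k \<in> S')) z" for z
    by (simp only: of_real_add trig_poly_add)
  moreover have "finite (S \<union> S')" using * by simp
  ultimately show ?thesis unfolding is_trig_def by blast
qed

lemma is_trig_mult:
  assumes "is_trig f" "is_trig g"
  shows "is_trig (\<lambda>x. f x * g x)"
proof -
  obtain S c S' c' where *: "finite S" "finite S'" "\<And>z. complex_of_real (f (circle2 z)) = trig_poly S c z"
    "\<And>z. complex_of_real (g (circle2 z)) = trig_poly S' c' z"
    using assms unfolding is_trig_def by blast
  then have "complex_of_real (f (circle2 z) * g (circle2 z)) = trig_poly ((\<lambda>p. fst p + snd p) ` (S \<times> S'))
      (\<lambda>K. \<Sum>p | p \<in> S \<times> S' \<and> fst p + snd p = K. c (fst p) * c' (snd p)) z" for z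
    by (simp only: of_real_mult trig_poly_mult)
  moreover have "finite ((\<lambda>p. fst p + snd p) ` (S \<times> S'))" using * by simp
  ultimately show ?thesis unfolding is_trig_def by blast
qed

lemma is_trig_const: "is_trig (\<lambda>x. c)"
  unfolding is_trig_def
  by (intro exI[of _ "{0}"] exI[of _ "\<lambda>_. of_real c"]) (simp add: trig_poly_def character_zero)

lemma is_trig_coordinate:
  assumes "\<And>z. complex_of_real (f (circle2 z)) = a * character k z + b * character (- k) z" "k \<noteq> 0"
  shows "is_trig f"
proof -
  \<comment> \<open>Because \<open>k\<close> and \<open>- k\<close> differ, one coefficient function
    can carry both \<open>a\<close> and \<open>b\<close>.\<close>
  have "k \<noteq> - k" using assms(2) by (auto simp: prod_eq_iff)
  then show ?thesis
    unfolding is_trig_def using assms(1)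
    by (intro exI[of _ "{k, -k}"] exI[of _ "\<lambda>j. if j = k then a else b"]) (auto simp: trig_poly_def)
qed

lemma is_trig_coordinates:
  "is_trig (\<lambda>x. Re (fst x))" "is_trig (\<lambda>x. Im (fst x))" "is_trig (\<lambda>x. Re (snd x))" "is_trig (\<lambda>x. Im (snd x))"
proof -
  show "is_trig (\<lambda>x. Re (fst x))"
    by (rule is_trig_coordinate[where a="1/2" and b="1/2" and k="(1, 0)"])
      (auto simp: circle2_def character_def complex_eq_iff zero_prod_def)
  show "is_trig (\<lambda>x. Re (snd x))"
    by (rule is_trig_coordinate[where a="1/2" and b="1/2" and k="(0, 1)"])
      (auto simp: circle2_def character_def complex_eq_iff zero_prod_def)
  show "is_trig (\<lambda>x. Im (fst x))"
    by (rule is_trig_coordinate[where a="-\<i>/2" and b="\<i>/2" and k="(1, 0)"])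
      (auto simp: circle2_def character_def complex_eq_iff zero_prod_def)
  show "is_trig (\<lambda>x. Im (snd x))"
    by (rule is_trig_coordinate[where a="-\<i>/2" and b="\<i>/2" and k="(0, 1)"])
      (auto simp: circle2_def character_def complex_eq_iff zero_prod_def)
qed

lemma is_trig_dense:
  fixes g :: "complex \<times> complex \<Rightarrow> real"
  assumes "continuous_on UNIV g" "e > 0"
  obtains f where "is_trig f" "\<And>z. \<bar>g (circle2 z) - f (circle2 z)\<bar> < e"
proof -
  define S :: "(complex \<times> complex) set" where "S = sphere 0 1 \<times> sphere 0 1"
  have "\<exists>f. (continuous_on UNIV f \<and> is_trig f) \<and> (\<forall>x\<in>S. \<bar>g x - f x\<bar> < e)"
  proof (rule Stone_Weierstrass_HOL)
    show "compact S" unfolding S_def by (intro compact_Times compact_sphere)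
    show "continuous_on S g" using assms(1) continuous_on_subset by blast
    fix x y assume "x \<in> S \<and> y \<in> S \<and> x \<noteq> y"
    then have "Re (fst x) \<noteq> Re (fst y) \<or> Im (fst x) \<noteq> Im (fst y) \<or> Re (snd x) \<noteq> Re (snd y) \<or> Im (snd x) \<noteq> Im (snd y)"
      by (auto simp: prod_eq_iff complex_eq_iff)
    moreover have "continuous_on UNIV (\<lambda>x::complex \<times> complex. Re (fst x))" "continuous_on UNIV (\<lambda>x::complex \<times> complex. Im (fst x))"
      "continuous_on UNIV (\<lambda>x::complex \<times> complex. Re (snd x))" "continuous_on UNIV (\<lambda>x::complex \<times> complex. Im (snd x))"
      by (auto intro!: continuous_intros)
    ultimately show "\<exists>f. (continuous_on UNIV f \<and> is_trig f) \<and> f x \<noteq> f y"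
      using is_trig_coordinates by metis
  next
    fix f h :: "complex \<times> complex \<Rightarrow> real"
    assume *: "(continuous_on UNIV f \<and> is_trig f) \<and> continuous_on UNIV h \<and> is_trig h"
    show "continuous_on UNIV (\<lambda>x. f x + h x) \<and> is_trig (\<lambda>x. f x + h x)"
      using * by (intro conjI continuous_on_add is_trig_add) blast+
    show "continuous_on UNIV (\<lambda>x. f x * h x) \<and> is_trig (\<lambda>x. f x * h x)"
      using * by (intro conjI continuous_on_mult is_trig_mult) blast+
  next
    fix f :: "complex \<times> complex \<Rightarrow> real"
    assume "continuous_on UNIV f \<and> is_trig f"
    then show "continuous_on S f" using continuous_on_subset by blast
  qed (use assms(2) is_trig_const in simp_all)
  then obtain f where f: "is_trig f" "\<And>x. x \<in> S \<Longrightarrow> \<bar>g x - f x\<bar> < e" by blast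
  moreover have "circle2 z \<in> S" for z by (simp add: S_def circle2_def)
  ultimately show ?thesis using that by blast
qed

section \<open>From vanishing Fourier integrals to vanishing almost everywhere\<close>

lemma integral_eq_0_of_is_trig:
  assumes d: "integrable torus d" and 0: "\<And>k. (LINT z|torus. d z * character k z) = 0" and f: "is_trig f"
  shows "(LINT z|torus. d z * of_real (f (circle2 z))) = 0"
proof -
  obtain S c where S: "finite S" "\<And>z. complex_of_real (f (circle2 z)) = trig_poly S c z"
    using f unfolding is_trig_def by blast
  have "(LINT z|torus. d z * of_real (f (circle2 z))) = (LINT z|torus. (\<Sum>k\<in>S. c k * (d z * character k z)))"
    by (simp add: S trig_poly_def sum_distrib_left mult_ac)
  also have "\<dots> = (\<Sum>k\<in>S. c k * (LINT z|torus. d z * character k z))"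
    by (subst Bochner_Integration.integral_sum) (auto intro!: integrable_mult_right integrable_times_character d)
  finally show ?thesis by (simp add: 0)
qed

lemma circle2_continuous_measurable:
  fixes g :: "complex \<times> complex \<Rightarrow> real"
  assumes "continuous_on UNIV g"
  shows "(\<lambda>z. g (circle2 z)) \<in> borel_measurable torus"
  by (intro borel_imp_torus_measurable borel_measurable_continuous_onI
      continuous_on_compose2[OF assms continuous_circle2]) auto

text \<open>The approximation is uniform, so integrability of \<open>d\<close> is enough: replacing
  \<open>g\<close> by an approximant with error \<open>e\<close> changes the integral by at most
  \<open>e\<close> times the L^1 norm of \<open>d\<close>.\<close>

lemma integral_eq_0_of_continuous:
  fixes g :: "complex \<times> complex \<Rightarrow> real"
  assumes d: "integrable torus d" and 0: "\<And>k. (LINT z|torus. d z * character k z) = 0"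
    and g: "continuous_on UNIV g" and bd: "\<And>x. \<bar>g x\<bar> \<le> B"
  shows "(LINT z|torus. d z * of_real (g (circle2 z))) = 0"
proof -
  note [measurable] = borel_measurable_integrable[OF d] circle2_continuous_measurable[OF g]
  define N where "N = (LINT z|torus. norm (d z))"
  have small: "norm (LINT z|torus. d z * of_real (g (circle2 z))) \<le> e * N" if e: "e > 0" for e
  proof -
    obtain f where f: "is_trig f" "\<And>z. \<bar>g (circle2 z) - f (circle2 z)\<bar> < e"
      using is_trig_dense[OF g e] by blast
    obtain S c where S: "finite S" "\<And>z. complex_of_real (f (circle2 z)) = trig_poly S c z"
      using f(1) unfolding is_trig_def by blast
    have [measurable]: "(\<lambda>z. complex_of_real (f (circle2 z))) \<in> borel_measurable torus"
      unfolding S(2) by measurable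
    have int1: "integrable torus (\<lambda>z. d z * of_real (g (circle2 z)))"
    proof (rule Bochner_Integration.integrable_bound[OF integrable_mult_right[OF d, of "of_real B"]])
      have "norm (d z * of_real (g (circle2 z))) \<le> norm (of_real B * d z)" for z
        using mult_left_mono[OF bd[of "circle2 z"], of "norm (d z)"] mult_left_mono[OF abs_ge_self[of B], of "norm (d z)"]
        by (simp add: norm_mult mult.commute)
      then show "AE z in torus. norm (d z * of_real (g (circle2 z))) \<le> norm (of_real B * d z)" by simp
    qed measurable
    have int2: "integrable torus (\<lambda>z. d z * of_real (f (circle2 z)))"
      unfolding S(2) trig_poly_def sum_distrib_left
      unfolding mult.left_commute[of "d _"]
      by (intro Bochner_Integration.integrable_sum integrable_mult_right integrable_times_character d)
    have "(LINT z|torus. d z * of_real (g (circle2 z)))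
        = (LINT z|torus. d z * of_real (g (circle2 z)) - d z * of_real (f (circle2 z)))"
      using integral_eq_0_of_is_trig[OF d 0 f(1)] by (subst Bochner_Integration.integral_diff[OF int1 int2]) simp
    also have "norm \<dots> \<le> (LINT z|torus. e * norm (d z))"
    proof (rule order_trans[OF integral_norm_bound Bochner_Integration.integral_mono])
      show "integrable torus (\<lambda>z. norm (d z * of_real (g (circle2 z)) - d z * of_real (f (circle2 z))))"
        using int1 int2 by (intro integrable_norm Bochner_Integration.integrable_diff)
      show "integrable torus (\<lambda>z. e * norm (d z))" using d by simp
      fix z
      have "norm (d z * of_real (g (circle2 z)) - d z * of_real (f (circle2 z))) = norm (d z) * \<bar>g (circle2 z) - f (circle2 z)\<bar>"
        by (simp add: right_diff_distrib[symmetric] norm_mult of_real_diff[symmetric] del: of_real_diff)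
      also have "\<dots> \<le> norm (d z) * e" using f(2)[of z] by (intro mult_left_mono) auto
      finally show "norm (d z * of_real (g (circle2 z)) - d z * of_real (f (circle2 z))) \<le> e * norm (d z)"
        by (simp add: mult.commute)
    qed
    finally show ?thesis by (simp add: N_def)
  qed
  then have "norm (LINT z|torus. d z * of_real (g (circle2 z))) \<le> 0 + e" if e: "e > 0" for e
  proof -
    have "N \<ge> 0" by (simp add: N_def)
    \<comment> \<open>Division by \<open>N + 1\<close> covers the case in which the L^1 norm
      \<open>N\<close> is zero.\<close>
    then have "e / (N + 1) * N \<le> e" "e / (N + 1) > 0" using e by (auto simp: field_simps)
    with small[of "e / (N + 1)"] show ?thesis by linarith
  qed
  then have "norm (LINT z|torus. d z * of_real (g (circle2 z))) \<le> 0" by (rule field_le_epsilon)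
  then show ?thesis by simp
qed

text \<open>The asymmetry is intended: \<open>y\<close> is interior while \<open>x\<close> may be an
  end point. An interior point shares its image on the circle with no other point of the closed
  interval.\<close>

lemma cis_eq_cis_imp_eq:
  assumes "cis x = cis y" "0 < y" "y < 2 * pi" "0 \<le> x" "x \<le> 2 * pi"
  shows "x = y"
proof -
  have "sin x = sin y \<and> cos x = cos y" using assms(1) by (simp add: complex_eq_iff)
  then obtain n :: int where n: "x = y + 2 * pi * of_int n" unfolding sin_cos_eq_iff by blast
  then have "\<bar>of_int n * (2 * pi)\<bar> < 1 * (2 * pi)" using assms by (auto simp: algebra_simps)
  then have "\<bar>real_of_int n\<bar> < 1" by (simp add: abs_mult)
  then have "n = 0" by linarith
  then show ?thesis using n by simp
qed

text \<open>\<open>circle2\<close> identifies opposite sides of the closed cell; the boundary is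
  null, so these points can be ignored.\<close>

lemma AE_torus_interior: "AE z in torus. z \<in> box (0, 0) (2 * pi, 2 * pi)"
proof -
  have "torus_cell = cbox (0, 0) (2 * pi, 2 * pi)"
    by (simp add: torus_cell_def cbox_Pair_eq)
  moreover have "negligible (cbox (0, 0) (2 * pi, 2 * pi) - box (0, 0) (2 * pi, 2 * pi :: real))"
    by (rule negligible_frontier_interval)
  ultimately have "torus_cell - box (0, 0) (2 * pi, 2 * pi) \<in> null_sets lebesgue"
    by (simp add: negligible_iff_null_sets)
  then have "AE z in lebesgue. z \<notin> torus_cell - box (0, 0) (2 * pi, 2 * pi)" by (rule AE_not_in)
  then show ?thesis
    using torus_cell_lebesgue by (subst AE_restrict_space_iff) auto
qed

(* The indicator of an open subset O of the open cell is the pointwise limit of continuous functions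
   on the squared circle: n times the distance to the image of the complement of O, truncated at 1. *)
lemma integral_open_eq_0:
  assumes d: "integrable torus d" and 0: "\<And>k. (LINT z|torus. d z * character k z) = 0"
    and "open V"
  shows "(LINT z|torus. indicator V z *\<^sub>R d z) = (0 :: complex)"
proof -
  note [measurable] = borel_measurable_integrable[OF d]
  define U where "U = V \<inter> box (0, 0) (2 * pi, 2 * pi :: real)"
  define K where "K = circle2 ` (torus_cell - U)"
  define g where "g n y = min 1 (real n * infdist y K)" for n y
  have V: "V \<in> sets lebesgue" using \<open>open V\<close> by simp
  then have VT [measurable]: "indicator V \<in> borel_measurable torus"
    by (intro measurable_restrict_space1) simp
  have "open U" using \<open>open V\<close> by (auto simp: U_def)
  moreover have "compact torus_cell" unfolding torus_cell_def by (intro compact_Times) auto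
  ultimately have "compact K"
    unfolding K_def by (intro compact_continuous_image continuous_circle2 compact_diff)
  then have K: "closed K" by (rule compact_imp_closed)
  \<comment> \<open>By convention \<open>infdist\<close> to the empty set is \<open>0\<close>. The
    corner lies outside the open cell and keeps \<open>K\<close> nonempty even when \<open>V\<close>
    is the whole plane.\<close>
  have "(0, 0) \<in> torus_cell - U" by (auto simp: torus_cell_def U_def box_def Basis_prod_def)
  then have Kne: "K \<noteq> {}" by (auto simp: K_def)
  have inK: "circle2 z \<in> K \<longleftrightarrow> z \<notin> U" if z: "z \<in> torus_cell" for z
  proof
    assume "circle2 z \<in> K"
    then obtain w where w: "w \<in> torus_cell" "w \<notin> U" "circle2 w = circle2 z" by (auto simp: K_def)
    show "z \<notin> U"
    proof
      assume "z \<in> U"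
      then have "z \<in> box (0, 0) (2 * pi, 2 * pi)" by (simp add: U_def)
      then have "0 < fst z" "fst z < 2 * pi" "0 < snd z" "snd z < 2 * pi"
        by (simp_all add: mem_box Basis_prod_def inner_prod_def)
      then have "fst w = fst z" "snd w = snd z"
        using w by (auto simp: circle2_def torus_cell_def intro: cis_eq_cis_imp_eq)
      then have "w = z" by (rule prod_eqI)
      then show False using w(2) \<open>z \<in> U\<close> by simp
    qed
  qed (use z in \<open>auto simp: K_def\<close>)
  have cont: "continuous_on UNIV (g n)" for n
    unfolding g_def by (intro continuous_intros)
  have "0 \<le> real n * infdist y K" for n y by (intro mult_nonneg_nonneg infdist_nonneg) auto
  then have g_le: "\<bar>g n y\<bar> \<le> 1" for n y by (simp add: g_def)
  have zero: "(LINT z|torus. d z * of_real (g n (circle2 z))) = 0" for n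
    by (rule integral_eq_0_of_continuous[OF d 0 cont g_le])
  have "(\<lambda>n. LINT z|torus. d z * of_real (g n (circle2 z))) \<longlonglongrightarrow> (LINT z|torus. indicator V z *\<^sub>R d z)"
  proof (rule integral_dominated_convergence[where w="\<lambda>z. norm (d z)"])
    show "(\<lambda>z. indicator V z *\<^sub>R d z) \<in> borel_measurable torus" by measurable
    show "(\<lambda>z. d z * of_real (g n (circle2 z))) \<in> borel_measurable torus" for n
      using circle2_continuous_measurable[OF cont, of n] by measurable
    show "integrable torus (\<lambda>z. norm (d z))" using d by simp
    show "AE z in torus. norm (d z * of_real (g n (circle2 z))) \<le> norm (d z)" for n
      using g_le by (simp add: norm_mult mult_left_le)
    show "AE z in torus. (\<lambda>n. d z * of_real (g n (circle2 z))) \<longlonglongrightarrow> indicator V z *\<^sub>R d z"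
      using AE_torus_interior AE_space
    proof eventually_elim
      fix z assume z: "z \<in> box (0, 0) (2 * pi, 2 * pi :: real)" "z \<in> space torus"
      then have cell: "z \<in> torus_cell" by (simp add: space_restrict_space)
      have "eventually (\<lambda>n. g n (circle2 z) = indicator V z) sequentially"
      proof (cases "z \<in> V")
        case True
        then have "circle2 z \<notin> K" using inK[OF cell] z by (simp add: U_def)
        then have pos: "infdist (circle2 z) K > 0" using infdist_pos_not_in_closed[OF K Kne] by blast
        obtain N where N: "1 / infdist (circle2 z) K < real N" using reals_Archimedean2 by blast
        have "g n (circle2 z) = 1" if "n \<ge> N" for n
        proof -
          have "1 / infdist (circle2 z) K \<le> real n" using N that by linarith
          then show ?thesis using pos by (simp add: g_def field_simps)
        qed
        then show ?thesis using True by (auto simp: eventually_sequentially)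
      next
        case False
        then have "circle2 z \<in> K" using inK[OF cell] by (simp add: U_def)
        then show ?thesis using False by (simp add: g_def)
      qed
      then have "eventually (\<lambda>n. d z * of_real (g n (circle2 z)) = indicator V z *\<^sub>R d z) sequentially"
        by eventually_elim (simp add: scaleR_conv_of_real)
      then show "(\<lambda>n. d z * of_real (g n (circle2 z))) \<longlonglongrightarrow> indicator V z *\<^sub>R d z"
        by (rule tendsto_eventually)
    qed
  qed
  then show ?thesis by (simp add: zero LIMSEQ_const_iff)
qed

text \<open>The integral of \<open>d\<close> vanishes over open sets, hence over Borel sets by
  Dynkin's argument, since open sets are stable under intersection; a Lebesgue set differs from an
  F_sigma set by a null set. A density whose integrals over all measurable sets vanish is zero
  almost everywhere.\<close>

lemma AE_eq_0_if_fourier_integrals_eq_0: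
  assumes d: "integrable torus d" and 0: "\<And>k. (LINT z|torus. d z * character k z) = 0"
  shows "AE z in torus. d z = (0 :: complex)"
proof -
  define D where "D z = indicator torus_cell z *\<^sub>R d z" for z
  have D: "integrable lebesgue D"
    unfolding D_def using d torus_cell_lebesgue by (subst (asm) integrable_restrict_space) auto
  have conv: "(LINT z:A|lebesgue. D z) = (LINT z|torus. indicator A z *\<^sub>R d z)" for A
    unfolding set_lebesgue_integral_def D_def using torus_cell_lebesgue
    by (subst integral_restrict_space) (auto simp: mult.commute)
  have int: "set_integrable lebesgue A D" if "A \<in> sets lebesgue" for A
    using D that unfolding set_integrable_def by (intro integrable_mult_indicator) auto
  \<comment> \<open>The vanishing total integral is what handles complements in Dynkin's
    argument.\<close>
  have UNIV0: "(LINT z:UNIV|lebesgue. D z) = 0"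
    unfolding conv using integral_open_eq_0[OF d 0, of UNIV] by simp
  have borel0: "(LINT z:A|lebesgue. D z) = 0" if "A \<in> sets borel" for A
  proof -
    have "Int_stable {S :: (real \<times> real) set. open S}" by (auto simp: Int_stable_def)
    moreover have "{S :: (real \<times> real) set. open S} \<subseteq> Pow UNIV" by simp
    moreover have "A \<in> sigma_sets UNIV {S. open S}" using that by (simp add: borel_def)
    ultimately show ?thesis
    proof (induction rule: sigma_sets_induct_disjoint)
      case (basic A)
      then show ?case unfolding conv using integral_open_eq_0[OF d 0] by simp
    next
      case (compl A)
      then have A: "A \<in> sets borel" by (simp add: borel_def)
      have "(LINT z:A \<union> (UNIV - A)|lebesgue. D z) = (LINT z:A|lebesgue. D z) + (LINT z:UNIV - A|lebesgue. D z)"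
        using A by (intro set_integral_Un int) auto
      then show ?case using UNIV0 compl by simp
    next
      case (union A)
      then have "A i \<in> sets borel" for i by (auto simp: borel_def)
      then have "(LINT z:(\<Union>i. A i)|lebesgue. D z) = (\<Sum>i. (LINT z:A i|lebesgue. D z))"
        using union(1) by (intro lebesgue_integral_countable_add int) (auto simp: disjoint_family_on_def)
      then show ?case using union by simp
    qed (auto simp: set_lebesgue_integral_def)
  qed
  have leb0: "(LINT z:A|lebesgue. D z) = 0" if A: "A \<in> sets lebesgue" for A
  proof -
    obtain C T where CT: "fsigma C" "T \<in> null_sets lebesgue" "C \<union> T = A" "disjnt C T"
      using lebesgue_set_almost_fsigma[OF A] by blast
    have C: "C \<in> sets borel" using CT(1) by (induction rule: fsigma.induct) auto
    have "(LINT z:A|lebesgue. D z) = (LINT z:C|lebesgue. D z)"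
      unfolding set_lebesgue_integral_def
    proof (rule integral_cong_AE)
      show "(\<lambda>z. indicat_real A z *\<^sub>R D z) \<in> borel_measurable lebesgue" "(\<lambda>z. indicat_real C z *\<^sub>R D z) \<in> borel_measurable lebesgue"
        using int[OF A] int[of C] C unfolding set_integrable_def by auto
      show "AE z in lebesgue. indicat_real A z *\<^sub>R D z = indicat_real C z *\<^sub>R D z"
        using AE_not_in[OF CT(2)] by eventually_elim (use CT(3) in \<open>auto simp: indicator_def\<close>)
    qed
    then show ?thesis using borel0[OF C] by simp
  qed
  interpret finite_measure torus by (rule finite_measure_torus)
  show ?thesis
  proof (rule density_zero[OF d])
    fix A assume "A \<in> sets torus"
    then have "A \<in> sets lebesgue"
      using torus_cell_lebesgue by (auto simp: sets_restrict_space)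
    then show "set_lebesgue_integral torus A d = 0"
      using leb0 unfolding conv by (simp add: set_lebesgue_integral_def)
  qed
qed

lemma fourier_uniqueness:
  assumes u: "integrable torus u" "integrable torus v"
    and eq: "\<And>n \<tau>. fourier_coeff u n \<tau> = fourier_coeff v n \<tau>"
  shows "AE z in torus. u z = v z"
proof -
  have "AE z in torus. u z - v z = 0"
  proof (rule AE_eq_0_if_fourier_integrals_eq_0)
    show "integrable torus (\<lambda>z. u z - v z)" using u by simp
    fix k :: "int \<times> int"
    have "(LINT z|torus. u z * character k z) = (LINT z|torus. v z * character k z)"
      using eq[of "- fst k" "- snd k"] by (simp add: fourier_coeff_altdef)
    then show "(LINT z|torus. (u z - v z) * character k z) = 0"
      unfolding left_diff_distrib
      by (subst Bochner_Integration.integral_diff) (auto intro: integrable_times_character u)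
  qed
  then show ?thesis by eventually_elim simp
qed

section \<open>Dominated partial Fourier sums\<close>

lemma nnsum_geometric: "(\<Sum>\<^sup>+j. ennreal ((1/4) ^ j)) \<le> 2"
proof -
  have "(\<Sum>\<^sup>+j. ennreal ((1/4) ^ j)) = ennreal (\<Sum>j. (1/4) ^ j)"
    unfolding nn_integral_count_space_nat by (intro suminf_ennreal_eq summable_sums summable_geometric) auto
  also have "\<dots> \<le> ennreal 2"
    by (intro ennreal_leI) (simp add: suminf_geometric)
  finally show ?thesis by simp
qed

text \<open>Cauchy-Schwarz after the splitting \<open>1 = (1/2)^j * 2^j\<close>; the geometric
  series of ratio \<open>1/4\<close> is at most \<open>2\<close>.\<close>

lemma nnsum_power2_le: "(\<Sum>\<^sup>+j. x j)^2 \<le> 2 * (\<Sum>\<^sup>+j. ennreal (4 ^ j) * x j ^ 2)" for x :: "nat \<Rightarrow> ennreal"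
proof -
  have "(\<Sum>\<^sup>+j. x j) = (\<Sum>\<^sup>+j. ennreal ((1/2) ^ j) * (ennreal (2 ^ j) * x j))"
    by (simp add: mult.assoc[symmetric] ennreal_mult[symmetric] power_mult_distrib[symmetric])
  then have "(\<Sum>\<^sup>+j. x j)^2 \<le> (\<Sum>\<^sup>+j. ennreal ((1/2) ^ j) ^ 2) * (\<Sum>\<^sup>+j. (ennreal (2 ^ j) * x j)^2)"
    by (simp only: nnsum_Cauchy_Schwarz)
  also have "\<dots> = (\<Sum>\<^sup>+j. ennreal ((1/4) ^ j)) * (\<Sum>\<^sup>+j. ennreal (4 ^ j) * x j ^ 2)"
    by (simp add: ennreal_power power_mult_distrib power_mult[symmetric] mult.commute[of _ 2])
      (simp add: power_mult power2_eq_square)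
  also have "\<dots> \<le> 2 * (\<Sum>\<^sup>+j. ennreal (4 ^ j) * x j ^ 2)"
    by (intro mult_right_mono nnsum_geometric) auto
  finally show ?thesis .
qed

text \<open>The square bound is applied twice, which gives \<open>64 = 4 * 4^2\<close> and
  \<open>8 = 2^2 * 2\<close>. A sum of blocks is thus controlled in L^4 once the integrals of their
  fourth powers decay at a geometric rate below \<open>1/64\<close>.\<close>

lemma nnsum_power4_le: "(\<Sum>\<^sup>+j. x j)^4 \<le> 8 * (\<Sum>\<^sup>+j. ennreal (64 ^ j) * x j ^ 4)" for x :: "nat \<Rightarrow> ennreal"
proof -
  have "(\<Sum>\<^sup>+j. x j)^4 = ((\<Sum>\<^sup>+j. x j)^2)^2" by simp
  also have "\<dots> \<le> (2 * (\<Sum>\<^sup>+j. ennreal (4 ^ j) * x j ^ 2))^2"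
    by (intro power_mono nnsum_power2_le) auto
  also have "\<dots> \<le> 4 * (2 * (\<Sum>\<^sup>+j. ennreal (4 ^ j) * (ennreal (4 ^ j) * x j ^ 2)^2))"
    unfolding power_mult_distrib[of 2] by (intro mult_mono nnsum_power2_le) auto
  also have "\<dots> = 8 * (\<Sum>\<^sup>+j. ennreal (64 ^ j) * x j ^ 4)"
  proof -
    have "ennreal (4 ^ j) * (ennreal (4 ^ j) * x j ^ 2)^2 = ennreal (64 ^ j) * x j ^ 4" for j
    proof -
      have "(4 :: real) ^ j * (4 ^ j)^2 = 64 ^ j"
        by (simp add: power2_eq_square power_mult_distrib[symmetric])
      then have "ennreal (4 ^ j) * ennreal (4 ^ j) ^ 2 = ennreal (64 ^ j)"
        by (simp add: ennreal_power ennreal_mult[symmetric])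
      then show ?thesis by (simp add: power_mult_distrib mult.assoc[symmetric])
    qed
    then show ?thesis by (simp add: mult.assoc[symmetric])
  qed
  finally show ?thesis .
qed

lemma nnsum_tail:
  fixes f :: "'a::countable \<Rightarrow> ennreal"
  assumes "nnsum f < \<infinity>" "e > 0"
  obtains N where "(\<Sum>\<^sup>+k. f k * indicator {k. N \<le> to_nat k} k) < e"
proof -
  have "(\<lambda>N. \<Sum>\<^sup>+k. f k * indicator {k. N \<le> to_nat k} k) \<longlonglongrightarrow> (\<Sum>\<^sup>+k::'a. 0)"
  proof (rule nn_integral_dominated_convergence[where w=f])
    have "eventually (\<lambda>N. f k * indicator {k. N \<le> to_nat k} k = 0) sequentially" for k
      using eventually_gt_at_top[of "to_nat k"] by eventually_elim simp
    then have "(\<lambda>N. f k * indicator {k. N \<le> to_nat k} k) \<longlonglongrightarrow> 0" for k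
      by (rule tendsto_eventually)
    then show "AE k in count_space UNIV. (\<lambda>N. f k * indicator {k. N \<le> to_nat k} k) \<longlonglongrightarrow> 0"
      by (simp add: AE_count_space)
  qed (use assms(1) in \<open>auto simp: indicator_def\<close>)
  then have "eventually (\<lambda>N. (\<Sum>\<^sup>+k. f k * indicator {k. N \<le> to_nat k} k) < e) sequentially"
    using assms(2) by (intro order_tendstoD) auto
  then show ?thesis using that eventually_happens'[OF sequentially_bot] by blast
qed

lemma trig_poly_Un:
  assumes "finite S" "finite S'" "S \<inter> S' = {}"
  shows "trig_poly (S \<union> S') c z = trig_poly S c z + trig_poly S' c z"
  unfolding trig_poly_def using assms by (rule sum.union_disjoint)

text \<open>The L^4 bound squares the rate \<open>1/16\<close> to \<open>1/256\<close>, which beats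
  the \<open>64\<close> of \<open>nnsum_power4_le\<close>. The factor \<open>nnsum f + 1\<close>
  covers at once \<open>j = 0\<close>, where the tail is the whole sum, and the later tails.\<close>

lemma nnsum_tail_geometric:
  fixes f :: "'a::countable \<Rightarrow> ennreal"
  assumes "nnsum f < \<infinity>"
  obtains m where "m 0 = (0::nat)" "mono m" "\<And>j. j \<le> m j"
    "\<And>j. (\<Sum>\<^sup>+k. f k * indicator {k. m j \<le> to_nat k} k) \<le> (nnsum f + 1) * ennreal ((1/16) ^ j)"
proof -
  have "\<exists>N. (\<Sum>\<^sup>+k. f k * indicator {k. N \<le> to_nat k} k) < ennreal ((1/16) ^ j)" for j :: nat
    using nnsum_tail[OF assms, of "ennreal ((1/16) ^ j)"] by auto
  then obtain n where n: "\<And>j. (\<Sum>\<^sup>+k. f k * indicator {k. n j \<le> to_nat k} k) < ennreal ((1/16) ^ j)"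
    by metis
  \<comment> \<open>Accumulating the thresholds makes \<open>m\<close> monotone, the added
    \<open>1\<close> forces \<open>j \<le> m j\<close>, and the value \<open>0\<close> at
    \<open>0\<close> lets the partial sums start empty.\<close>
  define m where "m j = (if j = 0 then 0 else \<Sum>i\<le>j. n i + 1)" for j
  have m: "n j \<le> m j" if "j > 0" for j
    using that member_le_sum[of j "{..j}" "\<lambda>i. n i + 1"] by (auto simp: m_def)
  show ?thesis
  proof
    show "m 0 = 0" by (simp add: m_def)
    show "mono m" by (auto intro!: monoI sum_mono2 simp: m_def simp del: sum.distrib sum_constant)
    show "j \<le> m j" for j
      using sum_mono[of "{..j}" "\<lambda>i. 1" "\<lambda>i. n i + 1"] by (auto simp: m_def)
    fix j
    show "(\<Sum>\<^sup>+k. f k * indicator {k. m j \<le> to_nat k} k) \<le> (nnsum f + 1) * ennreal ((1/16) ^ j)"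
    proof (cases "j = 0")
      case True
      have "(\<Sum>\<^sup>+k. f k * indicator {k. m j \<le> to_nat k} k) \<le> nnsum f"
        by (rule nnsum_mono) (auto simp: indicator_def)
      then show ?thesis using True by (simp add: add_increasing2)
    next
      case False
      have "(\<Sum>\<^sup>+k. f k * indicator {k. m j \<le> to_nat k} k) \<le> (\<Sum>\<^sup>+k. f k * indicator {k. n j \<le> to_nat k} k)"
        using m False by (intro nnsum_mono) (auto simp: indicator_def intro: order_trans)
      also have "\<dots> \<le> 1 * ennreal ((1/16) ^ j)" using n[of j] by simp
      also have "\<dots> \<le> (nnsum f + 1) * ennreal ((1/16) ^ j)"
        by (intro mult_right_mono) auto
      finally show ?thesis .
    qed
  qed
qed

text \<open>As in the proof that L^p is complete: along rapidly increasing frequency sets the sum of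
  the absolute values of the blocks lies in L^4. It dominates every partial sum and makes them
  converge almost everywhere. The limit has the coefficients of \<open>u\<close>, so it is
  \<open>u\<close> by uniqueness.\<close>

lemma fourier_series_dominated:
  assumes u: "integrable torus u"
    and c: "\<And>k. c k = fourier_coeff u (fst k) (snd k)"
    and fin: "(\<Sum>\<^sup>+k. ennreal (modulation k) * ennreal (norm (c k)) ^ 2) < \<infinity>"
  obtains S G where "\<And>j. finite (S j)" "integrable torus (\<lambda>z. G z ^ 3)"
    "AE z in torus. \<forall>j. norm (trig_poly (S j) c z) \<le> G z"
    "AE z in torus. (\<lambda>j. trig_poly (S j) c z) \<longlonglongrightarrow> u z"
proof -
  obtain C where C: "C \<ge> 0" "\<And>S c. finite S \<Longrightarrow> (\<integral>\<^sup>+z. ennreal (norm (trig_poly S c z) ^ 4) \<partial>torus)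
      \<le> ennreal C * (\<Sum>\<^sup>+k. ennreal (modulation k) * (ennreal (norm (c k)) * indicator S k)^2)^2"
    using trig_poly_L4 by blast
  define f where "f k = ennreal (modulation k) * ennreal (norm (c k)) ^ 2" for k
  have finf: "nnsum f < \<infinity>" using fin by (simp add: f_def[abs_def])
  obtain m where m: "m 0 = (0::nat)" "mono m" "\<And>j. j \<le> m j"
    "\<And>j. (\<Sum>\<^sup>+k. f k * indicator {k. m j \<le> to_nat k} k) \<le> (nnsum f + 1) * ennreal ((1/16) ^ j)"
    using nnsum_tail_geometric[OF finf] by blast
  define S where "S j = {k :: int \<times> int. to_nat k < m j}" for j
  define D where "D j = S (Suc j) - S j" for j
  define d where "d j = trig_poly (D j) c" for j
  define \<Gamma> where "\<Gamma> z = (\<Sum>\<^sup>+j. ennreal (norm (d j z)))" for z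
  define G where "G z = enn2real (\<Gamma> z)" for z
  define v where "v z = (\<Sum>j. d j z)" for z
  have finS: "finite (S j)" for j
    unfolding S_def using finite_vimageI[of "{..<m j}" "to_nat :: int \<times> int \<Rightarrow> nat"] by (simp add: vimage_def)
  then have finD: "finite (D j)" for j by (simp add: D_def)
  have [measurable]: "d j \<in> borel_measurable torus" for j unfolding d_def by measurable
  have \<Gamma>_meas [measurable]: "\<Gamma> \<in> borel_measurable torus"
    unfolding \<Gamma>_def[abs_def] nn_integral_count_space_nat by measurable
  have [measurable]: "G \<in> borel_measurable torus" "v \<in> borel_measurable torus"
    unfolding G_def[abs_def] v_def[abs_def] by measurable
  have partial: "trig_poly (S j) c z = (\<Sum>i<j. d i z)" for j z
  proof (induction j)
    case 0
    then show ?case by (simp add: S_def m(1) trig_poly_def)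
  next
    case (Suc j)
    have "S j \<subseteq> S (Suc j)" using monoD[OF m(2), of j "Suc j"] by (auto simp: S_def)
    then have "S (Suc j) = S j \<union> D j" "S j \<inter> D j = {}" by (auto simp: D_def)
    then show ?case using Suc trig_poly_Un[OF finS[of j] finD[of j]] by (simp add: d_def)
  qed
  have d4: "(\<integral>\<^sup>+z. ennreal (norm (d j z)) ^ 4 \<partial>torus) \<le> ennreal C * (nnsum f + 1)^2 * ennreal ((1/256) ^ j)" for j
  proof -
    have "(\<integral>\<^sup>+z. ennreal (norm (d j z)) ^ 4 \<partial>torus) = (\<integral>\<^sup>+z. ennreal (norm (trig_poly (D j) c z) ^ 4) \<partial>torus)"
      by (simp add: d_def ennreal_power)
    also have "\<dots> \<le> ennreal C * (\<Sum>\<^sup>+k. ennreal (modulation k) * (ennreal (norm (c k)) * indicator (D j) k)^2)^2"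
      by (rule C(2)[OF finD])
    also have "\<dots> \<le> ennreal C * ((nnsum f + 1) * ennreal ((1/16) ^ j))^2"
    proof (intro mult_left_mono power_mono order_trans[OF _ m(4)] nnsum_mono)
      fix k show "ennreal (modulation k) * (ennreal (norm (c k)) * indicator (D j) k)^2 \<le> f k * indicator {k. m j \<le> to_nat k} k"
        by (auto simp: f_def D_def S_def indicator_def)
    qed auto
    also have "\<dots> = ennreal C * (nnsum f + 1)^2 * ennreal ((1/256) ^ j)"
    proof -
      have "((1/16 :: real) ^ j)^2 = (1/256) ^ j"
        by (simp add: power2_eq_square power_mult_distrib[symmetric])
      then show ?thesis by (simp add: power_mult_distrib ennreal_power mult.assoc)
    qed
    finally show ?thesis .
  qed
  have \<Gamma>4: "(\<integral>\<^sup>+z. \<Gamma> z ^ 4 \<partial>torus) < \<infinity>"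
  proof -
    have "(\<integral>\<^sup>+z. \<Gamma> z ^ 4 \<partial>torus) \<le> (\<integral>\<^sup>+z. 8 * (\<Sum>\<^sup>+j. ennreal (64 ^ j) * ennreal (norm (d j z)) ^ 4) \<partial>torus)"
      unfolding \<Gamma>_def by (intro nn_integral_mono nnsum_power4_le)
    also have "\<dots> = 8 * (\<Sum>\<^sup>+j. \<integral>\<^sup>+z. ennreal (64 ^ j) * ennreal (norm (d j z)) ^ 4 \<partial>torus)"
      unfolding nn_integral_count_space_nat
      by (subst nn_integral_cmult) (auto simp: nn_integral_suminf)
    also have "\<dots> = 8 * (\<Sum>\<^sup>+j. ennreal (64 ^ j) * (\<integral>\<^sup>+z. ennreal (norm (d j z)) ^ 4 \<partial>torus))"
      by (simp add: nn_integral_cmult)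
    also have "\<dots> \<le> 8 * (\<Sum>\<^sup>+j. (ennreal C * (nnsum f + 1)^2) * ennreal ((1/4) ^ j))"
    proof (intro mult_left_mono nnsum_mono)
      fix j
      \<comment> \<open>The loss \<open>64\<close> against the decay \<open>1/256\<close> leaves a
        geometric series of ratio \<open>1/4\<close>.\<close>
      have "ennreal (64 ^ j) * ennreal ((1/256) ^ j) = ennreal ((1/4) ^ j)"
        by (simp add: ennreal_mult[symmetric] power_mult_distrib[symmetric])
      then have "ennreal (64 ^ j) * (ennreal C * (nnsum f + 1)^2 * ennreal ((1/256) ^ j))
          = (ennreal C * (nnsum f + 1)^2) * ennreal ((1/4) ^ j)"
        by (metis mult.left_commute)
      then show "ennreal (64 ^ j) * (\<integral>\<^sup>+z. ennreal (norm (d j z)) ^ 4 \<partial>torus) \<le> (ennreal C * (nnsum f + 1)^2) * ennreal ((1/4) ^ j)"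
        using mult_left_mono[OF d4[of j], of "ennreal (64 ^ j)"] by simp
    qed auto
    also have "\<dots> \<le> 8 * ((ennreal C * (nnsum f + 1)^2) * 2)"
      unfolding nnsum_cmult by (intro mult_left_mono nnsum_geometric) auto
    also have "\<dots> < \<infinity>"
      using finf by (simp add: ennreal_mult_less_top power_less_top_ennreal)
    finally show ?thesis .
  qed
  have AE_fin: "AE z in torus. \<Gamma> z < \<infinity>"
  proof -
    have "AE z in torus. \<Gamma> z ^ 4 \<noteq> \<infinity>"
      using \<Gamma>4 by (intro nn_integral_PInf_AE) auto
    then show ?thesis by eventually_elim (auto simp: less_top[symmetric] power_eq_top_ennreal)
  qed
  have pointwise: "summable (\<lambda>j. d j z)" "\<And>j. norm (\<Sum>i<j. d i z) \<le> G z" "norm (v z) \<le> G z"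
    if z: "\<Gamma> z < \<infinity>" for z
  proof -
    have "(\<Sum>j. ennreal (norm (d j z))) \<noteq> top"
      using z by (simp add: \<Gamma>_def nn_integral_count_space_nat)
    then have sm: "summable (\<lambda>j. norm (d j z))" by (intro summable_suminf_not_top) auto
    have G: "G z = (\<Sum>j. norm (d j z))"
      unfolding G_def \<Gamma>_def nn_integral_count_space_nat
      using sm by (subst suminf_ennreal2) (auto intro!: enn2real_ennreal suminf_nonneg)
    show "summable (\<lambda>j. d j z)" using sm by (rule summable_norm_cancel)
    show "norm (\<Sum>i<j. d i z) \<le> G z" for j
      unfolding G by (rule order_trans[OF norm_sum sum_le_suminf]) (use sm in auto)
    show "norm (v z) \<le> G z"
      unfolding G v_def using sm by (rule summable_norm)
  qed
  have G4: "integrable torus (\<lambda>z. G z ^ 4)"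
  proof (rule integrableI_bounded)
    have "(\<integral>\<^sup>+z. ennreal (norm (G z ^ 4)) \<partial>torus) \<le> (\<integral>\<^sup>+z. \<Gamma> z ^ 4 \<partial>torus)"
    proof (rule nn_integral_mono)
      fix z
      have "ennreal (G z) \<le> \<Gamma> z" unfolding G_def by (cases "\<Gamma> z") auto
      then have "ennreal (G z) ^ 4 \<le> \<Gamma> z ^ 4" by (rule power_mono) simp
      then show "ennreal (norm (G z ^ 4)) \<le> \<Gamma> z ^ 4"
        by (simp add: ennreal_power G_def power_abs[symmetric])
    qed
    then show "(\<integral>\<^sup>+z. ennreal (norm (G z ^ 4)) \<partial>torus) < \<infinity>" using \<Gamma>4 by (rule order_le_less_trans)
  qed measurable
  have G0: "G z \<ge> 0" for z by (simp add: G_def)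
  have int_one: "integrable torus (\<lambda>z. 1 + G z ^ 4)"
    by (intro Bochner_Integration.integrable_add finite_measure.integrable_const finite_measure_torus G4)
  \<comment> \<open>On a finite measure space the fourth power controls the lower ones: the exponent
    \<open>3\<close> is used for the cubic term, and \<open>1\<close> for the uniqueness
    theorem.\<close>
  have "x ^ n \<le> 1 + x ^ 4" if "x \<ge> 0" "n \<le> 4" for x :: real and n
  proof (cases "x \<le> 1")
    case True
    then show ?thesis using that by (simp add: power_le_one add_increasing2)
  next
    case False
    then have "x ^ n \<le> x ^ 4" using that by (intro power_increasing) auto
    then show ?thesis by simp
  qed
  then have Gpow: "integrable torus (\<lambda>z. G z ^ n)" if "n \<le> 4" for n
    using that G0 by (intro Bochner_Integration.integrable_bound[OF int_one]) auto
  have G1: "integrable torus G" using Gpow[of 1] by simp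
  have conv: "AE z in torus. (\<lambda>j. trig_poly (S j) c z) \<longlonglongrightarrow> v z"
    using AE_fin unfolding partial v_def
    by eventually_elim (intro summable_LIMSEQ pointwise)
  have dom: "AE z in torus. \<forall>j. norm (trig_poly (S j) c z) \<le> G z"
    using AE_fin unfolding partial by eventually_elim (auto intro: pointwise)
  have v: "integrable torus v"
    by (rule Bochner_Integration.integrable_bound[OF G1])
      (use AE_fin in \<open>auto elim!: eventually_mono simp: G0 intro: pointwise\<close>)
  have "AE z in torus. v z = u z"
  proof (rule fourier_uniqueness[OF v u])
    fix n \<tau>
    have "(\<lambda>j. LINT z|torus. trig_poly (S j) c z * character (- (n, \<tau>)) z)
        \<longlonglongrightarrow> (LINT z|torus. v z * character (- (n, \<tau>)) z)"
    proof (rule integral_dominated_convergence[where w=G])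
      show "AE z in torus. (\<lambda>j. trig_poly (S j) c z * character (- (n, \<tau>)) z) \<longlonglongrightarrow> v z * character (- (n, \<tau>)) z"
        using conv by eventually_elim (intro tendsto_mult tendsto_const)
      show "AE z in torus. norm (trig_poly (S j) c z * character (- (n, \<tau>)) z) \<le> G z" for j
        using dom by eventually_elim (simp add: norm_mult norm_character)
    qed (use G1 in auto)
    then have lim: "(\<lambda>j. fourier_coeff (trig_poly (S j) c) n \<tau>) \<longlonglongrightarrow> fourier_coeff v n \<tau>"
      unfolding fourier_coeff_altdef by (intro tendsto_scaleR tendsto_const)
    \<comment> \<open>Since \<open>j \<le> m j\<close>, every frequency eventually lies in
      \<open>S j\<close>, and from then on its coefficient is constant in \<open>j\<close>.\<close>
    have "eventually (\<lambda>j. fourier_coeff (trig_poly (S j) c) n \<tau> = c (n, \<tau>)) sequentially"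
      using eventually_gt_at_top[of "to_nat (n, \<tau>)"]
    proof eventually_elim
      case (elim j)
      then have "(n, \<tau>) \<in> S j" using m(3)[of j] by (simp add: S_def)
      then show ?case using finS by (simp add: fourier_coeff_trig_poly)
    qed
    then have "(\<lambda>j. fourier_coeff (trig_poly (S j) c) n \<tau>) \<longlonglongrightarrow> c (n, \<tau>)"
      by (rule tendsto_eventually)
    with lim have "fourier_coeff v n \<tau> = c (n, \<tau>)" by (rule LIMSEQ_unique)
    then show "fourier_coeff v n \<tau> = fourier_coeff u n \<tau>" by (simp add: c)
  qed
  then have "AE z in torus. (\<lambda>j. trig_poly (S j) c z) \<longlonglongrightarrow> u z"
    using conv by eventually_elim simp
  from that[OF finS Gpow[of 3] dom this] show ?thesis by simp
qed

section \<open>Fourier coefficients of the cutoff\<close>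

lemma bump_derivatives:
  assumes "bump \<eta>"
  shows "\<And>t. (\<eta> has_real_derivative deriv \<eta> t) (at t)"
    and "\<And>t. (deriv \<eta> has_real_derivative deriv (deriv \<eta>) t) (at t)"
    and "continuous_on UNIV (deriv (deriv \<eta>))"
    and "\<And>t. \<bar>t\<bar> > 2 \<Longrightarrow> \<eta> t = 0 \<and> deriv \<eta> t = 0 \<and> deriv (deriv \<eta>) t = 0"
proof -
  have diff: "(deriv ^^ k) \<eta> differentiable (at t)" for k t
    using assms by (auto simp: bump_def)
  show "(\<eta> has_real_derivative deriv \<eta> t) (at t)" for t
    using diff[of 0 t] by (simp add: DERIV_deriv_iff_real_differentiable)
  show "(deriv \<eta> has_real_derivative deriv (deriv \<eta>) t) (at t)" for t
    using diff[of 1 t] by (simp add: DERIV_deriv_iff_real_differentiable)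
  show "continuous_on UNIV (deriv (deriv \<eta>))"
    using diff[of 2] by (auto simp: numeral_2_eq_2 intro!: continuous_at_imp_continuous_on differentiable_imp_continuous_within)
  have open2: "open {t::real. \<bar>t\<bar> > 2}" by (intro open_Collect_less continuous_intros)
  have deriv0: "deriv f t = 0" if "\<And>t. \<bar>t\<bar> > 2 \<Longrightarrow> f t = 0" "\<bar>t\<bar> > 2" for f :: "real \<Rightarrow> real" and t
  proof -
    have "eventually (\<lambda>t. f t = 0) (nhds t)"
      using eventually_nhds_in_open[OF open2, of t] that by (auto elim!: eventually_mono)
    then have "deriv f t = deriv (\<lambda>_. 0) t" by (rule deriv_cong_ev) simp
    then show ?thesis by simp
  qed
  have 0: "\<eta> t = 0" if "\<bar>t\<bar> > 2" for t using assms that by (auto simp: bump_def)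
  have 1: "deriv \<eta> t = 0" if "\<bar>t\<bar> > 2" for t using deriv0[of \<eta>] 0 that by blast
  have 2: "deriv (deriv \<eta>) t = 0" if "\<bar>t\<bar> > 2" for t using deriv0[of "deriv \<eta>"] 1 that by blast
  show "\<eta> t = 0 \<and> deriv \<eta> t = 0 \<and> deriv (deriv \<eta>) t = 0" if "\<bar>t\<bar> > 2" for t
    using 0 1 2 that by blast
qed

lemma bounded_of_support:
  fixes f :: "real \<Rightarrow> real"
  assumes "continuous_on UNIV f" "\<And>t. \<bar>t\<bar> > 2 \<Longrightarrow> f t = 0"
  obtains B where "B \<ge> 0" "\<And>t. \<bar>f t\<bar> \<le> B"
proof -
  have "bounded (f ` {-2..2})"
    using assms(1) by (intro compact_imp_bounded compact_continuous_image) (auto intro: continuous_on_subset)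
  then obtain B where "\<forall>x\<in>f ` {-2..2}. norm x \<le> B" unfolding bounded_iff by blast
  then have B: "\<bar>f t\<bar> \<le> B" if "t \<in> {-2..2}" for t using that by auto
  have "\<bar>f t\<bar> \<le> B" for t
  proof (cases "\<bar>t\<bar> > 2")
    case True
    then show ?thesis using assms(2)[of t] B[of 0] by simp
  next
    case False
    then have "t \<in> {-2..2}" by auto
    then show ?thesis by (rule B)
  qed
  moreover from this[of 0] have "B \<ge> 0" by linarith
  ultimately show ?thesis using that by blast
qed

section \<open>The periodized cutoff on one cell\<close>

text \<open>On the cell the periodized cutoff is half a bump at each end. This formula has no floor
  function, so it can be differentiated and its values at \<open>0\<close> and \<open>2 * pi\<close>
  compared.\<close>

definition periodic_cutoff :: "(real \<Rightarrow> real) \<Rightarrow> real \<Rightarrow> real \<Rightarrow> real" where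
  "periodic_cutoff f T t = f (t / T) + f ((t - 2 * pi) / T)"

text \<open>\<open>2 * T < pi\<close> because \<open>T < 1\<close> and \<open>pi > 3\<close>: the
  bump at \<open>0\<close> has died out by the midpoint \<open>pi\<close>, where the floor jumps,
  and the bump at \<open>2 * pi\<close> starts only after it.\<close>

lemma cutoff_eq_periodic_cutoff:
  assumes "0 < T" "T < 1" "0 \<le> t" "t \<le> 2 * pi" and supp: "\<And>t. \<bar>t\<bar> > 2 \<Longrightarrow> f t = 0"
  shows "cutoff f T t = periodic_cutoff f T t"
proof (cases "t < pi")
  case True
  have "\<lfloor>(t + pi) / (2 * pi)\<rfloor> = 0" using True assms by (intro floor_unique) (auto simp: field_simps)
  moreover have "f ((t - 2 * pi) / T) = 0"
  proof (rule supp)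
    have "2 * T < 2 * pi - t" using True assms pi_gt3 by linarith
    then show "\<bar>(t - 2 * pi) / T\<bar> > 2" using assms by (simp add: field_simps)
  qed
  ultimately show ?thesis by (simp add: cutoff_def periodize_def periodic_cutoff_def)
next
  case False
  have "t < 3 * pi" using assms pi_gt_zero by linarith
  then have "\<lfloor>(t + pi) / (2 * pi)\<rfloor> = 1" using False by (intro floor_unique) (auto simp: field_simps)
  moreover have "f (t / T) = 0"
  proof (rule supp)
    have "2 * T < t" using False assms pi_gt3 by linarith
    then show "\<bar>t / T\<bar> > 2" using assms by (simp add: field_simps)
  qed
  ultimately show ?thesis by (simp add: cutoff_def periodize_def periodic_cutoff_def)
qed

text \<open>Height times length of the support: within the cell the cutoff occupies an interval of
  length \<open>2 * T\<close> at each end, hence the factor \<open>4\<close>.\<close>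

lemma norm_integral_periodic_cutoff_le:
  fixes e :: "real \<Rightarrow> complex"
  assumes T: "0 < T" "T < 1" and f: "continuous_on UNIV f" "\<And>t. \<bar>t\<bar> > 2 \<Longrightarrow> f t = 0" "\<And>t. \<bar>f t\<bar> \<le> B"
    and e: "continuous_on UNIV e" "\<And>t. norm (e t) \<le> 1"
  shows "norm (LINT t:{0..2*pi}|lborel. of_real (periodic_cutoff f T t) * e t) \<le> 4 * B * T"
proof -
  define w where "w t = B * indicator {0..2 * T} t + B * indicator {2 * pi - 2 * T..2 * pi} t" for t :: real
  have w: "integrable lborel w" "(LINT t|lborel. w t) = 4 * B * T"
    unfolding w_def using T by (auto simp: lmeasurable_iff_integrable[symmetric])
  have "norm (LINT t:{0..2*pi}|lborel. of_real (periodic_cutoff f T t) * e t) \<le> (LINT t|lborel. w t)"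
    unfolding set_lebesgue_integral_def
  proof (rule order_trans[OF integral_norm_bound Bochner_Integration.integral_mono])
    have c: "continuous_on {0..2*pi} (\<lambda>t. of_real (periodic_cutoff f T t) * e t)"
      unfolding periodic_cutoff_def using T
      by (intro continuous_intros continuous_on_compose2[OF f(1)] continuous_on_subset[OF e(1)]) auto
    show "integrable lborel (\<lambda>t. norm (indicator {0..2*pi} t *\<^sub>R (of_real (periodic_cutoff f T t) * e t)))"
      using borel_integrable_atLeastAtMost'[OF c] unfolding set_integrable_def by (rule integrable_norm)
    show "integrable lborel w" by fact
    fix t :: real
    have B: "B \<ge> 0" using f(3)[of 0] by linarith
    show "norm (indicator {0..2*pi} t *\<^sub>R (of_real (periodic_cutoff f T t) * e t)) \<le> w t"
    proof (cases "t \<in> {0..2*pi}")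
      case True
      have "\<bar>f (t / T)\<bar> \<le> B * indicator {0..2 * T} t"
      proof (cases "t \<le> 2 * T")
        case False
        then have "f (t / T) = 0" using T by (intro f(2)) (simp add: field_simps)
        then show ?thesis using B by simp
      qed (use True f(3) in auto)
      moreover have "\<bar>f ((t - 2 * pi) / T)\<bar> \<le> B * indicator {2 * pi - 2 * T..2 * pi} t"
      proof (cases "2 * pi - 2 * T \<le> t")
        case False
        then have "f ((t - 2 * pi) / T) = 0" using T by (intro f(2)) (auto simp: field_simps abs_if)
        then show ?thesis using B by simp
      qed (use True f(3) in auto)
      ultimately have "\<bar>periodic_cutoff f T t\<bar> \<le> w t" unfolding periodic_cutoff_def w_def by linarith
      moreover have "norm (of_real (periodic_cutoff f T t) * e t) \<le> \<bar>periodic_cutoff f T t\<bar>"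
        using e(2)[of t] by (simp add: norm_mult mult_left_le)
      ultimately show ?thesis using True by simp
    qed (use B in \<open>simp add: w_def\<close>)
  qed
  then show ?thesis using w by simp
qed

(* Two integrations by parts; the boundary terms cancel because the cutoff and its derivative
   take the same values at 0 and 2 pi. *)
lemma integral_periodic_cutoff_by_parts:
  assumes T: "0 < T" "T < 1" and "bump \<eta>" and "m \<noteq> 0"
  shows "(LINT t:{0..2*pi}|lborel. of_real (periodic_cutoff \<eta> T t) * cis (of_int m * t))
    = - ((LINT t:{0..2*pi}|lborel. of_real (periodic_cutoff (deriv (deriv \<eta>)) T t) * cis (of_int m * t))
          / of_real ((T * of_int m)^2))"
proof -
  note bd = bump_derivatives[OF \<open>bump \<eta>\<close>]
  define g0 where "g0 t = complex_of_real (periodic_cutoff \<eta> T t)" for t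
  define g1 where "g1 t = complex_of_real (periodic_cutoff (deriv \<eta>) T t / T)" for t
  define g2 where "g2 t = complex_of_real (periodic_cutoff (deriv (deriv \<eta>)) T t / T^2)" for t
  define e where "e t = cis (of_int m * t)" for t
  define a where "a = \<i> * of_int m"
  have a: "a \<noteq> 0" using \<open>m \<noteq> 0\<close> by (simp add: a_def)
  have "a * a = (\<i> * \<i>) * (of_int m * of_int m)" by (simp only: a_def mult_ac)
  then have a2: "a * a = - of_real ((of_int m)^2)" by (simp add: power2_eq_square)
  have "(periodic_cutoff \<eta> T has_real_derivative periodic_cutoff (deriv \<eta>) T t / T) (at t within A)" for t A
    unfolding periodic_cutoff_def[abs_def] using T
    by (auto intro!: derivative_eq_intros DERIV_chain2[OF bd(1)] simp: field_simps)
  then have g0: "(g0 has_vector_derivative g1 t) (at t within A)" for t A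
    unfolding g0_def g1_def by (intro has_vector_derivative_of_real) (simp add: has_real_derivative_iff_has_vector_derivative)
  have "((\<lambda>t. periodic_cutoff (deriv \<eta>) T t / T) has_real_derivative periodic_cutoff (deriv (deriv \<eta>)) T t / T^2) (at t within A)" for t A
    unfolding periodic_cutoff_def[abs_def] using T
    by (auto intro!: derivative_eq_intros DERIV_chain2[OF bd(2)] simp: field_simps power2_eq_square)
  then have g1: "(g1 has_vector_derivative g2 t) (at t within A)" for t A
    unfolding g1_def g2_def by (intro has_vector_derivative_of_real) (simp add: has_real_derivative_iff_has_vector_derivative)
  have e: "(e has_vector_derivative a * e t) (at t within A)" for t A
    unfolding e_def a_def cis_conv_exp of_real_mult of_real_of_int_eq
    by (intro has_vector_derivative_real_field[where f="\<lambda>z. exp (\<i> * (of_int m * z))"])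
      (auto intro!: derivative_eq_intros simp: mult_ac)
  have conte: "continuous_on A e" for A unfolding e_def by (intro continuous_intros)
  have cont0: "continuous_on A g0" for A
    using g0 by (intro continuous_at_imp_continuous_on) (auto intro: has_vector_derivative_continuous)
  have cont2: "continuous_on A g2" for A
    unfolding g2_def periodic_cutoff_def using T by (intro continuous_intros continuous_on_compose2[OF bd(3)]) auto
  \<comment> \<open>\<open>\<Phi>\<close> packs both integrations by parts into one antiderivative:
    in its derivative the terms with \<open>g1\<close> cancel, which leaves
    \<open>e t * g0 t - e t * g2 t / (a * a)\<close>.\<close>
  define \<Phi> where "\<Phi> t = e t * (g0 t / a - g1 t / (a * a))" for t
  have "(LBINT t=0..2*pi. e t * g0 t - e t * g2 t / (a * a)) = \<Phi> (2 * pi) - \<Phi> 0"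
    unfolding zero_ereal_def
  proof (rule interval_integral_FTC_finite)
    show "continuous_on {min 0 (2*pi)..max 0 (2*pi)} (\<lambda>t. e t * g0 t - e t * g2 t / (a * a))"
      using a by (intro continuous_intros conte cont0 cont2) auto
    fix t :: real
    have "(\<Phi> has_vector_derivative e t * (g1 t / a - g2 t / (a * a)) + a * e t * (g0 t / a - g1 t / (a * a)))
        (at t within {min 0 (2*pi)..max 0 (2*pi)})"
      unfolding \<Phi>_def by (intro has_vector_derivative_mult e has_vector_derivative_diff has_vector_derivative_divide g0 g1)
    also have "e t * (g1 t / a - g2 t / (a * a)) + a * e t * (g0 t / a - g1 t / (a * a)) = e t * g0 t - e t * g2 t / (a * a)"
      using a by (simp add: field_simps)
    finally show "(\<Phi> has_vector_derivative e t * g0 t - e t * g2 t / (a * a)) (at t within {min 0 (2*pi)..max 0 (2*pi)})" .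
  qed
  moreover have "\<Phi> (2 * pi) = \<Phi> 0"
  proof -
    \<comment> \<open>As \<open>2 * pi / T > 2\<close>, the distant bump vanishes with its
      derivative at each end, so both ends see the values at the centre of the bump.\<close>
    have "2 * T < 2 * pi" using T pi_gt3 by linarith
    then have big: "\<bar>2 * pi / T\<bar> > 2" "\<bar>- (2 * pi) / T\<bar> > 2" using T by (simp_all add: field_simps)
    have "cis (of_int m * (2 * pi)) = 1"
      using cis_multiple_2pi[of "of_int m"] by (simp add: mult.commute)
    then show ?thesis
      using bd(4)[OF big(1)] bd(4)[OF big(2)]
      by (simp add: \<Phi>_def e_def g0_def g1_def periodic_cutoff_def)
  qed
  ultimately have 0: "(LINT t:{0..2*pi}|lborel. e t * g0 t - e t * g2 t / (a * a)) = 0"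
    using interval_integral_Icc[of 0 "2*pi" "\<lambda>t. e t * g0 t - e t * g2 t / (a * a)"] by (simp add: zero_ereal_def)
  have "(LINT t:{0..2*pi}|lborel. e t * g0 t - e t * g2 t / (a * a))
      = (LINT t:{0..2*pi}|lborel. e t * g0 t) - (LINT t:{0..2*pi}|lborel. e t * g2 t / (a * a))"
    using a by (intro set_integral_diff borel_integrable_atLeastAtMost' continuous_intros conte cont0 cont2) auto
  then have "(LINT t:{0..2*pi}|lborel. e t * g0 t) = (LINT t:{0..2*pi}|lborel. e t * g2 t / (a * a))"
    using 0 by simp
  also have "\<dots> = (LINT t:{0..2*pi}|lborel. (of_real (periodic_cutoff (deriv (deriv \<eta>)) T t) * cis (of_int m * t))
      * (- 1 / of_real ((T * of_int m)^2)))"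
    unfolding a2 by (intro set_lebesgue_integral_cong) (auto simp: g2_def e_def power_mult_distrib field_simps)
  also have "\<dots> = (LINT t:{0..2*pi}|lborel. of_real (periodic_cutoff (deriv (deriv \<eta>)) T t) * cis (of_int m * t))
      * (- 1 / of_real ((T * of_int m)^2))"
    by (rule set_integral_mult_left)
  finally show ?thesis by (simp add: g0_def e_def mult.commute)
qed

text \<open>For \<open>\<bar>T * m\<bar>\<close> at most \<open>1\<close> the length of the support
  decides; beyond that, two integrations by parts gain \<open>(T * m)^2\<close>. In both ranges the
  comparison with \<open>1 + (T * m)^2\<close> costs a factor \<open>2\<close>, which turns
  \<open>4 * B\<close> into \<open>8 * B\<close>.\<close>

lemma cutoff_coeff_bound:
  assumes "bump \<eta>"
  obtains c where "c \<ge> 0" "\<And>T m. 0 < T \<Longrightarrow> T < 1 \<Longrightarrow>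
    norm (LINT t:{0..2*pi}|lborel. of_real (cutoff \<eta> T t) * cis (of_int m * t)) \<le> c * lorentz T m"
proof -
  note bd = bump_derivatives[OF assms]
  have cont: "continuous_on UNIV \<eta>"
    using bd(1) DERIV_isCont by (auto intro!: continuous_at_imp_continuous_on)
  obtain B0 where B0: "B0 \<ge> 0" "\<And>t. \<bar>\<eta> t\<bar> \<le> B0" using bounded_of_support[OF cont] bd(4) by blast
  obtain B2 where B2: "B2 \<ge> 0" "\<And>t. \<bar>deriv (deriv \<eta>) t\<bar> \<le> B2" using bounded_of_support[OF bd(3)] bd(4) by blast
  define B where "B = max B0 B2"
  have B: "B \<ge> 0" "\<And>t. \<bar>\<eta> t\<bar> \<le> B" "\<And>t. \<bar>deriv (deriv \<eta>) t\<bar> \<le> B"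
    using B0 B2 by (auto simp: B_def le_max_iff_disj)
  have "norm (LINT t:{0..2*pi}|lborel. of_real (cutoff \<eta> T t) * cis (of_int m * t)) \<le> (8 * B) * lorentz T m"
    if T: "0 < T" "T < 1" for T m
  proof -
    define I where "I = (LINT t:{0..2*pi}|lborel. of_real (periodic_cutoff \<eta> T t) * cis (of_int m * t))"
    define x where "x = (T * of_int m)^2"
    have eq: "(LINT t:{0..2*pi}|lborel. of_real (cutoff \<eta> T t) * cis (of_int m * t)) = I"
      unfolding I_def by (intro set_lebesgue_integral_cong) (auto simp: cutoff_eq_periodic_cutoff[OF T _ _ conjunct1[OF bd(4)]])
    have e: "continuous_on UNIV (\<lambda>t. cis (of_int m * t))" by (intro continuous_intros)
    have I1: "norm I \<le> 4 * B * T"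
      unfolding I_def by (rule norm_integral_periodic_cutoff_le[OF T cont _ B(2) e]) (use bd(4) in auto)
    have "norm I \<le> 8 * B * (T / (1 + x))"
    proof (cases "x \<le> 1")
      case True
      have "0 \<le> x" by (simp add: x_def)
      have "4 * B * T * (1 + x) \<le> 4 * B * T * 2" using True B T by (intro mult_left_mono) auto
      then have "4 * B * T \<le> 8 * B * (T / (1 + x))" using \<open>0 \<le> x\<close> by (simp add: field_simps)
      then show ?thesis using I1 by linarith
    next
      case False
      then have "m \<noteq> 0" by (auto simp: x_def)
      have "norm (LINT t:{0..2*pi}|lborel. of_real (periodic_cutoff (deriv (deriv \<eta>)) T t) * cis (of_int m * t)) \<le> 4 * B * T"
        by (rule norm_integral_periodic_cutoff_le[OF T bd(3) _ B(3) e]) (use bd(4) in auto)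
      then have "norm I \<le> 4 * B * T / x"
        unfolding I_def integral_periodic_cutoff_by_parts[OF T assms \<open>m \<noteq> 0\<close>] x_def
        by (simp add: norm_divide norm_power norm_mult divide_right_mono power_mult_distrib)
      also have "\<dots> \<le> 8 * B * (T / (1 + x))"
      proof -
        have "4 * B * T * (1 + x) \<le> 4 * B * T * (2 * x)" using False B T by (intro mult_left_mono) auto
        then show ?thesis using False by (simp add: field_simps)
      qed
      finally show ?thesis .
    qed
    then show ?thesis by (simp add: eq lorentz_def x_def)
  qed
  then show ?thesis using that[of "8 * B"] B(1) by simp
qed

section \<open>The cubic nonlinearity\<close>

lemma lorentz_uminus: "lorentz T (- m) = lorentz T m"
  by (simp add: lorentz_def)

lemma bump_continuous: "bump \<eta> \<Longrightarrow> continuous_on UNIV \<eta>"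
  using bump_derivatives(1) DERIV_isCont by (blast intro!: continuous_at_imp_continuous_on)

lemma cutoff_measurable:
  assumes "bump \<eta>"
  shows "cutoff \<eta> T \<in> borel_measurable borel"
proof -
  have [measurable]: "\<eta> \<in> borel_measurable borel"
    using bump_continuous[OF assms] by (rule borel_measurable_continuous_onI)
  show ?thesis unfolding cutoff_def periodize_def[abs_def] by measurable
qed

lemma cutoff_snd_measurable:
  assumes "bump \<eta>"
  shows "(\<lambda>z. cutoff \<eta> T (snd z)) \<in> borel_measurable torus"
proof -
  have "(\<lambda>z :: real \<times> real. cutoff \<eta> T (snd z)) \<in> borel_measurable (borel \<Otimes>\<^sub>M borel)"
    by (rule measurable_compose[OF measurable_snd cutoff_measurable[OF assms]])
  then show ?thesis by (intro borel_imp_torus_measurable) (simp add: borel_prod)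
qed

lemma cutoff_bounded:
  assumes "bump \<eta>"
  obtains B where "B \<ge> 0" "\<And>T t. \<bar>cutoff \<eta> T t\<bar> \<le> B"
proof -
  obtain B where "B \<ge> 0" "\<And>t. \<bar>\<eta> t\<bar> \<le> B"
    using bounded_of_support[OF bump_continuous[OF assms]] bump_derivatives(4)[OF assms] by blast
  then show ?thesis using that by (simp add: cutoff_def periodize_def)
qed

lemma cutoff_periodic: "cutoff \<eta> T (t + 2 * pi) = cutoff \<eta> T t"
proof -
  have "(t + 2 * pi + pi) / (2 * pi) = (t + pi) / (2 * pi) + 1" by (simp add: field_simps)
  then have "\<lfloor>(t + 2 * pi + pi) / (2 * pi)\<rfloor> = \<lfloor>(t + pi) / (2 * pi)\<rfloor> + 1" by simp
  then show ?thesis by (simp add: cutoff_def periodize_def algebra_simps)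
qed

text \<open>The cutoff depends on time alone: it keeps the spatial frequency and spreads the time
  frequency by the kernel \<open>lorentz\<close>.\<close>

lemma fourier_coeff_cutoff_character:
  assumes "bump \<eta>"
  obtains c where "c \<ge> 0" "\<And>T k n \<tau>. 0 < T \<Longrightarrow> T < 1 \<Longrightarrow>
    norm (fourier_coeff (\<lambda>z. of_real (cutoff \<eta> T (snd z)) * character k z) n \<tau>)
      \<le> c * of_bool (fst k = n) * lorentz T (\<tau> - snd k)"
proof -
  obtain c where c: "c \<ge> 0" "\<And>T m. 0 < T \<Longrightarrow> T < 1 \<Longrightarrow>
    norm (LINT t:{0..2*pi}|lborel. of_real (cutoff \<eta> T t) * cis (of_int m * t)) \<le> c * lorentz T m"
    using cutoff_coeff_bound[OF assms] by blast
  obtain B where B: "B \<ge> 0" "\<And>T t. \<bar>cutoff \<eta> T t\<bar> \<le> B" using cutoff_bounded[OF assms] by blast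
  have "norm (fourier_coeff (\<lambda>z. of_real (cutoff \<eta> T (snd z)) * character k z) n \<tau>)
      \<le> c * of_bool (fst k = n) * lorentz T (\<tau> - snd k)" if T: "0 < T" "T < 1" for T k n \<tau>
  proof -
    define I where "I = (LINT t:{0..2*pi}|lborel. of_real (cutoff \<eta> T t) * cis (of_int (snd k - \<tau>) * t))"
    have I: "norm I \<le> c * lorentz T (\<tau> - snd k)"
      using c(2)[OF T, of "snd k - \<tau>"] lorentz_uminus[of T "\<tau> - snd k"] by (simp add: I_def)
    note [measurable] = cutoff_measurable[OF assms]
    have cism: "(\<lambda>x. cis (of_int j * x)) \<in> borel_measurable borel" for j
      by (intro borel_measurable_continuous_onI continuous_intros)
    have "(LINT z|torus. of_real (cutoff \<eta> T (snd z)) * character k z * character (- (n, \<tau>)) z)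
      = (LINT z|torus. cis (of_int (fst k - n) * fst z) * (of_real (cutoff \<eta> T (snd z)) * cis (of_int (snd k - \<tau>) * snd z)))"
      by (intro Bochner_Integration.integral_cong)
        (auto simp: character_def cis_mult algebra_simps)
    also have "\<dots> = (LINT x:{0..2*pi}|lborel. cis (of_int (fst k - n) * x)) * I"
      unfolding I_def
    proof (rule integral_torus_product[where B="max 1 B"])
      show "(\<lambda>t. of_real (cutoff \<eta> T t) * cis (of_int (snd k - \<tau>) * t)) \<in> borel_measurable borel"
        using cism[of "snd k - \<tau>"] by measurable
    qed (use cism B in \<open>auto simp: norm_mult le_max_iff_disj simp del: of_int_diff\<close>)
    also have "\<dots> = of_bool (fst k = n) * (2 * pi) * I"
      unfolding integral_cis_period by simp
    finally have "norm (fourier_coeff (\<lambda>z. of_real (cutoff \<eta> T (snd z)) * character k z) n \<tau>)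
        = of_bool (fst k = n) * (norm I / (2 * pi))"
      unfolding fourier_coeff_altdef by (simp add: norm_mult power2_eq_square)
    also have "\<dots> \<le> of_bool (fst k = n) * norm I"
      using pi_gt3 by (intro mult_left_mono) (auto simp: divide_le_eq mult_le_cancel_left1)
    also have "\<dots> \<le> of_bool (fst k = n) * (c * lorentz T (\<tau> - snd k))"
      by (intro mult_left_mono I) auto
    finally show ?thesis by (simp add: mult_ac)
  qed
  then show ?thesis using that c(1) by blast
qed

lemma fourier_coeff_cmult: "fourier_coeff (\<lambda>z. a * f z) n \<tau> = a * fourier_coeff f n \<tau>"
  unfolding fourier_coeff_altdef by (simp add: mult.assoc)

lemma fourier_coeff_sum:
  assumes "\<And>i. i \<in> I \<Longrightarrow> integrable torus (f i)"
  shows "fourier_coeff (\<lambda>z. \<Sum>i\<in>I. f i z) n \<tau> = (\<Sum>i\<in>I. fourier_coeff (f i) n \<tau>)"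
  unfolding fourier_coeff_altdef sum_distrib_right
  using assms by (subst Bochner_Integration.integral_sum) (auto intro: integrable_times_character simp: scaleR_sum_right)

lemma sum_triple_product:
  fixes w :: "'a::comm_semiring_0"
  shows "(\<Sum>i\<in>A. f i) * ((\<Sum>j\<in>B. g j) * ((\<Sum>k\<in>D. h k) * w))
    = (\<Sum>i\<in>A. \<Sum>j\<in>B. \<Sum>k\<in>D. f i * (g j * (h k * w)))"
  by (subst sum_distrib_right[of h], subst sum_product, subst sum_product, simp only: sum_distrib_left)

lemma borel_measurable_cnj [measurable (raw)]:
  "f \<in> borel_measurable M \<Longrightarrow> (\<lambda>x. cnj (f x)) \<in> borel_measurable M"
  by (rule measurable_compose[OF _ borel_measurable_continuous_onI]) (auto intro: continuous_intros)

section \<open>Majorants for the coefficients of the cubic term\<close>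

text \<open>Up to a constant, a majorant for the Fourier coefficients of
  \<open>\<eta> (t / T) * u\<close> when \<open>a\<close> bounds those of \<open>u\<close>.\<close>

definition smeared :: "real \<Rightarrow> (int \<times> int \<Rightarrow> ennreal) \<Rightarrow> int \<times> int \<Rightarrow> ennreal" where
  "smeared T a k = (\<Sum>\<^sup>+\<sigma>. a (fst k, \<sigma>) * ennreal (lorentz T (snd k - \<sigma>)))"

text \<open>The relation \<open>k = k1 - k2 + k3\<close> is solved for \<open>k1\<close>, the
  frequency of the factor that carries the cutoff. The nesting is the one expected by
  \<open>nnsum_weighted_trilinear\<close>.\<close>

definition cubic_majorant :: "real \<Rightarrow> (int \<times> int \<Rightarrow> ennreal) \<Rightarrow> int \<times> int \<Rightarrow> ennreal" where
  "cubic_majorant T a k = (\<Sum>\<^sup>+k2. a k2 * (\<Sum>\<^sup>+k3. a k3 * smeared T a (k + k2 - k3)))"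

text \<open>The cutoff acts on the product character with frequency \<open>k1 - k2 + k3\<close>;
  since \<open>lorentz\<close> sees only differences of frequencies, it can be charged to
  \<open>k1\<close> alone. The bound uses all coefficients \<open>c k\<close>, not only those in
  \<open>S\<close>, and is therefore the same for every partial sum.\<close>

lemma fourier_coeff_cutoff_trig_poly:
  assumes "bump \<eta>"
  obtains C where "C \<ge> 0" "\<And>T S c n \<tau>. 0 < T \<Longrightarrow> T < 1 \<Longrightarrow> finite S \<Longrightarrow>
    ennreal (norm (fourier_coeff (\<lambda>z. of_real (cutoff \<eta> T (snd z)) *
      (trig_poly S c z * cnj (trig_poly S c z) * trig_poly S c z)) n \<tau>))
    \<le> ennreal C * cubic_majorant T (\<lambda>k. ennreal (norm (c k))) (n, \<tau>)"
proof -
  obtain C where C: "C \<ge> 0" "\<And>T k n \<tau>. 0 < T \<Longrightarrow> T < 1 \<Longrightarrow>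
    norm (fourier_coeff (\<lambda>z. of_real (cutoff \<eta> T (snd z)) * character k z) n \<tau>)
      \<le> C * of_bool (fst k = n) * lorentz T (\<tau> - snd k)"
    using fourier_coeff_cutoff_character[OF assms] by blast
  obtain B where B: "B \<ge> 0" "\<And>T t. \<bar>cutoff \<eta> T t\<bar> \<le> B" using cutoff_bounded[OF assms] by blast
  have "ennreal (norm (fourier_coeff (\<lambda>z. of_real (cutoff \<eta> T (snd z)) *
      (trig_poly S c z * cnj (trig_poly S c z) * trig_poly S c z)) n \<tau>))
    \<le> ennreal C * cubic_majorant T (\<lambda>k. ennreal (norm (c k))) (n, \<tau>)"
    if T: "0 < T" "T < 1" and S: "finite S" for T S c n \<tau>
  proof -
    define a where "a k = ennreal (norm (c k))" for k
    define \<phi> where "\<phi> k z = of_real (cutoff \<eta> T (snd z)) * character k z" for k z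
    have \<phi>: "integrable torus (\<phi> k)" for k
    proof (rule integrable_bounded_torus[where B=B])
      note [measurable] = cutoff_snd_measurable[OF assms]
      show "\<phi> k \<in> borel_measurable torus" unfolding \<phi>_def by measurable
    qed (use B in \<open>simp add: \<phi>_def norm_mult norm_character\<close>)
    define E where "E k1 k2 k3 = C * of_bool (fst (k1 - k2 + k3) = n) * lorentz T (\<tau> - snd (k1 - k2 + k3))" for k1 k2 k3
    have E: "0 \<le> E k1 k2 k3" for k1 k2 k3
      using C(1) T lorentz_nonneg[of T] by (simp add: E_def)
    have "fourier_coeff (\<lambda>z. of_real (cutoff \<eta> T (snd z)) *
        (trig_poly S c z * cnj (trig_poly S c z) * trig_poly S c z)) n \<tau>
      = fourier_coeff (\<lambda>z. \<Sum>k2\<in>S. \<Sum>k3\<in>S. \<Sum>k1\<in>S. (cnj (c k2) * c k3 * c k1) * \<phi> (k1 - k2 + k3) z) n \<tau>"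
    proof -
      have "of_real (cutoff \<eta> T (snd z)) * (trig_poly S c z * cnj (trig_poly S c z) * trig_poly S c z)
        = (\<Sum>k2\<in>S. \<Sum>k3\<in>S. \<Sum>k1\<in>S. (cnj (c k2) * c k3 * c k1) * \<phi> (k1 - k2 + k3) z)" for z
      proof -
        have "of_real (cutoff \<eta> T (snd z)) * (trig_poly S c z * cnj (trig_poly S c z) * trig_poly S c z)
          = cnj (trig_poly S c z) * (trig_poly S c z * (trig_poly S c z * of_real (cutoff \<eta> T (snd z))))"
          by (simp only: mult_ac)
        also have "\<dots> = (\<Sum>k2\<in>S. \<Sum>k3\<in>S. \<Sum>k1\<in>S. (cnj (c k2 * character k2 z)) * ((c k3 * character k3 z) * (c k1 * character k1 z * of_real (cutoff \<eta> T (snd z)))))"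
          unfolding trig_poly_def cnj_sum by (rule sum_triple_product)
        also have "\<dots> = (\<Sum>k2\<in>S. \<Sum>k3\<in>S. \<Sum>k1\<in>S. (cnj (c k2) * c k3 * c k1) * \<phi> (k1 - k2 + k3) z)"
          unfolding \<phi>_def diff_conv_add_uminus character_add character_uminus complex_cnj_mult
          by (simp only: mult_ac)
        finally show ?thesis .
      qed
      then show ?thesis by simp
    qed
    also have "\<dots> = (\<Sum>k2\<in>S. \<Sum>k3\<in>S. \<Sum>k1\<in>S. (cnj (c k2) * c k3 * c k1) * fourier_coeff (\<phi> (k1 - k2 + k3)) n \<tau>)"
      by (simp add: fourier_coeff_sum fourier_coeff_cmult \<phi>)
    finally have "norm (fourier_coeff (\<lambda>z. of_real (cutoff \<eta> T (snd z)) *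
        (trig_poly S c z * cnj (trig_poly S c z) * trig_poly S c z)) n \<tau>)
      = norm (\<Sum>k2\<in>S. \<Sum>k3\<in>S. \<Sum>k1\<in>S. (cnj (c k2) * c k3 * c k1) * fourier_coeff (\<phi> (k1 - k2 + k3)) n \<tau>)"
      by simp
    also have "\<dots> \<le> (\<Sum>k2\<in>S. \<Sum>k3\<in>S. \<Sum>k1\<in>S. (norm (c k2) * norm (c k3) * norm (c k1)) * E k1 k2 k3)"
    proof (intro order_trans[OF norm_sum sum_mono])
      fix k2 k3 k1
      show "norm ((cnj (c k2) * c k3 * c k1) * fourier_coeff (\<phi> (k1 - k2 + k3)) n \<tau>)
        \<le> (norm (c k2) * norm (c k3) * norm (c k1)) * E k1 k2 k3"
        using C(2)[OF T, of "k1 - k2 + k3" n \<tau>]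
        unfolding norm_mult E_def \<phi>_def[abs_def] complex_mod_cnj by (intro mult_left_mono) auto
    qed
    finally have "ennreal (norm (fourier_coeff (\<lambda>z. of_real (cutoff \<eta> T (snd z)) *
        (trig_poly S c z * cnj (trig_poly S c z) * trig_poly S c z)) n \<tau>))
      \<le> ennreal (\<Sum>k2\<in>S. \<Sum>k3\<in>S. \<Sum>k1\<in>S. (norm (c k2) * norm (c k3) * norm (c k1)) * E k1 k2 k3)"
      by (rule ennreal_leI)
    also have "\<dots> = (\<Sum>k2\<in>S. \<Sum>k3\<in>S. \<Sum>k1\<in>S. a k2 * (a k3 * (a k1 * ennreal (E k1 k2 k3))))"
      using E by (simp add: sum_ennreal[symmetric] sum_nonneg ennreal_mult a_def mult.assoc)
    also have "\<dots> = (\<Sum>k2\<in>S. a k2 * (\<Sum>k3\<in>S. a k3 * (\<Sum>k1\<in>S. a k1 * ennreal (E k1 k2 k3))))"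
      by (simp add: sum_distrib_left)
    also have "\<dots> \<le> (\<Sum>\<^sup>+k2. a k2 * (\<Sum>\<^sup>+k3. a k3 * (\<Sum>\<^sup>+k1. a k1 * ennreal (E k1 k2 k3))))"
      by (intro order_trans[OF sum_mono sum_le_nnsum] mult_left_mono order_trans[OF sum_mono sum_le_nnsum] sum_le_nnsum S) auto
    also have "\<dots> = (\<Sum>\<^sup>+k2. a k2 * (\<Sum>\<^sup>+k3. a k3 * (ennreal C * smeared T a ((n, \<tau>) + k2 - k3))))"
    proof -
      have "(\<Sum>\<^sup>+k1. a k1 * ennreal (E k1 k2 k3)) = ennreal C * smeared T a ((n, \<tau>) + k2 - k3)" for k2 k3
      proof -
        define n' where "n' = n + fst k2 - fst k3"
        have "(\<Sum>\<^sup>+k1. a k1 * ennreal (E k1 k2 k3)) = (\<Sum>\<^sup>+m. \<Sum>\<^sup>+\<sigma>. a (m, \<sigma>) * ennreal (E (m, \<sigma>) k2 k3))"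
          by (rule nnsum_pair[symmetric])
        \<comment> \<open>Matching spatial frequencies leaves the single value \<open>n'\<close> for
          the first component of \<open>k1\<close>.\<close>
        also have "\<dots> = (\<Sum>\<^sup>+\<sigma>. a (n', \<sigma>) * ennreal (E (n', \<sigma>) k2 k3))"
          by (subst nnsum_finite_support[of "{n'}"]) (auto simp: E_def n'_def)
        also have "\<dots> = (\<Sum>\<^sup>+\<sigma>. ennreal C * (a (n', \<sigma>) * ennreal (lorentz T (snd ((n, \<tau>) + k2 - k3) - \<sigma>))))"
          using C(1) lorentz_nonneg[of T] T
          by (intro nn_integral_cong) (simp add: E_def n'_def ennreal_mult algebra_simps)
        finally show ?thesis by (simp add: nnsum_cmult smeared_def n'_def)
      qed
      then show ?thesis by simp
    qed
    also have "\<dots> = ennreal C * cubic_majorant T a (n, \<tau>)"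
      by (simp add: cubic_majorant_def nnsum_cmult(1)[symmetric] mult.left_commute)
    finally show ?thesis by (simp add: a_def[abs_def])
  qed
  then show ?thesis using that C(1) by blast
qed

text \<open>The majorant is the same along the partial sums, so the bound survives the limit. The
  dominating function \<open>B * G z ^ 3\<close> gives both the integrability of the cubic term and
  the convergence of the coefficients.\<close>

lemma fourier_coeff_cutoff_cubic:
  assumes "bump \<eta>"
  obtains C where "C \<ge> 0"
    "\<And>T u. 0 < T \<Longrightarrow> T < 1 \<Longrightarrow> torus_integrable u \<Longrightarrow>
      (\<Sum>\<^sup>+k. ennreal (modulation k) * ennreal (norm (fourier_coeff u (fst k) (snd k))) ^ 2) < \<infinity> \<Longrightarrow>
      torus_integrable (cutoff_cubic \<eta> T u) \<and>
      (\<forall>n \<tau>. ennreal (norm (fourier_coeff (cutoff_cubic \<eta> T u) n \<tau>))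
        \<le> ennreal C * cubic_majorant T (\<lambda>k. ennreal (norm (fourier_coeff u (fst k) (snd k)))) (n, \<tau>))"
proof -
  obtain C where C: "C \<ge> 0" "\<And>T S c n \<tau>. 0 < T \<Longrightarrow> T < 1 \<Longrightarrow> finite S \<Longrightarrow>
    ennreal (norm (fourier_coeff (\<lambda>z. of_real (cutoff \<eta> T (snd z)) *
      (trig_poly S c z * cnj (trig_poly S c z) * trig_poly S c z)) n \<tau>))
    \<le> ennreal C * cubic_majorant T (\<lambda>k. ennreal (norm (c k))) (n, \<tau>)"
    using fourier_coeff_cutoff_trig_poly[OF assms] by blast
  obtain B where B: "B \<ge> 0" "\<And>T t. \<bar>cutoff \<eta> T t\<bar> \<le> B" using cutoff_bounded[OF assms] by blast
  have "torus_integrable (cutoff_cubic \<eta> T u) \<and>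
      (\<forall>n \<tau>. ennreal (norm (fourier_coeff (cutoff_cubic \<eta> T u) n \<tau>))
        \<le> ennreal C * cubic_majorant T (\<lambda>k. ennreal (norm (fourier_coeff u (fst k) (snd k)))) (n, \<tau>))"
    if T: "0 < T" "T < 1" and u: "torus_integrable u"
      and fin: "(\<Sum>\<^sup>+k. ennreal (modulation k) * ennreal (norm (fourier_coeff u (fst k) (snd k))) ^ 2) < \<infinity>" for T u
  proof -
    define c where "c k = fourier_coeff u (fst k) (snd k)" for k
    have per: "u (x + 2*pi, t) = u (x, t)" "u (x, t + 2*pi) = u (x, t)" for x t
      using u by (auto simp: torus_integrable_altdef)
    have uint: "integrable torus u"
      using u by (auto simp: torus_integrable_altdef)
    obtain S G where S: "\<And>j. finite (S j)" and G: "integrable torus (\<lambda>z. G z ^ 3)"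
      and dom: "AE z in torus. \<forall>j. norm (trig_poly (S j) c z) \<le> G z"
      and conv: "AE z in torus. (\<lambda>j. trig_poly (S j) c z) \<longlonglongrightarrow> u z"
      using fourier_series_dominated[OF uint c_def] fin unfolding c_def by blast
    define F where "F z = of_real (cutoff \<eta> T (snd z)) * (u z * cnj (u z) * u z)" for z
    define Fj where "Fj j z = of_real (cutoff \<eta> T (snd z)) *
      (trig_poly (S j) c z * cnj (trig_poly (S j) c z) * trig_poly (S j) c z)" for j z
    have F: "cutoff_cubic \<eta> T u = F"
    proof
      fix z
      have "cutoff_cubic \<eta> T u z = of_real (cutoff \<eta> T (snd z)) * (of_real ((cmod (u z))^2) * u z)"
        by (simp add: cutoff_cubic_def split_beta)
      then show "cutoff_cubic \<eta> T u z = F z"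
        unfolding complex_norm_square F_def .
    qed
    note [measurable] = cutoff_snd_measurable[OF assms]
    note [measurable] = borel_measurable_integrable[OF uint]
    have [measurable]: "F \<in> borel_measurable torus" "Fj j \<in> borel_measurable torus" for j
      unfolding F_def[abs_def] Fj_def[abs_def] by measurable
    have w: "integrable torus (\<lambda>z. B * G z ^ 3)" using G by simp
    have cube: "norm (of_real (cutoff \<eta> T t) * (w * cnj w * w)) \<le> B * g ^ 3" if "norm w \<le> g" for t g and w :: complex
    proof -
      have "norm w ^ 3 \<le> g ^ 3" using that by (intro power_mono) auto
      then have "\<bar>cutoff \<eta> T t\<bar> * norm w ^ 3 \<le> B * g ^ 3" using B by (intro mult_mono) auto
      then show ?thesis by (simp add: norm_mult power3_eq_cube)
    qed
    have domF: "AE z in torus. norm (F z) \<le> B * G z ^ 3"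
      using dom conv
    proof eventually_elim
      case (elim z)
      then have "norm (u z) \<le> G z" by (intro Lim_norm_ubound[OF sequentially_bot]) (auto intro: always_eventually)
      then show ?case unfolding F_def by (rule cube)
    qed
    then have Fint: "integrable torus F"
      by (intro Bochner_Integration.integrable_bound[OF w]) (auto elim!: eventually_mono)
    have "ennreal (norm (fourier_coeff F n \<tau>)) \<le> ennreal C * cubic_majorant T (\<lambda>k. ennreal (norm (c k))) (n, \<tau>)" for n \<tau>
    proof -
      have "(\<lambda>j. LINT z|torus. Fj j z * character (- (n, \<tau>)) z) \<longlonglongrightarrow> (LINT z|torus. F z * character (- (n, \<tau>)) z)"
      proof (rule integral_dominated_convergence[OF _ _ w])
        show "AE z in torus. (\<lambda>j. Fj j z * character (- (n, \<tau>)) z) \<longlonglongrightarrow> F z * character (- (n, \<tau>)) z"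
          using conv unfolding F_def Fj_def by eventually_elim (intro tendsto_intros)
        show "AE z in torus. norm (Fj j z * character (- (n, \<tau>)) z) \<le> B * G z ^ 3" for j
          using dom unfolding norm_mult norm_character Fj_def mult_1_right
          by eventually_elim (metis cube norm_mult)
      qed measurable
      then have "(\<lambda>j. fourier_coeff (Fj j) n \<tau>) \<longlonglongrightarrow> fourier_coeff F n \<tau>"
        unfolding fourier_coeff_altdef by (intro tendsto_scaleR tendsto_const)
      then have "(\<lambda>j. ennreal (norm (fourier_coeff (Fj j) n \<tau>))) \<longlonglongrightarrow> ennreal (norm (fourier_coeff F n \<tau>))"
        by (intro tendsto_ennrealI tendsto_norm)
      then show ?thesis
        by (rule LIMSEQ_le_const2) (use C(2)[OF T S] in \<open>auto simp: Fj_def[abs_def]\<close>)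
    qed
    moreover have "torus_integrable F"
      unfolding torus_integrable_altdef using Fint
      by (auto simp: F_def per cutoff_periodic)
    ultimately show ?thesis unfolding F c_def by blast
  qed
  then show ?thesis using that C(1) by blast
qed

section \<open>The norm estimate\<close>

lemma ennreal_infsum_eq_nnsum:
  fixes f :: "'a::countable \<Rightarrow> real"
  assumes "f summable_on UNIV" "\<And>x. 0 \<le> f x"
  shows "ennreal (infsum f UNIV) = (\<Sum>\<^sup>+x. ennreal (f x))"
proof -
  have eq: "ennreal (infsum f UNIV) = (SUP F\<in>{F. finite F \<and> F \<subseteq> UNIV}. ennreal (sum f F))"
    using assms by (intro infsum_nonneg_is_SUPREMUM_ennreal) auto
  show ?thesis
  proof (rule antisym)
    have "ennreal (sum f S) \<le> (\<Sum>\<^sup>+x. ennreal (f x))" if "finite S" for S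
      using sum_le_nnsum[OF that, of "\<lambda>x. ennreal (f x)"] assms(2) by simp
    then show "ennreal (infsum f UNIV) \<le> (\<Sum>\<^sup>+x. ennreal (f x))"
      unfolding eq by (intro SUP_least) auto
    show "(\<Sum>\<^sup>+x. ennreal (f x)) \<le> ennreal (infsum f UNIV)"
      unfolding eq
    proof (rule nnsum_le_finiteI)
      fix S :: "'a set" assume "finite S"
      then show "(\<Sum>x\<in>S. ennreal (f x)) \<le> (SUP F\<in>{F. finite F \<and> F \<subseteq> UNIV}. ennreal (sum f F))"
        using assms(2) by (intro SUP_upper2[of S]) auto
    qed
  qed
qed

lemma summable_on_of_nnsum_less_top:
  fixes f :: "'a::countable \<Rightarrow> real"
  assumes "(\<Sum>\<^sup>+x. ennreal (f x)) < \<infinity>" "\<And>x. 0 \<le> f x"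
  shows "f summable_on UNIV"
proof -
  obtain R where R: "0 \<le> R" "(\<Sum>\<^sup>+x. ennreal (f x)) = ennreal R"
    using assms(1) by (cases "\<Sum>\<^sup>+x. ennreal (f x)") auto
  have "sum f S \<le> R" if "finite S" for S
  proof -
    have "ennreal (sum f S) \<le> ennreal R"
      using sum_le_nnsum[OF that, of "\<lambda>x. ennreal (f x)"] assms(2) by (simp add: sum_ennreal R(2))
    then show ?thesis using R(1) by simp
  qed
  then show ?thesis
    using assms(2) by (intro nonneg_bdd_above_summable_on bdd_aboveI2[where M=R]) auto
qed

text \<open>The exponent \<open>p\<close> is \<open>1\<close> for the \<open>X\<close> norm and
  \<open>2\<close> for the \<open>Y\<close> norm. Positivity of \<open>w\<close> turns finiteness of
  the double sum into summability of each inner sum; as divergent sums have the value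
  \<open>0\<close>, a bound on the norm alone would not give membership in the space.\<close>

lemma weighted_infsum_bound:
  fixes g :: "int \<Rightarrow> int \<Rightarrow> real"
  assumes w: "\<And>n. 0 < w n" and g: "\<And>n \<tau>. 0 \<le> g n \<tau>" and R: "0 \<le> R" and p: "0 < p"
    and le: "(\<Sum>\<^sup>+n. ennreal (w n) * (\<Sum>\<^sup>+\<tau>. ennreal (g n \<tau>)) ^ p) \<le> ennreal R"
  shows "\<forall>n. g n summable_on UNIV" and "(\<lambda>n. w n * (\<Sum>\<^sub>\<infinity>\<tau>\<in>UNIV. g n \<tau>) ^ p) summable_on UNIV"
    and "(\<Sum>\<^sub>\<infinity>n\<in>UNIV. w n * (\<Sum>\<^sub>\<infinity>\<tau>\<in>UNIV. g n \<tau>) ^ p) \<le> R"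
proof -
  show sm: "\<forall>n. g n summable_on UNIV"
  proof
    fix n
    have "ennreal (w n) * (\<Sum>\<^sup>+\<tau>. ennreal (g n \<tau>)) ^ p \<le> ennreal R"
      using sum_le_nnsum[of "{n}" "\<lambda>n. ennreal (w n) * (\<Sum>\<^sup>+\<tau>. ennreal (g n \<tau>)) ^ p"] le by simp
    then have "ennreal (w n) * (\<Sum>\<^sup>+\<tau>. ennreal (g n \<tau>)) ^ p < \<infinity>"
      by (rule order_le_less_trans) simp
    then have "(\<Sum>\<^sup>+\<tau>. ennreal (g n \<tau>)) < \<infinity>"
      using w[of n] p by (auto simp: ennreal_mult_less_top power_less_top_ennreal)
    then show "g n summable_on UNIV" using g by (rule summable_on_of_nnsum_less_top)
  qed
  have "ennreal (w n * (\<Sum>\<^sub>\<infinity>\<tau>\<in>UNIV. g n \<tau>) ^ p) = ennreal (w n) * (\<Sum>\<^sup>+\<tau>. ennreal (g n \<tau>)) ^ p" for n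
    using w[of n] g sm by (simp add: ennreal_mult infsum_nonneg ennreal_power[symmetric] ennreal_infsum_eq_nnsum)
  then have eq: "(\<Sum>\<^sup>+n. ennreal (w n * (\<Sum>\<^sub>\<infinity>\<tau>\<in>UNIV. g n \<tau>) ^ p)) \<le> ennreal R"
    using le by simp
  have pos: "0 \<le> w n * (\<Sum>\<^sub>\<infinity>\<tau>\<in>UNIV. g n \<tau>) ^ p" for n
    using w[of n] g by (simp add: infsum_nonneg)
  show sm2: "(\<lambda>n. w n * (\<Sum>\<^sub>\<infinity>\<tau>\<in>UNIV. g n \<tau>) ^ p) summable_on UNIV"
    using eq by (intro summable_on_of_nnsum_less_top pos) (auto intro: order_le_less_trans)
  have "ennreal (\<Sum>\<^sub>\<infinity>n\<in>UNIV. w n * (\<Sum>\<^sub>\<infinity>\<tau>\<in>UNIV. g n \<tau>) ^ p) \<le> ennreal R"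
    using eq by (simp add: ennreal_infsum_eq_nnsum[OF sm2 pos])
  then show "(\<Sum>\<^sub>\<infinity>n\<in>UNIV. w n * (\<Sum>\<^sub>\<infinity>\<tau>\<in>UNIV. g n \<tau>) ^ p) \<le> R" using R by simp
qed

lemma weighted_infsum_eq:
  fixes g :: "int \<Rightarrow> int \<Rightarrow> real"
  assumes w: "\<And>n. 0 < w n" and g: "\<And>n \<tau>. 0 \<le> g n \<tau>"
    and sm: "\<forall>n. g n summable_on UNIV" "(\<lambda>n. w n * (\<Sum>\<^sub>\<infinity>\<tau>\<in>UNIV. g n \<tau>) ^ p) summable_on UNIV"
  shows "(\<Sum>\<^sup>+n. ennreal (w n) * (\<Sum>\<^sup>+\<tau>. ennreal (g n \<tau>)) ^ p)
    = ennreal ((sqrt (\<Sum>\<^sub>\<infinity>n\<in>UNIV. w n * (\<Sum>\<^sub>\<infinity>\<tau>\<in>UNIV. g n \<tau>) ^ p))^2)"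
proof -
  have pos: "0 \<le> w n * (\<Sum>\<^sub>\<infinity>\<tau>\<in>UNIV. g n \<tau>) ^ p" for n
    using w[of n] g by (simp add: infsum_nonneg)
  have "ennreal (w n * (\<Sum>\<^sub>\<infinity>\<tau>\<in>UNIV. g n \<tau>) ^ p) = ennreal (w n) * (\<Sum>\<^sup>+\<tau>. ennreal (g n \<tau>)) ^ p" for n
    using w[of n] g sm(1) by (simp add: ennreal_mult infsum_nonneg ennreal_power[symmetric] ennreal_infsum_eq_nnsum)
  then show ?thesis
    using ennreal_infsum_eq_nnsum[OF sm(2) pos] pos by (simp add: infsum_nonneg)
qed

lemma X_space_nnsum:
  assumes "u \<in> X_space s b"
  shows "(\<Sum>\<^sup>+n. ennreal (jbr n powr (2 * s)) * (\<Sum>\<^sup>+\<tau>. ennreal (X_term b u n \<tau>))) = ennreal ((X_norm s b u)^2)"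
  using assms weighted_infsum_eq[of "\<lambda>n. jbr n powr (2 * s)" "X_term b u" 1]
  by (auto simp: X_space_def X_norm_def X_term_def jbr_pos less_imp_neq[symmetric])

lemma Y_space_nnsum:
  assumes "u \<in> Y_space s b"
  shows "(\<Sum>\<^sup>+n. ennreal (jbr n powr (2 * s)) * (\<Sum>\<^sup>+\<tau>. ennreal (Y_term b u n \<tau>))^2) = ennreal ((Y_norm s b u)^2)"
  using assms weighted_infsum_eq[of "\<lambda>n. jbr n powr (2 * s)" "Y_term b u" 2]
  by (auto simp: Y_space_def Y_norm_def Y_term_def jbr_pos less_imp_neq[symmetric])

lemma X_spaceI:
  assumes "torus_integrable u" "0 \<le> R"
    and "(\<Sum>\<^sup>+n. ennreal (jbr n powr (2 * s)) * (\<Sum>\<^sup>+\<tau>. ennreal (X_term b u n \<tau>))) \<le> ennreal (R^2)"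
  shows "u \<in> X_space s b" "X_norm s b u \<le> R"
  using assms weighted_infsum_bound[of "\<lambda>n. jbr n powr (2 * s)" "X_term b u" "R^2" 1]
  by (auto simp: X_space_def X_norm_def X_term_def jbr_pos less_imp_neq[symmetric] intro!: real_le_lsqrt)

lemma Y_spaceI:
  assumes "torus_integrable u" "0 \<le> R"
    and "(\<Sum>\<^sup>+n. ennreal (jbr n powr (2 * s)) * (\<Sum>\<^sup>+\<tau>. ennreal (Y_term b u n \<tau>))^2) \<le> ennreal (R^2)"
  shows "u \<in> Y_space s b" "Y_norm s b u \<le> R"
  using assms weighted_infsum_bound[of "\<lambda>n. jbr n powr (2 * s)" "Y_term b u" "R^2" 2]
  by (auto simp: Y_space_def Y_norm_def Y_term_def jbr_pos less_imp_neq[symmetric] intro!: real_le_lsqrt)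

lemma X_norm_nonneg: "0 \<le> X_norm s b u"
  unfolding X_norm_def X_term_def by (intro real_sqrt_ge_zero infsum_nonneg mult_nonneg_nonneg) auto

lemma Y_norm_nonneg: "0 \<le> Y_norm s b u"
  unfolding Y_norm_def by (intro real_sqrt_ge_zero infsum_nonneg mult_nonneg_nonneg) auto

lemma powr_sq: "0 < x \<Longrightarrow> (x powr s)^2 = x powr (2 * s)" for x :: real
  by (simp add: powr_powr mult.commute flip: powr_numeral)

section \<open>The weighted trilinear estimate\<close>

text \<open>The gain is applied at each spatial frequency with \<open>p = P n\<close>. When
  \<open>a\<close> consists of the absolute values of the coefficients of \<open>u\<close>, the two
  terms on the right are the squared \<open>Y\<close> and \<open>X\<close> norms.\<close>

lemma smeared_weighted_bound:
  assumes T: "0 < T" "T < 1"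
  shows "(\<Sum>\<^sup>+k. ennreal (modulation k powr (2/3)) * (ennreal (jbr (fst k) powr s) * smeared T a k)^2)
    \<le> ennreal (72 * T powr (1/3)) *
      ((\<Sum>\<^sup>+n. ennreal (jbr n powr (2 * s)) * (\<Sum>\<^sup>+\<tau>. a (n, \<tau>))^2) +
       (\<Sum>\<^sup>+n. ennreal (jbr n powr (2 * s)) * (\<Sum>\<^sup>+\<tau>. ennreal (jbr (\<tau> - P n)) * a (n, \<tau>) ^ 2)))"
proof -
  have "(\<Sum>\<^sup>+k. ennreal (modulation k powr (2/3)) * (ennreal (jbr (fst k) powr s) * smeared T a k)^2)
    = (\<Sum>\<^sup>+n. \<Sum>\<^sup>+\<tau>. ennreal (jbr n powr (2 * s)) * (ennreal (jbr (\<tau> - P n) powr (2/3)) * smeared T a (n, \<tau>) ^ 2))"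
    by (subst nnsum_pair[symmetric])
      (simp add: modulation_def power_mult_distrib ennreal_power powr_sq jbr_pos mult.left_commute)
  also have "\<dots> \<le> (\<Sum>\<^sup>+n. ennreal (jbr n powr (2 * s)) * (ennreal (72 * T powr (1/3)) *
      ((\<Sum>\<^sup>+\<tau>. a (n, \<tau>))^2 + (\<Sum>\<^sup>+\<tau>. ennreal (jbr (\<tau> - P n)) * a (n, \<tau>) ^ 2))))"
    unfolding nnsum_cmult(1)
  proof (intro nnsum_mono mult_left_mono)
    fix n
    show "(\<Sum>\<^sup>+\<tau>. ennreal (jbr (\<tau> - P n) powr (2/3)) * smeared T a (n, \<tau>) ^ 2)
      \<le> ennreal (72 * T powr (1/3)) * ((\<Sum>\<^sup>+\<tau>. a (n, \<tau>))^2 + (\<Sum>\<^sup>+\<tau>. ennreal (jbr (\<tau> - P n)) * a (n, \<tau>) ^ 2))"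
      unfolding smeared_def fst_conv snd_conv by (rule lorentz_convolution_gain[OF T])
  qed auto
  also have "\<dots> = ennreal (72 * T powr (1/3)) *
      ((\<Sum>\<^sup>+n. ennreal (jbr n powr (2 * s)) * (\<Sum>\<^sup>+\<tau>. a (n, \<tau>))^2) +
       (\<Sum>\<^sup>+n. ennreal (jbr n powr (2 * s)) * (\<Sum>\<^sup>+\<tau>. ennreal (jbr (\<tau> - P n)) * a (n, \<tau>) ^ 2)))"
    unfolding mult.left_commute[of "ennreal (jbr _ powr (2 * s))"] distrib_left[of "ennreal (jbr _ powr (2 * s))"]
    by (simp only: nnsum_cmult(1) nnsum_add)
  finally show ?thesis .
qed

lemma jbr_powr_submultiplicative:
  assumes "0 \<le> s" "n = l + m - j"
  shows "jbr n powr s \<le> jbr l powr s * (jbr m powr s * jbr j powr s)"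
proof -
  have "jbr n \<le> jbr l * (jbr m * jbr j)"
  proof -
    have "jbr n \<le> jbr l * jbr (m - j)" using jbr_add_mult_le[of l "m - j"] assms(2) by (simp add: add_diff_eq)
    also have "\<dots> \<le> jbr l * (jbr m * jbr j)"
      using jbr_add_mult_le[of m "- j"] jbr_pos[of l] by (intro mult_left_mono) (auto simp: jbr_minus)
    finally show ?thesis .
  qed
  then have "jbr n powr s \<le> (jbr l * (jbr m * jbr j)) powr s"
    using assms(1) jbr_pos[of n] by (intro powr_mono2) auto
  then show ?thesis by (simp add: powr_mult jbr_pos less_imp_le)
qed

lemma cubic_majorant_weighted_le:
  assumes "0 \<le> s"
  shows "ennreal (jbr (fst k) powr s) * cubic_majorant T a k
    \<le> (\<Sum>\<^sup>+k2. (ennreal (jbr (fst k2) powr s) * a k2) * (\<Sum>\<^sup>+k3. (ennreal (jbr (fst k3) powr s) * a k3) *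
        (ennreal (jbr (fst (k + k2 - k3)) powr s) * smeared T a (k + k2 - k3))))"
  unfolding cubic_majorant_def nnsum_cmult(1)[symmetric]
proof (intro nnsum_mono)
  fix k2 k3
  define J where "J l = ennreal (jbr (fst l) powr s)" for l :: "int \<times> int"
  have "jbr (fst k) powr s \<le> jbr (fst k3) powr s * (jbr (fst (k + k2 - k3)) powr s * jbr (fst k2) powr s)"
    by (rule jbr_powr_submultiplicative[OF assms]) simp
  then have "J k \<le> J k3 * (J (k + k2 - k3) * J k2)"
    unfolding J_def by (simp add: ennreal_mult[symmetric] ennreal_leI)
  then have "J k * (a k2 * (a k3 * smeared T a (k + k2 - k3)))
      \<le> (J k3 * (J (k + k2 - k3) * J k2)) * (a k2 * (a k3 * smeared T a (k + k2 - k3)))"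
    by (rule mult_right_mono) simp
  then show "J k * (a k2 * (a k3 * smeared T a (k + k2 - k3)))
      \<le> (J k2 * a k2) * ((J k3 * a k3) * (J (k + k2 - k3) * smeared T a (k + k2 - k3)))"
    by (simp only: mult_ac)
qed

text \<open>This uses the room between the exponents: \<open>1 = 2/3 + 1/3\<close>, and the weight
  of exponent \<open>-2/3\<close> is square summable because \<open>4/3 > 1\<close>. So the bound in
  \<open>X\<close> of exponent \<open>-1/3\<close> also controls the \<open>Y\<close> part.\<close>

lemma Y_le_X_weighted:
  obtains C where "C \<ge> 0" "\<And>f :: int \<Rightarrow> real. \<And>p. (\<And>\<tau>. 0 \<le> f \<tau>) \<Longrightarrow>
    (\<Sum>\<^sup>+\<tau>. ennreal (jbr (\<tau> - p) powr (-1) * f \<tau>))^2 \<le> ennreal C * (\<Sum>\<^sup>+\<tau>. ennreal (f \<tau> ^ 2 / jbr (\<tau> - p) powr (2/3)))"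
proof -
  obtain C where C: "C \<ge> 0" "(\<Sum>\<^sup>+j. ennreal (jbr j powr - (4/3))) \<le> ennreal C"
    using nnsum_jbr_powr[of "4/3"] by auto
  have "(\<Sum>\<^sup>+\<tau>. ennreal (jbr (\<tau> - p) powr (-1) * f \<tau>))^2 \<le> ennreal C * (\<Sum>\<^sup>+\<tau>. ennreal (f \<tau> ^ 2 / jbr (\<tau> - p) powr (2/3)))"
    if f: "\<And>\<tau>. 0 \<le> f \<tau>" for f :: "int \<Rightarrow> real" and p
  proof -
    have "jbr (\<tau> - p) powr (-1) * f \<tau> = jbr (\<tau> - p) powr (-2/3) * (jbr (\<tau> - p) powr (-1/3) * f \<tau>)" for \<tau>
      by (simp add: mult.assoc[symmetric] powr_add[symmetric])
    then have "(\<Sum>\<^sup>+\<tau>. ennreal (jbr (\<tau> - p) powr (-1) * f \<tau>))^2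
      = (\<Sum>\<^sup>+\<tau>. ennreal (jbr (\<tau> - p) powr (-2/3)) * ennreal (jbr (\<tau> - p) powr (-1/3) * f \<tau>))^2"
      using f by (simp add: ennreal_mult)
    also have "\<dots> \<le> (\<Sum>\<^sup>+\<tau>. ennreal (jbr (\<tau> - p) powr (-2/3))^2) * (\<Sum>\<^sup>+\<tau>. ennreal (jbr (\<tau> - p) powr (-1/3) * f \<tau>)^2)"
      by (rule nnsum_Cauchy_Schwarz)
    also have "(\<Sum>\<^sup>+\<tau>. ennreal (jbr (\<tau> - p) powr (-2/3))^2) = (\<Sum>\<^sup>+j. ennreal (jbr j powr - (4/3)))"
      using nnsum_shift(2)[of "\<lambda>j. ennreal (jbr j powr - (4/3))" p] by (simp add: ennreal_power powr_sq jbr_pos)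
    also have "(\<Sum>\<^sup>+\<tau>. ennreal (jbr (\<tau> - p) powr (-1/3) * f \<tau>)^2) = (\<Sum>\<^sup>+\<tau>. ennreal (f \<tau> ^ 2 / jbr (\<tau> - p) powr (2/3)))"
      using f by (simp add: ennreal_power power_mult_distrib powr_sq jbr_pos powr_minus_divide power_divide)
    also have "(\<Sum>\<^sup>+j. ennreal (jbr j powr - (4/3))) * (\<Sum>\<^sup>+\<tau>. ennreal (f \<tau> ^ 2 / jbr (\<tau> - p) powr (2/3)))
      \<le> ennreal C * (\<Sum>\<^sup>+\<tau>. ennreal (f \<tau> ^ 2 / jbr (\<tau> - p) powr (2/3)))"
      by (intro mult_right_mono C) auto
    finally show ?thesis .
  qed
  then show ?thesis using that C(1) by blast
qed

text \<open>In terms of the \<open>X\<close> part \<open>x\<close> and the \<open>Y\<close> part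
  \<open>y\<close> of the norm, the two factors without cutoff contribute \<open>x^4\<close> and the
  smeared one \<open>T powr (1/3) * (x^2 + y^2)\<close>. The estimate is for squares, hence
  \<open>T powr (1/3)\<close> and the sixth power.\<close>

lemma fourier_coeff_cubic_weighted_bound:
  fixes s :: real
  assumes s: "0 \<le> s" and "bump \<eta>"
  obtains K where "K \<ge> 0" "\<And>T u. 0 < T \<Longrightarrow> T < 1 \<Longrightarrow> u \<in> Z_space s (1/2) \<Longrightarrow>
    torus_integrable (cutoff_cubic \<eta> T u) \<and>
    (\<Sum>\<^sup>+k. ennreal ((jbr (fst k) powr s * norm (fourier_coeff (cutoff_cubic \<eta> T u) (fst k) (snd k)))^2 / modulation k powr (2/3)))
      \<le> ennreal (K * T powr (1/3) * Z_norm s (1/2) u ^ 6)"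
proof -
  obtain C1 where C1: "C1 \<ge> 0"
    "\<And>K. (\<Sum>\<^sup>+k. ennreal (1 / modulation k powr (2/3) * (1 / modulation (K - k)))) \<le> ennreal C1"
    using modulation_kernel_bound by blast
  obtain C2 where C2: "C2 \<ge> 0"
    "\<And>T u. 0 < T \<Longrightarrow> T < 1 \<Longrightarrow> torus_integrable u \<Longrightarrow>
      (\<Sum>\<^sup>+k. ennreal (modulation k) * ennreal (norm (fourier_coeff u (fst k) (snd k))) ^ 2) < \<infinity> \<Longrightarrow>
      torus_integrable (cutoff_cubic \<eta> T u) \<and>
      (\<forall>n \<tau>. ennreal (norm (fourier_coeff (cutoff_cubic \<eta> T u) n \<tau>))
        \<le> ennreal C2 * cubic_majorant T (\<lambda>k. ennreal (norm (fourier_coeff u (fst k) (snd k)))) (n, \<tau>))"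
    using fourier_coeff_cutoff_cubic[OF \<open>bump \<eta>\<close>] by blast
  \<comment> \<open>\<open>72\<close> comes from the gain of the cutoff, \<open>C1\<close> from the
    kernel used for the product and for its dual, and \<open>C2\<close> from the majorant of the
    coefficients.\<close>
  define K where "K = 72 * C1^2 * C2^2"
  have "torus_integrable (cutoff_cubic \<eta> T u) \<and>
    (\<Sum>\<^sup>+k. ennreal ((jbr (fst k) powr s * norm (fourier_coeff (cutoff_cubic \<eta> T u) (fst k) (snd k)))^2 / modulation k powr (2/3)))
      \<le> ennreal (K * T powr (1/3) * Z_norm s (1/2) u ^ 6)"
    if T: "0 < T" "T < 1" and u: "u \<in> Z_space s (1/2)" for T u
  proof -
    define a where "a k = ennreal (norm (fourier_coeff u (fst k) (snd k)))" for k
    define f where "f k = jbr (fst k) powr s * norm (fourier_coeff (cutoff_cubic \<eta> T u) (fst k) (snd k))" for k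
    define x where "x = X_norm s (1/2) u"
    define y where "y = Y_norm s 0 u"
    have x: "0 \<le> x" and y: "0 \<le> y" by (simp_all add: x_def y_def X_norm_nonneg Y_norm_nonneg)
    have uX: "u \<in> X_space s (1/2)" and uY: "u \<in> Y_space s 0" using u by (auto simp: Z_space_def)
    have int: "torus_integrable u" using uX by (simp add: X_space_def)
    have X: "(\<Sum>\<^sup>+n. ennreal (jbr n powr (2 * s)) * (\<Sum>\<^sup>+\<tau>. ennreal (jbr (\<tau> - P n)) * a (n, \<tau>) ^ 2)) = ennreal (x^2)"
      using X_space_nnsum[OF uX]
      by (simp add: x_def X_term_def a_def ennreal_mult ennreal_power jbr_pos less_imp_le)
    have Y: "(\<Sum>\<^sup>+n. ennreal (jbr n powr (2 * s)) * (\<Sum>\<^sup>+\<tau>. a (n, \<tau>))^2) = ennreal (y^2)"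
      using Y_space_nnsum[OF uY]
      by (simp add: y_def Y_term_def a_def jbr_pos less_imp_neq[symmetric])
    have Xw: "(\<Sum>\<^sup>+k. ennreal (modulation k) * (ennreal (jbr (fst k) powr s) * a k)^2) = ennreal (x^2)"
      unfolding X[symmetric] nnsum_cmult(1)[symmetric]
      by (subst nnsum_pair[symmetric])
        (simp add: modulation_def power_mult_distrib ennreal_power powr_sq jbr_pos mult.left_commute)
    \<comment> \<open>The passage from partial sums to \<open>u\<close> asks for a finite sum
      without spatial weight; it is finite because \<open>jbr (fst k) powr s\<close> is at least
      \<open>1\<close>.\<close>
    have "(\<Sum>\<^sup>+k. ennreal (modulation k) * a k ^ 2)
        \<le> (\<Sum>\<^sup>+k. ennreal (modulation k) * (ennreal (jbr (fst k) powr s) * a k)^2)"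
    proof (intro nnsum_mono mult_left_mono power_mono)
      fix k :: "int \<times> int"
      have "1 \<le> ennreal (jbr (fst k) powr s)"
        using ge_one_powr_ge_zero[OF jbr_ge_1 s] by (simp add: ennreal_ge_1)
      from mult_right_mono[OF this, of "a k"] show "a k \<le> ennreal (jbr (fst k) powr s) * a k" by simp
    qed auto
    then have "(\<Sum>\<^sup>+k. ennreal (modulation k) * a k ^ 2) < \<infinity>"
      unfolding Xw by (rule order_le_less_trans) simp
    then have fin: "(\<Sum>\<^sup>+k. ennreal (modulation k) * ennreal (norm (fourier_coeff u (fst k) (snd k))) ^ 2) < \<infinity>"
      unfolding a_def .
    note F = C2(2)[OF T int fin]
    define A where "A k = ennreal (jbr (fst k) powr s) * a k" for k
    define V where "V k = ennreal C2 * (ennreal (jbr (fst k) powr s) * smeared T a k)" for k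
    have f: "ennreal (f k) \<le> (\<Sum>\<^sup>+k2. A k2 * (\<Sum>\<^sup>+k3. A k3 * V (k + k2 - k3)))" for k
    proof -
      have "ennreal (f k) \<le> ennreal (jbr (fst k) powr s) * (ennreal C2 * cubic_majorant T a k)"
        using conjunct2[OF F, rule_format, of "fst k" "snd k"]
        unfolding f_def a_def[abs_def] by (subst ennreal_mult) (auto intro!: mult_left_mono)
      also have "\<dots> \<le> ennreal C2 * (\<Sum>\<^sup>+k2. A k2 * (\<Sum>\<^sup>+k3. A k3 *
        (ennreal (jbr (fst (k + k2 - k3)) powr s) * smeared T a (k + k2 - k3))))"
        unfolding A_def mult.left_commute[of "ennreal (jbr (fst k) powr s)"]
        by (intro mult_left_mono cubic_majorant_weighted_le s) simp
      also have "\<dots> = (\<Sum>\<^sup>+k2. A k2 * (\<Sum>\<^sup>+k3. A k3 * V (k + k2 - k3)))"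
        unfolding V_def mult.left_commute[of _ "ennreal C2"] nnsum_cmult(1) ..
      finally show ?thesis .
    qed
    have "(\<Sum>\<^sup>+k. ennreal (f k ^ 2 / modulation k powr (2/3)))
        \<le> ennreal C1 ^ 2 * (\<Sum>\<^sup>+k. ennreal (modulation k) * A k ^ 2)^2 * (\<Sum>\<^sup>+k. ennreal (modulation k powr (2/3)) * V k ^ 2)"
      by (rule nnsum_weighted_trilinear[OF _ modulation_pos C1(2) _ f])
        (auto simp: f_def modulation_pos less_imp_neq[symmetric])
    also have "(\<Sum>\<^sup>+k. ennreal (modulation k) * A k ^ 2) = ennreal (x^2)"
      unfolding A_def by (rule Xw)
    also have "(\<Sum>\<^sup>+k. ennreal (modulation k powr (2/3)) * V k ^ 2)
        = ennreal C2 ^ 2 * (\<Sum>\<^sup>+k. ennreal (modulation k powr (2/3)) * (ennreal (jbr (fst k) powr s) * smeared T a k)^2)"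
      unfolding V_def by (subst nnsum_cmult(1)[symmetric]) (simp only: power_mult_distrib[of "ennreal C2"] mult.left_commute)
    also have "ennreal C1 ^ 2 * ennreal (x^2)^2 * \<dots> \<le> ennreal C1 ^ 2 * ennreal (x^2)^2 *
        (ennreal C2 ^ 2 * (ennreal (72 * T powr (1/3)) * (ennreal (y^2) + ennreal (x^2))))"
      unfolding X[symmetric] Y[symmetric] by (intro mult_left_mono smeared_weighted_bound T) auto
    also have "\<dots> = ennreal (K * T powr (1/3) * (x^4 * (x^2 + y^2)))"
    proof -
      have "ennreal C1 ^ 2 * ennreal (x^2)^2 * (ennreal C2 ^ 2 * (ennreal (72 * T powr (1/3)) * (ennreal (y^2) + ennreal (x^2))))
        = ennreal (C1^2 * (x^2)^2 * (C2^2 * (72 * T powr (1/3) * (y^2 + x^2))))"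
        using C1(1) C2(1) by (simp add: ennreal_mult ennreal_power ennreal_plus del: ennreal_numeral)
      also have "C1^2 * (x^2)^2 * (C2^2 * (72 * T powr (1/3) * (y^2 + x^2))) = K * T powr (1/3) * (x^4 * (x^2 + y^2))"
        by (simp add: K_def algebra_simps)
      finally show ?thesis .
    qed
    also have "\<dots> \<le> ennreal (K * T powr (1/3) * Z_norm s (1/2) u ^ 6)"
    proof (intro ennreal_leI mult_left_mono)
      have "x^4 * (x^2 + y^2) \<le> (x + y)^4 * (x + y)^2"
        using x y by (intro mult_mono power_mono) (auto simp: power2_eq_square algebra_simps)
      also have "\<dots> = (x + y)^6" by (simp add: power_add[symmetric])
      finally show "x^4 * (x^2 + y^2) \<le> Z_norm s (1/2) u ^ 6" by (simp add: Z_norm_def x_def y_def)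
    qed (simp add: K_def)
    finally show ?thesis using F unfolding f_def by blast
  qed
  moreover have "K \<ge> 0" by (simp add: K_def)
  ultimately show ?thesis using that by blast
qed

theorem lemma4p4:
  fixes s :: real and \<eta> :: "real \<Rightarrow> real"
  assumes "s \<ge> 1/2" and "bump \<eta>"
  shows "\<exists>C :: real. \<forall>T u. 0 < T \<and> T < 1 \<and> u \<in> Z_space s (1/2) \<longrightarrow>
           cutoff_cubic \<eta> T u \<in> Z_space s (-1/2) \<and>
           Z_norm s (-1/2) (cutoff_cubic \<eta> T u) \<le> C * T powr (1/6) * (Z_norm s (1/2) u)^3"
proof -
  have "0 \<le> s" using assms(1) by simp
  then obtain K where K: "K \<ge> 0" "\<And>T u. 0 < T \<Longrightarrow> T < 1 \<Longrightarrow> u \<in> Z_space s (1/2) \<Longrightarrow>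
    torus_integrable (cutoff_cubic \<eta> T u) \<and>
    (\<Sum>\<^sup>+k. ennreal ((jbr (fst k) powr s * norm (fourier_coeff (cutoff_cubic \<eta> T u) (fst k) (snd k)))^2 / modulation k powr (2/3)))
      \<le> ennreal (K * T powr (1/3) * Z_norm s (1/2) u ^ 6)"
    using fourier_coeff_cubic_weighted_bound[OF _ assms(2)] by blast
  obtain L where L: "L \<ge> 0" "\<And>f :: int \<Rightarrow> real. \<And>p. (\<And>\<tau>. 0 \<le> f \<tau>) \<Longrightarrow>
    (\<Sum>\<^sup>+\<tau>. ennreal (jbr (\<tau> - p) powr (-1) * f \<tau>))^2 \<le> ennreal L * (\<Sum>\<^sup>+\<tau>. ennreal (f \<tau> ^ 2 / jbr (\<tau> - p) powr (2/3)))"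
    using Y_le_X_weighted by blast
  have "cutoff_cubic \<eta> T u \<in> Z_space s (-1/2) \<and>
      Z_norm s (-1/2) (cutoff_cubic \<eta> T u) \<le> (sqrt K + sqrt (L * K)) * T powr (1/6) * (Z_norm s (1/2) u)^3"
    if T: "0 < T" "T < 1" and u: "u \<in> Z_space s (1/2)" for T u
  proof -
    define F where "F = cutoff_cubic \<eta> T u"
    define z where "z = Z_norm s (1/2) u"
    have z: "0 \<le> z" by (simp add: z_def Z_norm_def X_norm_nonneg Y_norm_nonneg)
    define h where "h n \<tau> = norm (fourier_coeff F n \<tau>) ^ 2 / jbr (\<tau> - P n) powr (2/3)" for n \<tau>
    \<comment> \<open>Apart from \<open>K\<close>, \<open>R\<close> is the square root of the bound;
      this halves \<open>T powr (1/3)\<close> to \<open>T powr (1/6)\<close> and the sixth power to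
      the third.\<close>
    define R where "R = T powr (1/6) * z^3"
    have R: "0 \<le> R" using z by (simp add: R_def)
    have R2: "R^2 = T powr (1/3) * z^6"
      using T by (simp add: R_def power_mult_distrib powr_sq power_mult[symmetric])
    have int: "torus_integrable F"
      and "(\<Sum>\<^sup>+k. ennreal ((jbr (fst k) powr s * norm (fourier_coeff F (fst k) (snd k)))^2 / modulation k powr (2/3))) \<le> ennreal (K * R^2)"
      using K(2)[OF T u] by (simp_all add: F_def R2 z_def mult.assoc)
    then have main: "(\<Sum>\<^sup>+n. ennreal (jbr n powr (2 * s)) * (\<Sum>\<^sup>+\<tau>. ennreal (h n \<tau>))) \<le> ennreal (K * R^2)"
      unfolding nnsum_cmult(1)[symmetric]
      by (subst (asm) nnsum_pair[symmetric])
        (simp add: modulation_def h_def ennreal_mult[symmetric] power_mult_distrib powr_sq jbr_pos)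
    \<comment> \<open>As \<open>jbr\<close> is at least \<open>1\<close>, the weight of exponent
      \<open>-1\<close> in the \<open>X\<close> sum is below the weight of exponent
      \<open>-2/3\<close> that \<open>main\<close> already bounds.\<close>
    have "(\<Sum>\<^sup>+n. ennreal (jbr n powr (2 * s)) * (\<Sum>\<^sup>+\<tau>. ennreal (X_term (-1/2) F n \<tau>))) \<le> ennreal (K * R^2)"
    proof (rule order_trans[OF _ main], intro nnsum_mono mult_left_mono ennreal_leI)
      fix n \<tau>
      have "jbr (\<tau> - P n) powr (-1) \<le> jbr (\<tau> - P n) powr (-(2/3))"
        by (intro powr_mono jbr_ge_1) auto
      then have "jbr (\<tau> - P n) powr (-1) * norm (fourier_coeff F n \<tau>) ^ 2
          \<le> jbr (\<tau> - P n) powr (-(2/3)) * norm (fourier_coeff F n \<tau>) ^ 2"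
        by (rule mult_right_mono) simp
      moreover have "X_term (-1/2) F n \<tau> = jbr (\<tau> - P n) powr (-1) * norm (fourier_coeff F n \<tau>) ^ 2"
        by (simp add: X_term_def)
      moreover have "h n \<tau> = jbr (\<tau> - P n) powr (-(2/3)) * norm (fourier_coeff F n \<tau>) ^ 2"
        by (simp add: h_def powr_minus_divide)
      ultimately show "X_term (-1/2) F n \<tau> \<le> h n \<tau>" by simp
    qed auto
    then have X: "F \<in> X_space s (-1/2)" "X_norm s (-1/2) F \<le> sqrt K * R"
      using X_spaceI[OF int, of "sqrt K * R" s "-1/2"] K(1) R by (simp_all add: power_mult_distrib)
    \<comment> \<open>The \<open>Y\<close> part of \<open>Z_space s (-1/2)\<close> has exponent
      \<open>-1/2 - 1/2 = -1\<close>.\<close>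
    have "(\<Sum>\<^sup>+n. ennreal (jbr n powr (2 * s)) * (\<Sum>\<^sup>+\<tau>. ennreal (Y_term (-1) F n \<tau>))^2)
        \<le> (\<Sum>\<^sup>+n. ennreal L * (ennreal (jbr n powr (2 * s)) * (\<Sum>\<^sup>+\<tau>. ennreal (h n \<tau>))))"
      unfolding mult.left_commute[of "ennreal L"] Y_term_def h_def
      by (intro nnsum_mono mult_left_mono L(2)) auto
    also have "\<dots> \<le> ennreal L * ennreal (K * R^2)"
      unfolding nnsum_cmult(1) by (intro mult_left_mono main) simp
    also have "\<dots> = ennreal ((sqrt (L * K) * R)^2)"
      using L(1) K(1) by (simp add: ennreal_mult[symmetric] power_mult_distrib mult.assoc)
    finally have Y: "F \<in> Y_space s (-1)" "Y_norm s (-1) F \<le> sqrt (L * K) * R"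
      using Y_spaceI[OF int, of "sqrt (L * K) * R" s "-1"] L(1) K(1) R by simp_all
    have "F \<in> Z_space s (-1/2)" using X(1) Y(1) by (simp add: Z_space_def)
    moreover have "Z_norm s (-1/2) F \<le> sqrt K * R + sqrt (L * K) * R"
      using X(2) Y(2) by (simp add: Z_norm_def)
    ultimately show ?thesis
      unfolding F_def[symmetric] z_def[symmetric] R_def by (simp only: distrib_right mult.assoc)
  qed
  then show ?thesis by blast
qed

end
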